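(* Let $p>1$, $q>\max\{p-1,1\}$, $V\in L^1_{loc}(\Omega\times[0,+\infty))$ with $V>0$ a.e. in $\Omega\times(0,+\infty)$, and $u_0\in L^1_{loc}(\Omega)$ with $u_0\ge 0$ a.e. in $\Omega$. Set $$\bar s_1:=\frac{q}{q-1}\theta_2,\quad \bar s_2:=\frac{1}{q-1},\quad \bar s_3:=\frac{pq}{q-p+1}\theta_2,\quad \bar s_4:=\frac{p-1}{q-p+1}.$$ Assume that there exist constants $\theta_1\ge 1$, $\theta_2\ge 1$ (the $\theta_2$ entering $\bar s_1,\bar s_3$), $C_0\ge 0$, $C>0$, $\delta_0\in(0,1)$ and $\varepsilon_0>0$ such that, with $E_\delta:=\{(x,t)\in\Omega\times[0,+\infty): d(x)^{-\theta_2}+t^{\theta_1}\le\delta^{-\theta_2}\}$ for $\delta>0$, the following hold for every $\delta\in(0,\delta_0)$ and every $\varepsilon\in(0,\varepsilon_0)$: (i) $$\int_{E_{\delta/2}\setminus E_{\delta}} t^{(\theta_1-1)\left(\frac{q}{q-1}-\varepsilon\right)}V^{-\frac{1}{q-1}+\varepsilon}\,dx\,dt\le C\,\delta^{-\bar s_1-C_0\varepsilon}|\log\delta|^{\bar s_2},$$ $$\int_{E_{\delta/2}\setminus E_{\delta}} t^{(\theta_1-1)\left(\frac{q}{q-1}+\varepsilon\right)}V^{-\frac{1}{q-1}-\varepsilon}\,dx\,dt\le C\,\delta^{-\bar s_1-C_0\varepsilon}|\log\delta|^{\bar s_2};$$ (ii) $$\int_{E_{\delta/2}\setminus E_{\delta}}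 d(x)^{-(\theta_2+1)p\left(\frac{q}{q-p+1}-\varepsilon\right)}V^{-\frac{p-1}{q-p+1}+\varepsilon}\,dx\,dt\le C\,\delta^{-\bar s_3-C_0\varepsilon}|\log\delta|^{\bar s_4},$$ $$\int_{E_{\delta/2}\setminus E_{\delta}} d(x)^{-(\theta_2+1)p\left(\frac{q}{q-p+1}+\varepsilon\right)}V^{-\frac{p-1}{q-p+1}-\varepsilon}\,dx\,dt\le C\,\delta^{-\bar s_3-C_0\varepsilon}|\log\delta|^{\bar s_4}.$$ If $u$ is a nonnegative weak solution of $$\begin{cases}\partial_t u-\operatorname{div}(|\nabla u|^{p-2}\nabla u)\ge V u^q&\text{in }\Omega\times(0,+\infty),\\ u=0&\text{on }\partial\Omega\times(0,+\infty),\\ u=u_0&\text{in }\Omega\times\{0\},\end{cases}$$ then $u=0$ a.e. in $\Omega\times[0,+\infty)$.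
   Context: $\Omega\subset\mathbb{R}^N$, $N\ge 3$, is an open bounded connected set, and $d(x):=\operatorname{dist}(x,\partial\Omega)$ for $x\in\overline\Omega$. Weak solution: a function $u\in W^{1,p}_{loc}(\Omega\times[0,+\infty))\cap L^q_{loc}(\Omega\times[0,+\infty),V\,dx\,dt)$ is a weak solution of the problem in the claim if $u\ge 0$ a.e. in $\Omega\times(0,+\infty)$ and for every $\varphi\in\operatorname{Lip}(\Omega\times[0,\infty))$ with $\varphi\ge 0$ and with compact support in $\Omega\times[0,\infty)$ one has $$\int_0^{\infty}\!\int_{\Omega}Vu^q\varphi\,dx\,dt\le\int_0^{\infty}\!\int_{\Omega}|\nabla u|^{p-2}\langle\nabla u,\nabla\varphi\rangle\,dx\,dt-\int_0^{\infty}\!\int_{\Omega}u\,\partial_t\varphi\,dx\,dt-\int_{\Omega}u_0\,\varphi(x,0)\,dx.$$ Here $\nabla$ is the gradient in the $x$ variable. *)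

theory Defs
  imports "HOL-Analysis.Analysis"
begin

text \<open>The weighted space \<open>L^p_loc(S, w dx)\<close>: integrability is required on the compact subsets of
  \<open>S\<close>, which need not be open. For \<open>S = \<Omega> \<times> [0,\<infinity>)\<close> these compact sets may touch \<open>t = 0\<close>.\<close>

definition Lp_loc :: "real \<Rightarrow> ('b::euclidean_space \<Rightarrow> real) \<Rightarrow> 'b set \<Rightarrow> ('b \<Rightarrow> 'c::euclidean_space) \<Rightarrow> bool"
  where "Lp_loc p w S f \<longleftrightarrow>
    f \<in> borel_measurable (lebesgue_on S) \<and>
    (\<forall>K. compact K \<and> K \<subseteq> S \<longrightarrow> set_integrable lebesgue K (\<lambda>z. norm (f z) powr p * w z))"

text \<open>The value is unspecified at points where \<open>f\<close> is not differentiable; for Lipschitz \<open>f\<close>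
  these form a null set by Rademacher's theorem.\<close>

definition gradient :: "('b::euclidean_space \<Rightarrow> real) \<Rightarrow> 'b \<Rightarrow> 'b"
  where "gradient f x = (THE D. GDERIV f x :> D)"

primrec C_k :: "nat \<Rightarrow> ('b::euclidean_space \<Rightarrow> real) \<Rightarrow> bool"
  where
    "C_k 0 f \<longleftrightarrow> continuous_on UNIV f"
  | "C_k (Suc k) f \<longleftrightarrow> f differentiable_on UNIV \<and> (\<forall>b\<in>Basis. C_k k (\<lambda>x. gradient f x \<bullet> b))"

definition test_function :: "'b::euclidean_space set \<Rightarrow> ('b \<Rightarrow> real) \<Rightarrow> bool"
  where "test_function U \<phi> \<longleftrightarrow>
    (\<forall>k. C_k k \<phi>) \<and> compact (closure {z. \<phi> z \<noteq> 0}) \<and> closure {z. \<phi> z \<noteq> 0} \<subseteq> U"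

definition has_weak_gradient ::
  "'b::euclidean_space set \<Rightarrow> ('b \<Rightarrow> real) \<Rightarrow> ('b \<Rightarrow> 'b) \<Rightarrow> bool"
  where "has_weak_gradient U u G \<longleftrightarrow>
    Lp_loc 1 (\<lambda>_. 1) U u \<and> Lp_loc 1 (\<lambda>_. 1) U G \<and>
    (\<forall>\<phi>. test_function U \<phi> \<longrightarrow>
      set_lebesgue_integral lebesgue U (\<lambda>z. u z *\<^sub>R gradient \<phi> z)
        = - set_lebesgue_integral lebesgue U (\<lambda>z. \<phi> z *\<^sub>R G z))"

text \<open>\<open>u\<close> belongs to \<open>W^{1,p}_loc(S)\<close> and \<open>G\<close> represents its weak gradient (unique up to null sets).
  The weak derivatives are taken on \<open>interior S\<close>, the integrability is local on \<open>S\<close>.\<close>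

definition W1p_loc ::
  "real \<Rightarrow> 'b::euclidean_space set \<Rightarrow> ('b \<Rightarrow> real) \<Rightarrow> ('b \<Rightarrow> 'b) \<Rightarrow> bool"
  where "W1p_loc p S u G \<longleftrightarrow>
    Lp_loc p (\<lambda>_. 1) S u \<and> Lp_loc p (\<lambda>_. 1) S G \<and> has_weak_gradient (interior S) u G"

definition Lip_compact_support :: "'b::euclidean_space set \<Rightarrow> ('b \<Rightarrow> real) \<Rightarrow> bool"
  where "Lip_compact_support S \<phi> \<longleftrightarrow>
    (\<exists>L. L-lipschitz_on S \<phi>) \<and> (\<exists>K. compact K \<and> K \<subseteq> S \<and> (\<forall>z\<in>S - K. \<phi> z = 0))"

text \<open>\<open>G\<close> is the full space-time weak gradient of \<open>u\<close>; its first component is the weak gradient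
  in the \<open>x\<close> variable. The lateral condition \<open>u = 0\<close> on \<open>\<partial>\<Omega>\<close> is not encoded: weak
  solutions are tested only against functions with compact support in \<open>\<Omega> \<times> [0,\<infinity>)\<close>.\<close>

definition weak_solution ::
  "real \<Rightarrow> real \<Rightarrow> 'a::euclidean_space set \<Rightarrow> ('a \<times> real \<Rightarrow> real) \<Rightarrow> ('a \<Rightarrow> real)
    \<Rightarrow> ('a \<times> real \<Rightarrow> real) \<Rightarrow> bool"
  where "weak_solution p q \<Omega> V u0 u \<longleftrightarrow>
    Lp_loc q V (\<Omega> \<times> {0..}) u \<and>
    (AE z in lebesgue. z \<in> \<Omega> \<times> {0<..} \<longrightarrow> u z \<ge> 0) \<and>
    (\<exists>G. W1p_loc p (\<Omega> \<times> {0..}) u G \<and>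
      (\<forall>\<phi>. Lip_compact_support (\<Omega> \<times> {0..}) \<phi> \<and> (\<forall>z\<in>\<Omega> \<times> {0..}. \<phi> z \<ge> 0) \<longrightarrow>
        set_lebesgue_integral lebesgue (\<Omega> \<times> {0..}) (\<lambda>z. V z * u z powr q * \<phi> z)
        \<le> set_lebesgue_integral lebesgue (\<Omega> \<times> {0..})
             (\<lambda>(x, t). norm (fst (G (x, t))) powr (p - 2)
                * (fst (G (x, t)) \<bullet> gradient (\<lambda>y. \<phi> (y, t)) x))
          - set_lebesgue_integral lebesgue (\<Omega> \<times> {0..})
             (\<lambda>(x, t). u (x, t) * deriv (\<lambda>s. \<phi> (x, s)) t)
          - set_lebesgue_integral lebesgue \<Omega> (\<lambda>x. u0 x * \<phi> (x, 0))))"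

definition bdist :: "'a::euclidean_space set \<Rightarrow> 'a \<Rightarrow> real"
  where "bdist \<Omega> x = infdist x (frontier \<Omega>)"

definition E_set :: "'a::euclidean_space set \<Rightarrow> real \<Rightarrow> real \<Rightarrow> real \<Rightarrow> ('a \<times> real) set"
  where "E_set \<Omega> \<theta>1 \<theta>2 \<delta> =
    {(x, t). x \<in> \<Omega> \<and> 0 \<le> t \<and> bdist \<Omega> x powr (- \<theta>2) + t powr \<theta>1 \<le> \<delta> powr (- \<theta>2)}"

end

theory Submission
  imports Defs
begin

text \<open>Why the solution vanishes. The weak inequality is tested with \<open>h (u) \<psi>\<close>, where \<open>h (u) = 1 + \<lambda> (u +
  \<eta>)\<^sup>-\<^sup>\<gamma>\<close> and \<open>\<psi>\<close> is a cutoff. The constant part of \<open>h\<close> produces the mass of \<open>V u\<^sup>q \<psi>\<close>. The negative power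
  produces the energy \<open>\<lambda> \<gamma> |\<nabla>u|\<^sup>p (u + \<eta>)\<^sup>-\<^sup>\<gamma>\<^sup>-\<^sup>1 \<psi>\<close> on the same side of the inequality, into which Young's
  inequality absorbs every gradient term that the derivative of \<open>\<psi>\<close> creates. The remaining powers of \<open>u\<close> are
  absorbed into the mass. There remain integrals of \<open>V\<close> against powers of the derivatives of the cutoff
  whose exponents differ from the critical ones by \<open>O(\<gamma>)\<close>; for such exponents the hypotheses give bounds on
  the annuli \<open>E\<^sub>\<delta>\<^sub>/\<^sub>2 - E\<^sub>\<delta>\<close> (lemma \<open>energy_absorption_pointwise\<close>).

  The cutoff is logarithmic (lemma \<open>cutoff_exists\<close>): it descends from 1 to 0 over about \<open>n\<close> dyadic annuli
  with \<open>\<delta> = 2\<^sup>-\<^sup>k\<close> and \<open>k\<close> between \<open>n - 1\<close> and \<open>2 n\<close>, which gains a factor \<open>1 / n\<close> in its derivatives, and \<open>\<gamma> = 1 /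
  n\<close>. The powers of \<open>|log \<delta>|\<close> in the hypotheses are exactly those for which each annulus then contributes
  \<open>O(1 / n)\<close> (lemma \<open>annulus_integral_bound\<close>); the factor \<open>\<delta> powr (- C0 \<epsilon>)\<close> is bounded because \<open>\<epsilon>\<close> is of order \<open>1
  / n\<close>. The result, lemma \<open>cutoff_estimate\<close>, bounds the mass inside the cutoff by \<open>2 \<mu>\<close> times the mass in the
  annuli plus a quantity independent of \<open>n\<close>, which becomes small when first \<open>\<mu>\<close> is large and then \<open>\<lambda>\<close> small. A
  small \<open>\<mu>\<close> shows that the total mass is finite. Hence the mass in the annuli tends to zero, and the
  estimate, now with a large \<open>\<mu>\<close>, shows that the total mass is zero. As \<open>V\<close> is positive almost everywhere, \<open>u\<close>
  vanishes.

  Since \<open>u\<close> only has weak derivatives, the test function must be justified. The weak inequality is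
  evaluated at smooth kernels supported at positive times, which gives a pointwise differential
  inequality for the mollified solution. This is multiplied by \<open>h\<close> of the mollified solution times \<open>\<psi>\<close> and
  integrated by parts; the boundary term at \<open>t = 0\<close> has the right sign because the primitive of \<open>h\<close> is
  nonnegative. In the limit (lemma \<open>energy_inequality\<close>) only convergence in the mean of finitely many
  mollified functions is used, because Chebyshev's association inequality bounds the product of mollified
  flux and mollified gradient by the mollified energy density (lemma \<open>mollified_flux_le\<close>).\<close>

section \<open>Smooth mollifiers\<close>

lemma gradient_eq: "GDERIV f x :> D \<Longrightarrow> gradient f x = D"
  unfolding gradient_def
proof (rule the_equality)
  fix D' assume a: "GDERIV f x :> D" "GDERIV f x :> D'"
  then have "(\<lambda>h. h \<bullet> D) = (\<lambda>h. h \<bullet> D')"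
    unfolding gderiv_def by (rule has_derivative_unique)
  then have "\<forall>h. h \<bullet> D' = h \<bullet> D" by metis
  then show "D' = D" by (simp only: vector_eq_ldot)
qed

lemma GDERIV_exists:
  fixes f :: "'b::euclidean_space \<Rightarrow> real"
  assumes "f differentiable (at x)" shows "\<exists>D. GDERIV f x :> D"
proof -
  obtain f' where f': "(f has_derivative f') (at x)" using assms differentiable_def by blast
  interpret bounded_linear f' using f' has_derivative_bounded_linear by blast
  have "f' = (\<lambda>h. h \<bullet> (\<Sum>b\<in>Basis. f' b *\<^sub>R b))"
  proof
    fix h
    have "f' h = f' (\<Sum>b\<in>Basis. (h \<bullet> b) *\<^sub>R b)" by (simp add: euclidean_representation)
    also have "\<dots> = h \<bullet> (\<Sum>b\<in>Basis. f' b *\<^sub>R b)"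
      by (simp add: sum scaleR inner_sum_right mult.commute)
    finally show "f' h = h \<bullet> (\<Sum>b\<in>Basis. f' b *\<^sub>R b)" .
  qed
  then show ?thesis using f' unfolding gderiv_def by metis
qed

lemma GDERIV_gradient:
  fixes f :: "'b::euclidean_space \<Rightarrow> real"
  assumes "f differentiable (at x)" shows "GDERIV f x :> gradient f x"
  using GDERIV_exists[OF assms] gradient_eq by metis

lemma differentiable_if_GDERIV: "GDERIV f x :> D \<Longrightarrow> f differentiable (at x)"
  unfolding gderiv_def differentiable_def by blast

lemma C_k_SucI:
  assumes "\<And>x. GDERIV f x :> D x" "\<And>b. b \<in> Basis \<Longrightarrow> C_k k (\<lambda>x. D x \<bullet> b)"
  shows "C_k (Suc k) f"
  using assms by (auto simp: differentiable_on_def gradient_eq[OF assms(1)]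
      intro!: differentiable_if_GDERIV)

lemma C_k_SucD:
  assumes "C_k (Suc k) f"
  shows "GDERIV f x :> gradient f x" "b \<in> Basis \<Longrightarrow> C_k k (\<lambda>x. gradient f x \<bullet> b)"
  using assms by (auto intro!: GDERIV_gradient simp: differentiable_on_def)

lemma C_k_lower: "C_k (Suc k) f \<Longrightarrow> C_k k f"
proof (induction k arbitrary: f)
  case 0
  then show ?case by (auto intro: differentiable_imp_continuous_on)
next
  case (Suc k)
  show ?case
    by (rule C_k_SucI[where D = "gradient f"]) (use Suc C_k_SucD in blast)+
qed

lemma C_k_const: "C_k k (\<lambda>_. c)"
  by (induction k arbitrary: c) (auto intro!: C_k_SucI[where D = "\<lambda>_. 0"] GDERIV_const simp del: C_k.simps(2))

lemma C_k_add: "C_k k f \<Longrightarrow> C_k k g \<Longrightarrow> C_k k (\<lambda>x. f x + g x)"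
proof (induction k arbitrary: f g)
  case 0
  then show ?case by (auto intro: continuous_on_add)
next
  case (Suc k)
  show ?case
  proof (rule C_k_SucI[where D = "\<lambda>x. gradient f x + gradient g x"])
    show "GDERIV (\<lambda>x. f x + g x) x :> gradient f x + gradient g x" for x
      by (intro GDERIV_add C_k_SucD[OF Suc.prems(1)] C_k_SucD[OF Suc.prems(2)])
    show "C_k k (\<lambda>x. (gradient f x + gradient g x) \<bullet> b)" if "b \<in> Basis" for b
      unfolding inner_add_left
      by (intro Suc.IH C_k_SucD(2)[OF Suc.prems(1) that] C_k_SucD(2)[OF Suc.prems(2) that])
  qed
qed

lemma C_k_mult: "C_k k f \<Longrightarrow> C_k k g \<Longrightarrow> C_k k (\<lambda>x. f x * g x)"
proof (induction k arbitrary: f g)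
  case 0
  then show ?case by (auto intro: continuous_on_mult)
next
  case (Suc k)
  show ?case
  proof (rule C_k_SucI[where D = "\<lambda>x. f x *\<^sub>R gradient g x + g x *\<^sub>R gradient f x"])
    show "GDERIV (\<lambda>x. f x * g x) x :> f x *\<^sub>R gradient g x + g x *\<^sub>R gradient f x" for x
      by (intro GDERIV_mult C_k_SucD[OF Suc.prems(1)] C_k_SucD[OF Suc.prems(2)])
    show "C_k k (\<lambda>x. (f x *\<^sub>R gradient g x + g x *\<^sub>R gradient f x) \<bullet> b)" if "b \<in> Basis" for b
      unfolding inner_add_left inner_scaleR_left
      by (intro C_k_add Suc.IH C_k_SucD(2)[OF Suc.prems(1) that] C_k_SucD(2)[OF Suc.prems(2) that]
          C_k_lower[OF Suc.prems(1)] C_k_lower[OF Suc.prems(2)])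
  qed
qed

lemma C_k_affine: "C_k k (\<lambda>x::'b::euclidean_space. (x - c) \<bullet> a)"
proof (cases k)
  case 0
  then show ?thesis by (auto intro!: continuous_intros)
next
  case (Suc k)
  show ?thesis unfolding Suc
    by (rule C_k_SucI[where D = "\<lambda>_. a"])
      (auto simp: gderiv_def inner_diff_left intro!: derivative_eq_intros C_k_const)
qed

text \<open>Since \<open>h j\<close> stands for the \<open>j\<close>-th derivative of one function, an induction on the order of
  differentiability can pass from \<open>h j\<close> to \<open>h (Suc j)\<close> in the chain rule.\<close>

lemma C_k_compose:
  assumes h: "\<And>j x. (h j has_real_derivative h (Suc j) x) (at x)" and f: "\<And>k. C_k k f"
  shows "C_k k (\<lambda>x. h j (f x))"
proof (induction k arbitrary: j)
  case 0
  have "continuous_on UNIV (h j)"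
    using h by (meson DERIV_continuous_on has_field_derivative_at_within)
  moreover have "continuous_on UNIV f" using f[of 0] by simp
  ultimately show ?case
    by (auto intro: continuous_on_compose2)
next
  case (Suc k)
  show ?case
  proof (rule C_k_SucI[where D = "\<lambda>x. h (Suc j) (f x) *\<^sub>R gradient f x"])
    show "GDERIV (\<lambda>x. h j (f x)) x :> h (Suc j) (f x) *\<^sub>R gradient f x" for x
      by (rule GDERIV_DERIV_compose[OF C_k_SucD(1)[OF f] h])
    show "C_k k (\<lambda>x. (h (Suc j) (f x) *\<^sub>R gradient f x) \<bullet> b)" if "b \<in> Basis" for b
      unfolding inner_scaleR_left
      by (intro C_k_mult Suc.IH C_k_SucD(2)[OF f that])
  qed
qed

text \<open>The functions \<open>x \<mapsto> P (1 / x) exp (- 1 / x)\<close>, continued by zero to \<open>x \<le> 0\<close>. The polynomial is a parameter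
  because differentiation only changes the polynomial.\<close>

definition flat_exp :: "real poly \<Rightarrow> real \<Rightarrow> real"
  where "flat_exp P x = (if x > 0 then poly P (1 / x) * exp (- 1 / x) else 0)"

lemma poly_div_exp_tendsto_0: "((\<lambda>y::real. poly P y / exp y) \<longlongrightarrow> 0) at_top"
proof -
  have "((\<lambda>y::real. \<Sum>i\<le>degree P. coeff P i * (y ^ i / exp y)) \<longlongrightarrow> (\<Sum>i\<le>degree P. coeff P i * 0)) at_top"
    by (intro tendsto_intros tendsto_power_div_exp_0)
  then show ?thesis by (simp add: poly_altdef sum_divide_distrib)
qed

lemma flat_exp_deriv:
  "(flat_exp P has_real_derivative flat_exp ([:0, 0, 1:] * (P - pderiv P)) x) (at x)"
proof -
  consider "x > 0" | "x < 0" | "x = 0" by linarith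
  then show ?thesis
  proof cases
    case 1
    have "((\<lambda>x. poly P (1 / x) * exp (- 1 / x)) has_real_derivative
       flat_exp ([:0, 0, 1:] * (P - pderiv P)) x) (at x)"
      using 1 unfolding flat_exp_def
      by (auto intro!: derivative_eq_intros simp: field_simps power2_eq_square)
    then show ?thesis
      by (rule has_field_derivative_transform_within_open[where S = "{0<..}"])
        (use 1 in \<open>auto simp: flat_exp_def\<close>)
  next
    case 2
    have "((\<lambda>x. 0) has_real_derivative flat_exp ([:0, 0, 1:] * (P - pderiv P)) x) (at x)"
      using 2 unfolding flat_exp_def by auto
    then show ?thesis
      by (rule has_field_derivative_transform_within_open[where S = "{..<0}"])
        (use 2 in \<open>auto simp: flat_exp_def\<close>)
  next
    case 3
    have "((\<lambda>h. flat_exp P h / h) \<longlongrightarrow> 0) (at_right 0)"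
    proof -
      have "((\<lambda>h. poly ([:0,1:] * P) (inverse h) / exp (inverse h)) \<longlongrightarrow> 0) (at_right (0::real))"
        by (rule filterlim_compose[OF poly_div_exp_tendsto_0 filterlim_inverse_at_top_right])
      moreover have "\<forall>\<^sub>F h in at_right (0::real).
          poly ([:0,1:] * P) (inverse h) / exp (inverse h) = flat_exp P h / h"
        by (auto simp: eventually_at_filter flat_exp_def exp_minus field_simps)
      ultimately show ?thesis by (rule Lim_transform_eventually)
    qed
    moreover have "((\<lambda>h. flat_exp P h / h) \<longlongrightarrow> 0) (at_left 0)"
      by (rule Lim_transform_eventually[OF tendsto_const])
        (auto simp: eventually_at_filter flat_exp_def)
    ultimately have "((\<lambda>h. flat_exp P h / h) \<longlongrightarrow> 0) (at 0)"
      using filterlim_at_split by blast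
    then show ?thesis using 3 by (simp add: DERIV_def flat_exp_def)
  qed
qed

text \<open>The polynomial that belongs to the \<open>j\<close>-th derivative of \<open>x \<mapsto> exp (- 1 / x)\<close>.\<close>

primrec flat_poly :: "nat \<Rightarrow> real poly" where
  "flat_poly 0 = 1"
| "flat_poly (Suc j) = [:0, 0, 1:] * (flat_poly j - pderiv (flat_poly j))"

definition bump :: "'b::euclidean_space \<Rightarrow> real \<Rightarrow> 'b \<Rightarrow> real"
  where "bump c r z = flat_exp 1 (r\<^sup>2 - (z - c) \<bullet> (z - c))"

lemma C_k_bump: "C_k k (bump c r)"
proof -
  have q: "C_k k (\<lambda>z. r\<^sup>2 - (z - c) \<bullet> (z - c))" for k
  proof (cases k)
    case 0
    then show ?thesis by (auto intro!: continuous_intros)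
  next
    case (Suc k)
    show ?thesis unfolding Suc
    proof (rule C_k_SucI[where D = "\<lambda>z. (- 2) *\<^sub>R (z - c)"])
      show "GDERIV (\<lambda>z. r\<^sup>2 - (z - c) \<bullet> (z - c)) x :> (- 2) *\<^sub>R (x - c)" for x
        unfolding gderiv_def
        by (auto intro!: derivative_eq_intros simp: inner_commute)
      show "C_k k (\<lambda>x. ((- 2) *\<^sub>R (x - c)) \<bullet> b)" for b
        using C_k_affine[of k c "(-2) *\<^sub>R b"] by simp
    qed
  qed
  have "C_k k (\<lambda>z. (\<lambda>j. flat_exp (flat_poly j)) 0 (r\<^sup>2 - (z - c) \<bullet> (z - c)))"
    by (rule C_k_compose[OF _ q]) (use flat_exp_deriv in simp)
  then show ?thesis by (simp add: bump_def[abs_def])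
qed

lemma continuous_on_bump: "continuous_on A (bump c r)"
  using C_k_bump[of 0 c r] continuous_on_subset by auto

lemma bump_nonneg: "bump c r z \<ge> 0" by (simp add: bump_def flat_exp_def)

lemma bump_pos: "norm (z - c) < r \<Longrightarrow> bump c r z > 0"
  using power_strict_mono[of "norm (z - c)" r 2]
  by (auto simp: bump_def flat_exp_def dot_square_norm)

lemma bump_eq_0: "r > 0 \<Longrightarrow> z \<notin> cball c r \<Longrightarrow> bump c r z = 0"
  using power_mono[of r "norm (z - c)" 2] norm_minus_commute[of c z]
  by (auto simp: bump_def flat_exp_def dot_square_norm dist_norm norm_minus_commute[of c]
      dest: power_less_imp_less_base)

lemma bump_translate: "bump c r (y - z) = bump (c + z) r y"
  by (simp add: bump_def algebra_simps)

text \<open>A radial bump is symmetric in its argument and its centre. This is what makes the kernel have mass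
  one also as a function of the base point.\<close>

lemma bump_reflect: "bump c r (y - z) = bump (y - c) r z"
proof -
  have e: "y - z - c = - (z - (y - c))" by simp
  show ?thesis unfolding bump_def e by (simp only: inner_minus_left inner_minus_right minus_minus)
qed

lemma integrable_bump: assumes "r > 0" shows "integrable lborel (bump (c::'b::euclidean_space) r)"
proof -
  have "integrable lborel (\<lambda>x. indicator (cball c r) x *\<^sub>R bump c r x)"
    by (rule borel_integrable_compact) (auto intro: continuous_on_bump)
  moreover have "(\<lambda>x. indicator (cball c r) x *\<^sub>R bump c r x) = bump c r"
    using bump_eq_0[OF assms] by (fastforce simp: indicator_def)
  ultimately show ?thesis by simp
qed

lemma integral_bump_center: "integral\<^sup>L lborel (bump (c::'b::euclidean_space) r) = integral\<^sup>L lborel (bump (0::'b) r)"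
proof -
  have "integral\<^sup>L lborel (bump c r) = integral\<^sup>L (distr lborel borel ((+) c)) (bump c r)"
    by (simp add: lborel_distr_plus)
  also have "\<dots> = (LINT x|lborel. bump c r (c + x))"
    by (rule integral_distr) (auto intro!: borel_measurable_continuous_onI continuous_on_bump)
  also have "\<dots> = integral\<^sup>L lborel (bump (0::'b) r)"
    by (rule Bochner_Integration.integral_cong) (auto simp: bump_def)
  finally show ?thesis .
qed

lemma integral_bump_pos: assumes "r > 0" shows "integral\<^sup>L lborel (bump (c::'b::euclidean_space) r) > 0"
proof (rule ccontr)
  assume "\<not> ?thesis"
  then have "integral\<^sup>L lborel (bump c r) = 0"
    using Bochner_Integration.integral_nonneg[of lborel "bump c r"] bump_nonneg by (metis less_eq_real_def)
  then have "AE x in lborel. bump c r x = 0"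
    using integral_nonneg_eq_0_iff_AE[OF integrable_bump[OF assms, of c]] by (simp add: bump_nonneg)
  then have "AE x in lborel. x \<notin> ball c r"
    by eventually_elim (use bump_pos in \<open>fastforce simp: dist_norm norm_minus_commute\<close>)
  then have "ball c r \<in> null_sets lborel"
    by (subst AE_iff_null_sets) auto
  then show False
    using content_ball_pos[OF assms, of c] by (simp add: null_sets_def measure_def)
qed

definition mollifier :: "'b::euclidean_space \<Rightarrow> real \<Rightarrow> 'b \<Rightarrow> real"
  where "mollifier c r z = bump c r z / integral\<^sup>L lborel (bump (0::'b) r)"

context fixes r :: real assumes r: "r > 0" begin

lemma C_k_mollifier: "C_k k (mollifier c r)"
  using C_k_mult[OF C_k_bump C_k_const, of k c r "1 / integral\<^sup>L lborel (bump 0 r)"]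
  by (simp add: mollifier_def[abs_def])

lemma mollifier_nonneg: "mollifier (c::'b::euclidean_space) r z \<ge> 0"
  unfolding mollifier_def using bump_nonneg integral_bump_pos[OF r, where c = "0::'b::euclidean_space"]
  by (intro divide_nonneg_pos) auto

lemma mollifier_eq_0: "z \<notin> cball c r \<Longrightarrow> mollifier c r z = 0"
  by (simp add: mollifier_def bump_eq_0[OF r])

lemma mollifier_translate: "mollifier c r (y - z) = mollifier (c + z) r y"
  by (simp add: mollifier_def bump_translate)

lemma mollifier_reflect: "mollifier c r (y - z) = mollifier (y - c) r z"
  by (simp add: mollifier_def bump_reflect)

lemma continuous_on_mollifier: "continuous_on A (mollifier c r)"
  using C_k_mollifier[of 0 c] continuous_on_subset by auto

lemma integrable_mollifier: "integrable lborel (mollifier c r)"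
  unfolding mollifier_def using integrable_bump[OF r] by auto

lemma integral_mollifier: "integral\<^sup>L lborel (mollifier (c::'b::euclidean_space) r) = 1"
  unfolding mollifier_def using integral_bump_pos[OF r, of "0::'b"] integral_bump_center[of c r] by simp

lemma GDERIV_mollifier: "GDERIV (mollifier c r) x :> gradient (mollifier c r) x"
  using C_k_SucD(1)[OF C_k_mollifier] .

lemma continuous_gradient_mollifier: "continuous_on A (gradient (mollifier c r))"
proof -
  have "continuous_on A (\<lambda>x. gradient (mollifier c r) x \<bullet> b)" if "b \<in> Basis" for b
    using C_k_SucD(2)[OF C_k_mollifier[of "Suc 0"] that]
    by (metis C_k.simps(1) continuous_on_subset subset_UNIV)
  then show ?thesis by (rule continuous_on_componentwise[THEN iffD2, rule_format])
qed

lemma gradient_mollifier_translate: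
  "gradient (mollifier (c + z) r) y = gradient (mollifier c r) (y - z)"
proof (rule gradient_eq)
  have "((\<lambda>y. mollifier c r (y - z)) has_derivative (\<lambda>h. h \<bullet> gradient (mollifier c r) (y - z))) (at y)"
    by (rule has_derivative_compose[where g = "mollifier c r" and f = "\<lambda>y. y - z", 
          OF _ GDERIV_mollifier[unfolded gderiv_def], THEN has_derivative_eq_rhs])
      (auto intro!: derivative_eq_intros)
  then show "GDERIV (mollifier (c + z) r) y :> gradient (mollifier c r) (y - z)"
    by (simp add: gderiv_def mollifier_translate)
qed

lemma gradient_mollifier_eq_0: "z \<notin> cball c r \<Longrightarrow> gradient (mollifier c r) z = 0"
proof (rule gradient_eq)
  assume z: "z \<notin> cball c r"
  have "((\<lambda>_. 0) has_derivative (\<lambda>h. h \<bullet> 0)) (at z)" by (auto intro!: derivative_eq_intros)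
  then have "(mollifier c r has_derivative (\<lambda>h. h \<bullet> 0)) (at z)"
    by (rule has_derivative_transform_within_open[where s = "- cball c r"])
      (use z mollifier_eq_0 in auto)
  then show "GDERIV (mollifier c r) z :> 0" by (simp add: gderiv_def)
qed

lemma test_function_mollifier:
  assumes "cball c r \<subseteq> U" shows "test_function U (mollifier c r)"
proof -
  have "closure {z. mollifier c r z \<noteq> 0} \<subseteq> cball c r"
    by (rule closure_minimal) (use mollifier_eq_0[of _ c] in blast, simp)
  moreover have "compact (closure {z. mollifier c r z \<noteq> 0})"
    using calculation by (meson bounded_cball bounded_subset closed_closure compact_eq_bounded_closed)
  ultimately show ?thesis unfolding test_function_def using assms C_k_mollifier by blast
qed

end

section \<open>Mollification of integrable functions\<close>

lemma continuous_support_bounded: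
  fixes g :: "'b::euclidean_space \<Rightarrow> 'c::real_normed_vector"
  assumes "continuous_on UNIV g" "\<And>z. z \<notin> cball c r \<Longrightarrow> g z = 0"
  obtains M where "M \<ge> 0" "\<And>z. norm (g z) \<le> M"
proof -
  have "bounded (g ` cball c r)"
    by (intro compact_imp_bounded compact_continuous_image compact_cball
        continuous_on_subset[OF assms(1)]) auto
  then obtain M where M: "\<And>z. z \<in> cball c r \<Longrightarrow> norm (g z) \<le> M"
    unfolding bounded_iff by blast
  have "norm (g z) \<le> max M 0" for z
    using M[of z] assms(2)[of z] by (cases "z \<in> cball c r") auto
  then show thesis using that[of "max M 0"] by auto
qed

lemma continuous_support_uniform:
  fixes g :: "'b::euclidean_space \<Rightarrow> 'c::real_normed_vector"
  assumes "continuous_on UNIV g" "\<And>z. z \<notin> cball c r \<Longrightarrow> g z = 0" "e > 0"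
  obtains d where "d > 0" "\<And>x y. dist x y < d \<Longrightarrow> dist (g x) (g y) < e"
proof -
  have "uniformly_continuous_on (cball c (r + 1)) g"
    by (intro compact_uniformly_continuous compact_cball continuous_on_subset[OF assms(1)]) auto
  then obtain d where d: "d > 0" "\<And>x y. x \<in> cball c (r + 1) \<Longrightarrow> y \<in> cball c (r + 1) \<Longrightarrow>
    dist x y < d \<Longrightarrow> dist (g x) (g y) < e"
    using \<open>e > 0\<close> unfolding uniformly_continuous_on_def by (metis dist_commute)
  have "dist (g x) (g y) < e" if "dist x y < min d 1" for x y
  proof (cases "x \<in> cball c (r + 1) \<and> y \<in> cball c (r + 1)")
    case False
    then have "x \<notin> cball c r \<and> y \<notin> cball c r"
      using that dist_triangle[of c x y] dist_triangle[of c y x] by (auto simp: dist_commute)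
    then show ?thesis using assms(2,3) by simp
  qed (use d that in auto)
  then show thesis using that[of "min d 1"] \<open>d > 0\<close> by auto
qed

lemma integrable_bounded_kernel:
  fixes f :: "'b::euclidean_space \<Rightarrow> 'c::euclidean_space" and k :: "'b \<Rightarrow> real"
  assumes "continuous_on UNIV k" "\<And>z. \<bar>k z\<bar> \<le> M" "integrable lebesgue f"
  shows "integrable lebesgue (\<lambda>y. k (y - z) *\<^sub>R f y)"
proof (rule Bochner_Integration.integrable_bound)
  show "integrable lebesgue (\<lambda>y. M *\<^sub>R norm (f y))" using assms(3) by auto
  have "(\<lambda>y. k (y - z)) \<in> borel_measurable borel"
    by (intro borel_measurable_continuous_onI continuous_on_compose2[OF assms(1)] continuous_intros) auto
  then have "(\<lambda>y. k (y - z)) \<in> borel_measurable lebesgue"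
    by (intro measurable_completion) simp
  then show "(\<lambda>y. k (y - z) *\<^sub>R f y) \<in> borel_measurable lebesgue"
    using assms(3) by auto
  show "AE y in lebesgue. norm (k (y - z) *\<^sub>R f y) \<le> norm (M *\<^sub>R norm (f y))"
    by (rule AE_I2) (use assms(2) in \<open>auto intro!: mult_right_mono order_trans[OF _ abs_ge_self]\<close>)
qed

lemma integrable_bounded_kernel':
  fixes f :: "'b::euclidean_space \<Rightarrow> real" and k :: "'b \<Rightarrow> 'c::euclidean_space"
  assumes "continuous_on UNIV k" "\<And>z. norm (k z) \<le> M" "integrable lebesgue f"
  shows "integrable lebesgue (\<lambda>y. f y *\<^sub>R k (y - z))"
proof (rule Bochner_Integration.integrable_bound)
  show "integrable lebesgue (\<lambda>y. M *\<^sub>R norm (f y))" using assms(3) by auto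
  have "(\<lambda>y. k (y - z)) \<in> borel_measurable borel"
    by (intro borel_measurable_continuous_onI continuous_on_compose2[OF assms(1)] continuous_intros) auto
  then have "(\<lambda>y. k (y - z)) \<in> borel_measurable lebesgue"
    by (intro measurable_completion) simp
  then show "(\<lambda>y. f y *\<^sub>R k (y - z)) \<in> borel_measurable lebesgue"
    using assms(3) by auto
  show "AE y in lebesgue. norm (f y *\<^sub>R k (y - z)) \<le> norm (M *\<^sub>R norm (f y))"
  proof (rule AE_I2)
    fix y
    have "norm (f y *\<^sub>R k (y - z)) \<le> M * norm (f y)"
      using mult_left_mono[OF assms(2)[of "y - z"], of "norm (f y)"] by (simp add: mult.commute)
    then show "norm (f y *\<^sub>R k (y - z)) \<le> norm (M *\<^sub>R norm (f y))"
      by (metis abs_ge_self order_trans real_norm_def real_scaleR_def)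
  qed
qed

text \<open>The kernel is evaluated at \<open>y - z\<close>, so that the value at \<open>z\<close> is the integral of \<open>f\<close> against the test
  function \<open>y \<mapsto> \<rho> (y - z)\<close>; the value of a weak formulation at this test function is then a statement about
  mollified functions at the point \<open>z\<close>.\<close>

definition mollify :: "('b::euclidean_space \<Rightarrow> real) \<Rightarrow> ('b \<Rightarrow> 'c::euclidean_space) \<Rightarrow> 'b \<Rightarrow> 'c"
  where "mollify \<rho> f z = (LINT y|lebesgue. \<rho> (y - z) *\<^sub>R f y)"

context
  fixes c :: "'b::euclidean_space" and r :: real
  assumes r: "r > 0"
begin

lemma mollifier_bounded: obtains M where "M \<ge> 0" "\<And>z. \<bar>mollifier c r z\<bar> \<le> M"
  by (rule continuous_support_bounded[OF continuous_on_mollifier[OF r, where c = c] mollifier_eq_0[OF r, where c = c]]) auto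

lemma gradient_mollifier_bounded: obtains M where "M \<ge> 0" "\<And>z. norm (gradient (mollifier c r) z) \<le> M"
  by (rule continuous_support_bounded[OF continuous_gradient_mollifier[OF r, where c = c] gradient_mollifier_eq_0[OF r, where c = c]]) auto

lemma integrable_mollify:
  fixes f :: "'b \<Rightarrow> 'c::euclidean_space"
  assumes "integrable lebesgue f"
  shows "integrable lebesgue (\<lambda>y. mollifier c r (y - z) *\<^sub>R f y)"
  using integrable_bounded_kernel[OF continuous_on_mollifier[OF r] _ assms] mollifier_bounded by metis

lemma integrable_mollify_gradient:
  fixes f :: "'b \<Rightarrow> real"
  assumes "integrable lebesgue f"
  shows "integrable lebesgue (\<lambda>y. f y *\<^sub>R gradient (mollifier c r) (y - z))"
  using integrable_bounded_kernel'[OF continuous_gradient_mollifier[OF r] _ assms]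
    gradient_mollifier_bounded by metis

lemma mollify_bounded_linear:
  assumes "bounded_linear T" "integrable lebesgue f"
  shows "mollify (mollifier c r) (\<lambda>y. T (f y)) z = T (mollify (mollifier c r) f z)"
  unfolding mollify_def
  by (simp add: integral_bounded_linear[OF assms(1) integrable_mollify[OF assms(2)], symmetric]
      linear_scale[OF bounded_linear.linear[OF assms(1)]])

lemma mollify_nonneg:
  fixes f :: "'b \<Rightarrow> real"
  assumes "AE y in lebesgue. f y \<ge> 0"
  shows "mollify (mollifier c r) f z \<ge> 0"
  unfolding mollify_def
  by (rule Bochner_Integration.integral_nonneg_AE) (use assms in eventually_elim, simp add: mollifier_nonneg[OF r])

lemma mollify_bounded:
  fixes f :: "'b \<Rightarrow> real"
  assumes "integrable lebesgue f"
  obtains B where "B \<ge> 0" "\<And>z. \<bar>mollify (mollifier c r) f z\<bar> \<le> B"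
    "\<And>z. norm (LINT y|lebesgue. f y *\<^sub>R gradient (mollifier c r) (y - z)) \<le> B"
proof -
  obtain M1 where M1: "M1 \<ge> 0" "\<And>z. \<bar>mollifier c r z\<bar> \<le> M1" using mollifier_bounded by metis
  obtain M2 where M2: "M2 \<ge> 0" "\<And>z. norm (gradient (mollifier c r) z) \<le> M2"
    using gradient_mollifier_bounded by metis
  let ?I = "LINT y|lebesgue. norm (f y)"
  have 0: "?I \<ge> 0" by simp
  have "\<bar>mollify (mollifier c r) f z\<bar> \<le> M1 * ?I" for z
  proof -
    have "norm (mollify (mollifier c r) f z) \<le> (LINT y|lebesgue. M1 * norm (f y))"
      unfolding mollify_def
      by (rule Bochner_Integration.integral_norm_bound_integral)
        (use assms integrable_mollify[OF assms] M1 in \<open>auto simp: abs_mult intro!: mult_right_mono\<close>)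
    then show ?thesis by simp
  qed
  moreover have "norm (LINT y|lebesgue. f y *\<^sub>R gradient (mollifier c r) (y - z)) \<le> M2 * ?I" for z
  proof -
    have "norm (LINT y|lebesgue. f y *\<^sub>R gradient (mollifier c r) (y - z)) \<le> (LINT y|lebesgue. M2 * norm (f y))"
      by (rule Bochner_Integration.integral_norm_bound_integral)
        (use assms integrable_mollify_gradient[OF assms] M2 in
          \<open>auto simp: mult.commute[of M2] intro!: mult_left_mono\<close>)
    then show ?thesis by simp
  qed
  ultimately show thesis
    by (intro that[of "max (M1 * ?I) (M2 * ?I)"])
      (auto intro: max.coboundedI1 max.coboundedI2 simp: M1(1) 0 le_max_iff_disj)
qed

lemma continuous_on_mollify:
  fixes f :: "'b \<Rightarrow> 'c::euclidean_space"
  assumes f: "integrable lebesgue f"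
  shows "continuous_on A (mollify (mollifier c r) f)"
proof -
  let ?I = "LINT y|lebesgue. norm (f y)"
  have I: "?I \<ge> 0" by simp
  have "\<exists>d>0. \<forall>x'. dist x' x < d \<longrightarrow> dist (mollify (mollifier c r) f x') (mollify (mollifier c r) f x) < e"
    if "e > 0" for e x
  proof -
    have pos: "e / (?I + 1) > 0" using \<open>e > 0\<close> I by (intro divide_pos_pos) linarith+
    obtain d where d: "d > 0"
      "\<And>x y. dist x y < d \<Longrightarrow> dist (mollifier c r x) (mollifier c r y) < e / (?I + 1)"
      by (rule continuous_support_uniform[OF continuous_on_mollifier[OF r, where c = c] mollifier_eq_0[OF r, where c = c] pos]) auto
    have "dist (mollify (mollifier c r) f x') (mollify (mollifier c r) f x) < e" if "dist x' x < d" for x'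
    proof -
      have "norm (LINT y|lebesgue. mollifier c r (y - x') *\<^sub>R f y - mollifier c r (y - x) *\<^sub>R f y)
        \<le> (LINT y|lebesgue. e / (?I + 1) * norm (f y))"
      proof (rule Bochner_Integration.integral_norm_bound_integral)
        show "norm (mollifier c r (y - x') *\<^sub>R f y - mollifier c r (y - x) *\<^sub>R f y) \<le> e / (?I + 1) * norm (f y)" for y
          unfolding scaleR_diff_left[symmetric] norm_scaleR
          using d(2)[of "y - x'" "y - x"] that
          by (intro mult_right_mono) (auto simp: dist_norm norm_minus_commute)
      qed (use f integrable_mollify[OF f] in auto)
      also have "\<dots> = e * (?I / (?I + 1))" by simp
      also have "\<dots> < e * 1"
      proof (rule mult_strict_left_mono[OF _ \<open>e > 0\<close>])
        have "?I < ?I + 1" "0 < ?I + 1" using I by linarith+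
        then show "?I / (?I + 1) < 1" by (simp only: divide_less_eq_1_pos)
      qed
      finally show ?thesis
        by (simp add: dist_norm mollify_def Bochner_Integration.integral_diff[OF integrable_mollify[OF f] integrable_mollify[OF f]])
    qed
    then show ?thesis using d(1) by blast
  qed
  then have "continuous_on UNIV (mollify (mollifier c r) f)"
    unfolding continuous_on_iff by blast
  then show ?thesis using continuous_on_subset by blast
qed

text \<open>The first-order Taylor remainder of the kernel is small uniformly in \<open>y\<close>, because its gradient is
  uniformly continuous; it can therefore be integrated against any integrable \<open>f\<close>.\<close>

lemma mollify_has_derivative:
  fixes f :: "'b \<Rightarrow> real"
  assumes f: "integrable lebesgue f"
  shows "(mollify (mollifier c r) f has_derivative
    (\<lambda>h. - (h \<bullet> (LINT y|lebesgue. f y *\<^sub>R gradient (mollifier c r) (y - z))))) (at z)"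
  unfolding has_derivative_at_alt
proof (intro conjI allI impI)
  let ?g = "gradient (mollifier c r)"
  show "bounded_linear (\<lambda>h. - (h \<bullet> (LINT y|lebesgue. f y *\<^sub>R ?g (y - z))))"
    by (intro bounded_linear_minus bounded_linear_inner_left)
  let ?I = "LINT y|lebesgue. norm (f y)"
  have I: "?I \<ge> 0" by simp
  fix e :: real assume "e > 0"
  then have pos: "e / (?I + 1) > 0" using I by (intro divide_pos_pos) linarith+
  obtain d where d: "d > 0" "\<And>x y. dist x y < d \<Longrightarrow> dist (?g x) (?g y) < e / (?I + 1)"
    by (rule continuous_support_uniform[OF continuous_gradient_mollifier[OF r, where c = c] gradient_mollifier_eq_0[OF r, where c = c] pos]) auto
  have *: "\<bar>mollifier c r (a - h) - mollifier c r a + h \<bullet> ?g a\<bar> \<le> norm h * (e / (?I + 1))"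
    if h: "norm h < d" for a h
  proof -
    have "norm (mollifier c r (a - h) - mollifier c r a - (a - h - a) \<bullet> ?g a) \<le> norm (a - h - a) * (e / (?I + 1))"
    proof (rule differentiable_bound_linearization[where S = "ball a d" and f' = "\<lambda>x h. h \<bullet> ?g x"])
      show "a + t *\<^sub>R (a - h - a) \<in> ball a d" if "t \<in> {0..1}" for t
        using that h mult_mono[of "\<bar>t\<bar>" 1 "norm h" "norm h"] by (auto simp: dist_norm)
      show "(mollifier c r has_derivative (\<lambda>h. h \<bullet> ?g x)) (at x within ball a d)" for x
        using GDERIV_mollifier[OF r, of c x] by (auto simp: gderiv_def intro: has_derivative_at_withinI)
      show "onorm ((\<lambda>h. h \<bullet> ?g x) - (\<lambda>h. h \<bullet> ?g a)) \<le> e / (?I + 1)" if "x \<in> ball a d" for x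
      proof (rule onorm_le)
        fix v
        have "norm (((\<lambda>h. h \<bullet> ?g x) - (\<lambda>h. h \<bullet> ?g a)) v) = \<bar>v \<bullet> (?g x - ?g a)\<bar>"
          by (simp add: inner_diff_right)
        also have "\<dots> \<le> norm v * norm (?g x - ?g a)" by (rule Cauchy_Schwarz_ineq2)
        also have "\<dots> \<le> norm v * (e / (?I + 1))"
          using d(2)[of x a] that by (intro mult_left_mono) (auto simp: dist_norm norm_minus_commute)
        finally show "norm (((\<lambda>h. h \<bullet> ?g x) - (\<lambda>h. h \<bullet> ?g a)) v) \<le> e / (?I + 1) * norm v"
          by (simp add: mult.commute)
      qed
    qed (use d in auto)
    then show ?thesis by (simp add: inner_diff_left)
  qed
  show "\<exists>d>0. \<forall>y. norm (y - z) < d \<longrightarrow>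
      norm (mollify (mollifier c r) f y - mollify (mollifier c r) f z
        - - ((y - z) \<bullet> (LINT x|lebesgue. f x *\<^sub>R ?g (x - z)))) \<le> e * norm (y - z)"
  proof (intro exI[of _ d] conjI allI impI d)
    fix x assume x: "norm (x - z) < d"
    let ?h = "x - z"
    note i = integrable_mollify[OF f]
    have i2: "integrable lebesgue (\<lambda>y. ?h \<bullet> (f y *\<^sub>R ?g (y - z)))"
      using integrable_mollify_gradient[OF f, of z] by (intro integrable_inner_right) auto
    have "mollify (mollifier c r) f x - mollify (mollifier c r) f z
        - - (?h \<bullet> (LINT y|lebesgue. f y *\<^sub>R ?g (y - z)))
      = (LINT y|lebesgue. mollifier c r (y - x) *\<^sub>R f y - mollifier c r (y - z) *\<^sub>R f y
          + ?h \<bullet> (f y *\<^sub>R ?g (y - z)))"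
      using i[of x] i[of z] i2 integrable_mollify_gradient[OF f, of z]
      by (simp add: mollify_def integral_inner_right del: inner_scaleR_right real_scaleR_def)
    also have "norm \<dots> \<le> (LINT y|lebesgue. (norm ?h * (e / (?I + 1))) * norm (f y))"
    proof (rule Bochner_Integration.integral_norm_bound_integral)
      fix y
      have "mollifier c r (y - x) *\<^sub>R f y - mollifier c r (y - z) *\<^sub>R f y + ?h \<bullet> (f y *\<^sub>R ?g (y - z))
        = (mollifier c r ((y - z) - ?h) - mollifier c r (y - z) + ?h \<bullet> ?g (y - z)) * f y"
        by (simp add: algebra_simps)
      then show "norm (mollifier c r (y - x) *\<^sub>R f y - mollifier c r (y - z) *\<^sub>R f y + ?h \<bullet> (f y *\<^sub>R ?g (y - z)))
        \<le> (norm ?h * (e / (?I + 1))) * norm (f y)"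
        using *[OF x, of "y - z"] by (simp only: abs_mult real_norm_def) (intro mult_right_mono, auto)
    qed (use f i i2 in auto)
    also have "\<dots> = e * norm ?h * (?I / (?I + 1))" by simp
    also have "\<dots> \<le> e * norm ?h * 1"
    proof (rule mult_left_mono)
      have "?I \<le> ?I + 1" "0 < ?I + 1" using I by linarith+
      then show "?I / (?I + 1) \<le> 1" by (simp only: divide_le_eq_1_pos)
    qed (use \<open>e > 0\<close> in simp)
    finally show "norm (mollify (mollifier c r) f x - mollify (mollifier c r) f z
        - - (?h \<bullet> (LINT y|lebesgue. f y *\<^sub>R ?g (y - z)))) \<le> e * norm ?h" by simp
  qed
qed

lemma nn_integral_mollifier_shift: "(\<integral>\<^sup>+z. ennreal (mollifier c r (y - z)) \<partial>lborel) = 1"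
  unfolding mollifier_reflect[OF r]
  using nn_integral_eq_integral[OF integrable_mollifier[OF r, of "y - c"]]
    integral_mollifier[OF r, of "y - c"] by (simp add: mollifier_nonneg[OF r])

lemma integral_mollifier_shift: "(LINT y|lebesgue. mollifier c r (y - z)) = 1"
  unfolding mollifier_translate[OF r]
  using integral_mollifier[OF r, of "c + z"]
  by (subst integral_completion)
    (auto intro!: borel_measurable_continuous_onI continuous_on_mollifier[OF r])

text \<open>Tonelli's theorem, with the kernel integrated over the base point first. The theorem needs Borel
  functions, so \<open>norm (f y)\<close> is first replaced by a Borel function that agrees with it almost everywhere.\<close>

lemma nn_integral_mollify_le:
  fixes f :: "'b \<Rightarrow> 'c::euclidean_space"
  assumes f: "integrable lebesgue f"
  shows "(\<integral>\<^sup>+z. ennreal (norm (mollify (mollifier c r) f z)) \<partial>lebesgue) \<le> (\<integral>\<^sup>+y. ennreal (norm (f y)) \<partial>lebesgue)"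
proof -
  have [measurable]: "mollifier c r \<in> borel_measurable borel"
    by (intro borel_measurable_continuous_onI continuous_on_mollifier[OF r])
  have fm: "f \<in> borel_measurable lebesgue" using f by auto
  then have "(\<lambda>y. ennreal (norm (f y))) \<in> borel_measurable lebesgue" by measurable
  then obtain N where [measurable]: "N \<in> borel_measurable lborel" and N: "AE y in lborel. ennreal (norm (f y)) = N y"
    using completion_ex_borel_measurable by blast
  have "(\<integral>\<^sup>+z. ennreal (norm (mollify (mollifier c r) f z)) \<partial>lebesgue)
      = (\<integral>\<^sup>+z. ennreal (norm (mollify (mollifier c r) f z)) \<partial>lborel)"
    by (rule nn_integral_completion)
  also have "\<dots> \<le> (\<integral>\<^sup>+z. (\<integral>\<^sup>+y. ennreal (mollifier c r (y - z)) * N y \<partial>lborel) \<partial>lborel)"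
  proof (rule nn_integral_mono)
    fix z
    have "ennreal (norm (mollify (mollifier c r) f z))
      \<le> (\<integral>\<^sup>+y. ennreal (norm (mollifier c r (y - z) *\<^sub>R f y)) \<partial>lebesgue)"
      unfolding mollify_def by (intro integral_norm_bound_ennreal integrable_mollify f)
    also have "\<dots> = (\<integral>\<^sup>+y. ennreal (mollifier c r (y - z)) * ennreal (norm (f y)) \<partial>lebesgue)"
      by (simp add: ennreal_mult mollifier_nonneg[OF r])
    also have "\<dots> = (\<integral>\<^sup>+y. ennreal (mollifier c r (y - z)) * ennreal (norm (f y)) \<partial>lborel)"
      by (rule nn_integral_completion)
    also have "\<dots> = (\<integral>\<^sup>+y. ennreal (mollifier c r (y - z)) * N y \<partial>lborel)"
      by (rule nn_integral_cong_AE) (use N in auto)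
    finally show "ennreal (norm (mollify (mollifier c r) f z)) \<le> \<dots>" .
  qed
  also have "\<dots> = (\<integral>\<^sup>+y. (\<integral>\<^sup>+z. ennreal (mollifier c r (y - z)) * N y \<partial>lborel) \<partial>lborel)"
    by (rule lborel_pair.Fubini') measurable
  also have "\<dots> = (\<integral>\<^sup>+y. N y \<partial>lborel)"
    by (subst nn_integral_multc) (auto simp: nn_integral_mollifier_shift)
  also have "\<dots> = (\<integral>\<^sup>+y. ennreal (norm (f y)) \<partial>lborel)"
    by (rule nn_integral_cong_AE) (use N in auto)
  also have "\<dots> = (\<integral>\<^sup>+y. ennreal (norm (f y)) \<partial>lebesgue)" by (rule nn_integral_completion[symmetric])
  finally show ?thesis .
qed

end

section \<open>Approximation in the mean\<close>

lemma integrable_compact_continuous: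
  fixes f :: "'b::euclidean_space \<Rightarrow> 'c::euclidean_space"
  assumes "compact K" "continuous_on K f"
  shows "integrable lebesgue (\<lambda>x. indicator K x *\<^sub>R f x)"
proof -
  have "integrable lborel (\<lambda>x. indicator K x *\<^sub>R f x)" by (rule borel_integrable_compact[OF assms])
  then show ?thesis by (subst integrable_completion) auto
qed

text \<open>A measurable function is an almost everywhere limit of continuous functions. After truncation at a
  height \<open>N\<close> with small loss in the mean, the convergence on a compact set is dominated.\<close>

lemma continuous_dense_L1:
  fixes f :: "'b::euclidean_space \<Rightarrow> 'c::euclidean_space"
  assumes f: "integrable lebesgue f" and K: "compact K" and e: "e > 0"
  obtains g where "continuous_on UNIV g" "(LINT z|lebesgue. norm (indicator K z *\<^sub>R (f z - g z))) < e"
proof -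
  have Km: "K \<in> sets lebesgue" using K by (simp add: compact_imp_closed)
  have fm: "f \<in> borel_measurable lebesgue" using f by auto
  define fN where "fN N z = (if norm (f z) \<le> real N then f z else 0)" for N z
  have fNm: "fN N \<in> borel_measurable lebesgue" for N
  proof -
    have "{z \<in> space lebesgue. norm (f z) \<le> real N} \<in> sets lebesgue" using fm by measurable
    then show ?thesis unfolding fN_def[abs_def] using fm by (intro measurable_If) auto
  qed
  have "(\<lambda>N. LINT z|lebesgue. norm (f z - fN N z)) \<longlonglongrightarrow> (LINT z::'b|lebesgue. 0)"
  proof (rule integral_dominated_convergence)
    show "integrable lebesgue (\<lambda>z. norm (f z))" using f by auto
    show "AE z in lebesgue. (\<lambda>N. norm (f z - fN N z)) \<longlonglongrightarrow> 0"
    proof (rule AE_I2)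
      fix z
      have "\<forall>\<^sub>F N in sequentially. norm (f z) \<le> real N" 
        using eventually_ge_at_top[of "nat \<lceil>norm (f z)\<rceil>"] by eventually_elim linarith
      then have "\<forall>\<^sub>F N in sequentially. norm (f z - fN N z) = 0"
        by eventually_elim (auto simp: fN_def)
      then show "(\<lambda>N. norm (f z - fN N z)) \<longlonglongrightarrow> 0" by (rule tendsto_eventually)
    qed
  qed (use fm fNm in \<open>auto simp: fN_def\<close>)
  then have "(\<lambda>N. LINT z|lebesgue. norm (f z - fN N z)) \<longlonglongrightarrow> 0" by simp
  then have "\<forall>\<^sub>F N in sequentially. (LINT z|lebesgue. norm (f z - fN N z)) < e / 2"
    using e by (intro order_tendstoD(2)[where y = 0]) auto
  then obtain N where N: "(LINT z|lebesgue. norm (f z - fN N z)) < e / 2"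
    by (auto simp: eventually_sequentially)
  have fN_int: "integrable lebesgue (fN N)"
    by (rule Bochner_Integration.integrable_bound[OF f fNm]) (auto simp: fN_def)
  obtain Z g where Z: "negligible Z" and g: "\<And>n. continuous_on UNIV (g n)"
    "\<And>z. z \<notin> Z \<Longrightarrow> (\<lambda>n. g n z) \<longlonglongrightarrow> fN N z"
    using lebesgue_measurable_imp_measurable_on[OF fNm[of N], of UNIV] unfolding measurable_on_def
    by auto
  \<comment> \<open>Clipping to the ball of radius \<open>N\<close> keeps continuity and makes dominated convergence applicable.\<close>
  let ?P = "closest_point (cball (0::'c) (real N))"
  have P: "continuous_on T ?P" for T by (rule continuous_on_closest_point) auto
  have Pin: "norm (?P y) \<le> real N" for y
    using closest_point_in_set[of "cball (0::'c) (real N)" y] by auto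
  have Pid: "?P (fN N z) = fN N z" for z by (rule closest_point_self) (auto simp: fN_def)
  define h where "h n z = ?P (g n z)" for n z
  have h: "continuous_on UNIV (h n)" for n
    unfolding h_def by (rule continuous_on_compose2[OF P g(1)]) auto
  have hm: "h n \<in> borel_measurable lebesgue" for n
    by (intro measurable_completion) (simp add: borel_measurable_continuous_onI h)
  have "(\<lambda>n. LINT z|lebesgue. norm (indicator K z *\<^sub>R (fN N z - h n z))) \<longlonglongrightarrow> (LINT z::'b|lebesgue. 0)"
  proof (rule integral_dominated_convergence)
    show "integrable lebesgue (\<lambda>z. indicator K z *\<^sub>R (2 * real N))"
      by (rule integrable_compact_continuous[OF K]) auto
    have "AE z in lebesgue. z \<notin> Z" using Z by (simp add: AE_not_in negligible_iff_null_sets)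
    then show "AE z in lebesgue. (\<lambda>n. norm (indicator K z *\<^sub>R (fN N z - h n z))) \<longlonglongrightarrow> 0"
    proof eventually_elim
      case (elim z)
      have "isCont ?P (fN N z)" using P[of UNIV] by (simp add: continuous_on_eq_continuous_at)
      then have "(\<lambda>n. h n z) \<longlonglongrightarrow> ?P (fN N z)"
        unfolding h_def using g(2)[OF elim] isCont_tendsto_compose by blast
      then have "(\<lambda>n. norm (indicator K z *\<^sub>R (fN N z - h n z))) \<longlonglongrightarrow> norm (indicator K z *\<^sub>R (fN N z - fN N z))"
        unfolding Pid by (intro tendsto_intros)
      then show ?case by simp
    qed
    show "AE z in lebesgue. norm (norm (indicator K z *\<^sub>R (fN N z - h n z))) \<le> indicator K z *\<^sub>R (2 * real N)" for n
    proof (rule AE_I2)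
      fix z
      have "norm (fN N z - h n z) \<le> norm (fN N z) + norm (h n z)" by (rule norm_triangle_ineq4)
      also have "\<dots> \<le> 2 * real N" using Pin[of "g n z"] by (auto simp: h_def fN_def)
      finally show "norm (norm (indicator K z *\<^sub>R (fN N z - h n z))) \<le> indicator K z *\<^sub>R (2 * real N)"
        by (auto simp: indicator_def)
    qed
  qed (use fNm hm Km in auto)
  then have "\<forall>\<^sub>F n in sequentially. (LINT z|lebesgue. norm (indicator K z *\<^sub>R (fN N z - h n z))) < e / 2"
    using e by (intro order_tendstoD(2)[where y = 0]) auto
  then obtain n where n: "(LINT z|lebesgue. norm (indicator K z *\<^sub>R (fN N z - h n z))) < e / 2"
    by (auto simp: eventually_sequentially)
  have hi: "integrable lebesgue (\<lambda>z. indicator K z *\<^sub>R h n z)"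
    by (rule integrable_compact_continuous[OF K continuous_on_subset[OF h]]) auto
  have fi: "integrable lebesgue (\<lambda>z. indicator K z *\<^sub>R fN N z)" "integrable lebesgue (\<lambda>z. indicator K z *\<^sub>R f z)"
    using fN_int f Km by (auto intro: integrable_mult_indicator)
  have "(LINT z|lebesgue. norm (indicator K z *\<^sub>R (f z - h n z)))
    \<le> (LINT z|lebesgue. norm (f z - fN N z) + norm (indicator K z *\<^sub>R (fN N z - h n z)))"
  proof (rule integral_mono)
    fix z
    show "norm (indicator K z *\<^sub>R (f z - h n z)) \<le> norm (f z - fN N z) + norm (indicator K z *\<^sub>R (fN N z - h n z))"
      using norm_triangle_ineq[of "f z - fN N z" "fN N z - h n z"] by (auto simp: indicator_def)
  qed (use f fN_int hi fi in \<open>auto simp: scaleR_diff_right\<close>)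
  also have "\<dots> = (LINT z|lebesgue. norm (f z - fN N z)) + (LINT z|lebesgue. norm (indicator K z *\<^sub>R (fN N z - h n z)))"
    using f fN_int hi fi by (intro Bochner_Integration.integral_add) (auto simp: scaleR_diff_right)
  finally have "(LINT z|lebesgue. norm (indicator K z *\<^sub>R (f z - h n z))) < e" using N n by linarith
  then show thesis using that[OF h] by blast
qed

text \<open>The function is split into a continuous part \<open>G\<close> and a part \<open>F\<close> that is small in the mean. Mollification
  does not increase the integral of \<open>norm F\<close> and approximates \<open>G\<close> uniformly on \<open>K\<close>; only values in the
  neighbourhood \<open>K'\<close> of radius one matter.\<close>

lemma mollify_tendsto_L1:
  fixes f :: "'b::euclidean_space \<Rightarrow> 'c::euclidean_space"
  assumes f: "integrable lebesgue f" and K: "compact K" and r: "\<And>k. r k > 0"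
    and lim: "(\<lambda>k. norm (c k) + r k) \<longlonglongrightarrow> 0"
  shows "(\<lambda>k. LINT z|lebesgue. norm (indicator K z *\<^sub>R (mollify (mollifier (c k) (r k)) f z - f z))) \<longlonglongrightarrow> 0"
proof (rule LIMSEQ_I)
  fix e :: real assume e: "e > 0"
  define K' where "K' = {x + y | x y. x \<in> K \<and> y \<in> cball 0 1}"
  have K': "compact K'" unfolding K'_def by (rule compact_sums[OF K compact_cball])
  have K'in: "y \<in> K'" if "z \<in> K" "dist z y \<le> 1" for y z
  proof -
    have "y = z + (y - z)" "y - z \<in> cball 0 1" using that by (auto simp: dist_norm norm_minus_commute)
    then show ?thesis unfolding K'_def using that by blast
  qed
  have Km: "K \<in> sets lebesgue" "K' \<in> sets lebesgue" using K K' by (simp_all add: compact_imp_closed)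
  obtain g where g: "continuous_on UNIV g" "(LINT z|lebesgue. norm (indicator K' z *\<^sub>R (f z - g z))) < e / 3"
    using continuous_dense_L1[OF f K', of "e / 3"] e by auto
  define G where "G z = indicator K' z *\<^sub>R g z" for z
  define F where "F z = indicator K' z *\<^sub>R (f z - g z)" for z
  have G: "integrable lebesgue G" unfolding G_def
    by (rule integrable_compact_continuous[OF K' continuous_on_subset[OF g(1)]]) auto
  have fK: "integrable lebesgue (\<lambda>z. indicator K' z *\<^sub>R f z)"
    using f Km by (auto intro: integrable_mult_indicator)
  have F: "integrable lebesgue F"
    unfolding F_def scaleR_diff_right using fK G unfolding G_def by (rule Bochner_Integration.integrable_diff)
  define m where "m = measure lebesgue K"
  have m: "m \<ge> 0" by (simp add: m_def)
  have intK: "integrable lebesgue (\<lambda>z. indicator K z *\<^sub>R (1::real))"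
    by (rule integrable_compact_continuous[OF K]) auto
  have m_eq: "(LINT z|lebesgue. indicator K z *\<^sub>R (1::real)) = m" by (simp add: m_def)
  have "e / (3 * (m + 1)) > 0" using e m by simp
  then obtain d where d: "d > 0" "\<And>x y. x \<in> K' \<Longrightarrow> y \<in> K' \<Longrightarrow> dist y x < d \<Longrightarrow> dist (g y) (g x) < e / (3 * (m + 1))"
    using compact_uniformly_continuous[OF continuous_on_subset[OF g(1)] K']
    unfolding uniformly_continuous_on_def by (metis subset_UNIV)
  have "\<forall>\<^sub>F k in sequentially. norm (c k) + r k < min d 1"
    using d(1) by (intro order_tendstoD(2)[OF lim]) auto
  then obtain k0 where k0: "\<And>k. k \<ge> k0 \<Longrightarrow> norm (c k) + r k < min d 1"
    by (auto simp: eventually_sequentially)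
  have main: "(LINT z|lebesgue. norm (indicator K z *\<^sub>R (mollify (mollifier (c k) (r k)) f z - f z))) < e"
    if k: "k \<ge> k0" for k
  proof -
    let ?\<rho> = "mollifier (c k) (r k)"
    have near: "dist y z < min d 1" if "?\<rho> (y - z) \<noteq> 0" for y z
    proof -
      have "y - z \<in> cball (c k) (r k)" using mollifier_eq_0[OF r] that by blast
      then have "norm (y - z) \<le> norm (c k) + r k"
        using norm_triangle_ineq[of "c k" "y - z - c k"] by (auto simp: dist_norm norm_minus_commute)
      then show ?thesis using k0[OF k] by (simp add: dist_norm)
    qed
    have split: "mollify ?\<rho> f z = mollify ?\<rho> F z + mollify ?\<rho> G z" if "z \<in> K" for z
    proof -
      have "mollify ?\<rho> f z = (LINT y|lebesgue. ?\<rho> (y - z) *\<^sub>R F y + ?\<rho> (y - z) *\<^sub>R G y)"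
        unfolding mollify_def
      proof (rule Bochner_Integration.integral_cong)
        fix y
        show "?\<rho> (y - z) *\<^sub>R f y = ?\<rho> (y - z) *\<^sub>R F y + ?\<rho> (y - z) *\<^sub>R G y"
        proof (cases "?\<rho> (y - z) = 0")
          case False
          then have "y \<in> K'" using near[of y z] that by (intro K'in[of z]) (auto simp: dist_commute)
          then show ?thesis by (simp add: F_def G_def algebra_simps)
        qed simp
      qed simp
      then show ?thesis using integrable_mollify[OF r F] integrable_mollify[OF r G]
        by (simp add: mollify_def)
    qed
    have Gclose: "norm (mollify ?\<rho> G z - g z) \<le> e / (3 * (m + 1))" if "z \<in> K" for z
    proof -
      have ii: "integrable lebesgue (\<lambda>y. ?\<rho> (y - z))"
        using integrable_mollifier[OF r, of "c k + z" k]
        by (simp add: mollifier_translate[OF r] integrable_completion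
            borel_measurable_continuous_onI continuous_on_mollifier[OF r])
      have "mollify ?\<rho> G z - g z = (LINT y|lebesgue. ?\<rho> (y - z) *\<^sub>R G y) - (LINT y|lebesgue. ?\<rho> (y - z) *\<^sub>R g z)"
        using ii by (simp add: mollify_def integral_mollifier_shift[OF r])
      also have "\<dots> = (LINT y|lebesgue. ?\<rho> (y - z) *\<^sub>R G y - ?\<rho> (y - z) *\<^sub>R g z)"
        using ii by (intro Bochner_Integration.integral_diff[symmetric] integrable_mollify[OF r G]) auto
      also have "norm \<dots> \<le> (LINT y|lebesgue. ?\<rho> (y - z) * (e / (3 * (m + 1))))"
      proof (rule Bochner_Integration.integral_norm_bound_integral)
        fix y
        show "norm (?\<rho> (y - z) *\<^sub>R G y - ?\<rho> (y - z) *\<^sub>R g z) \<le> ?\<rho> (y - z) * (e / (3 * (m + 1)))"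
        proof (cases "?\<rho> (y - z) = 0")
          case False
          then have "y \<in> K'" "z \<in> K'" "dist y z < d"
            using near[of y z] that by (auto simp: dist_commute intro: K'in[of z])
          then have "norm (G y - g z) \<le> e / (3 * (m + 1))"
            using d(2)[of z y] by (auto simp: G_def dist_norm)
          then show ?thesis unfolding scaleR_diff_right[symmetric] norm_scaleR
            using mollifier_nonneg[OF r, of "c k" k "y - z"]
            by (simp only: abs_of_nonneg) (rule mult_left_mono)
        qed simp
      qed (use ii integrable_mollify[OF r G] in auto)
      also have "\<dots> = e / (3 * (m + 1))" using ii by (simp add: integral_mollifier_shift[OF r])
      finally show ?thesis .
    qed
    have Fm: "integrable lebesgue (\<lambda>z. norm (mollify ?\<rho> F z))"
      "(LINT z|lebesgue. norm (mollify ?\<rho> F z)) \<le> (LINT z|lebesgue. norm (F z))"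
    proof -
      have nn: "(\<integral>\<^sup>+z. ennreal (norm (mollify ?\<rho> F z)) \<partial>lebesgue) \<le> ennreal (LINT z|lebesgue. norm (F z))"
        using nn_integral_mollify_le[OF r F, of "c k" k] nn_integral_eq_integral[of lebesgue "\<lambda>z. norm (F z)"] F by simp
      have meas: "(\<lambda>z. norm (mollify ?\<rho> F z)) \<in> borel_measurable lebesgue"
        by (intro measurable_completion)
          (simp add: borel_measurable_continuous_onI continuous_on_mollify[OF r F] continuous_on_norm)
      show I: "integrable lebesgue (\<lambda>z. norm (mollify ?\<rho> F z))"
        by (rule integrableI_bounded[OF meas]) (use nn in \<open>auto simp: top_unique less_top[symmetric]\<close>)
      have "ennreal (LINT z|lebesgue. norm (mollify ?\<rho> F z)) \<le> ennreal (LINT z|lebesgue. norm (F z))"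
        using nn nn_integral_eq_integral[OF I] by simp
      then show "(LINT z|lebesgue. norm (mollify ?\<rho> F z)) \<le> (LINT z|lebesgue. norm (F z))"
        by (subst (asm) ennreal_le_iff) auto
    qed
    have mc: "integrable lebesgue (\<lambda>z. indicator K z *\<^sub>R mollify ?\<rho> f z)"
      by (intro integrable_compact_continuous K continuous_on_mollify[OF r f])
    have fK2: "integrable lebesgue (\<lambda>z. indicator K z *\<^sub>R f z)"
      using f Km by (auto intro: integrable_mult_indicator)
    have "(LINT z|lebesgue. norm (indicator K z *\<^sub>R (mollify ?\<rho> f z - f z)))
      \<le> (LINT z|lebesgue. norm (mollify ?\<rho> F z) + (e / (3 * (m + 1))) * (indicator K z *\<^sub>R 1) + norm (F z))"
    proof (rule integral_mono)
      fix z
      show "norm (indicator K z *\<^sub>R (mollify ?\<rho> f z - f z))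
        \<le> norm (mollify ?\<rho> F z) + (e / (3 * (m + 1))) * (indicator K z *\<^sub>R 1) + norm (F z)"
      proof (cases "z \<in> K")
        case True
        have zK': "z \<in> K'" using K'in[OF True] by simp
        have "mollify ?\<rho> f z - f z = mollify ?\<rho> F z + (mollify ?\<rho> G z - g z) - F z"
          using split[OF True] zK' by (simp add: F_def)
        also have "norm \<dots> \<le> norm (mollify ?\<rho> F z) + norm (mollify ?\<rho> G z - g z) + norm (F z)"
          by (meson norm_triangle_ineq4 norm_triangle_ineq order_trans add_right_mono)
        finally show ?thesis using True Gclose[OF True] by simp
      qed simp
    qed (use mc fK2 Fm(1) F intK in \<open>auto simp: scaleR_diff_right\<close>)
    also have "\<dots> = (LINT z|lebesgue. norm (mollify ?\<rho> F z)) + (e / (3 * (m + 1))) * m + (LINT z|lebesgue. norm (F z))"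
      using Fm(1) F intK m_eq by simp
    also have "\<dots> < e / 3 + e / 3 + e / 3"
    proof -
      have "(e / (3 * (m + 1))) * m \<le> e / 3" using e m by (simp add: field_simps)
      then show ?thesis using Fm(2) g(2)[folded F_def] by linarith
    qed
    finally show ?thesis by simp
  qed
  show "\<exists>k0. \<forall>k\<ge>k0. norm ((LINT z|lebesgue. norm (indicator K z *\<^sub>R (mollify (mollifier (c k) (r k)) f z - f z))) - 0) < e"
    using main by (intro exI[of _ k0]) simp
qed

text \<open>Along a subsequence with errors at most \<open>(1/2) ^ j\<close> the sum of all errors is integrable. Finiteness of
  this sum gives convergence almost everywhere, and the sum itself gives the dominating function.\<close>

lemma L1_convergent_dominated_subseq:
  fixes f :: "nat \<Rightarrow> 'a \<Rightarrow> 'c::euclidean_space"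
  assumes f: "\<And>k. integrable M (f k)" and g: "integrable M g"
    and lim: "(\<lambda>k. LINT z|M. norm (f k z - g z)) \<longlonglongrightarrow> 0"
  obtains \<sigma> D where "strict_mono (\<sigma>::nat \<Rightarrow> nat)" "integrable M D"
    "AE z in M. (\<lambda>k. f (\<sigma> k) z) \<longlonglongrightarrow> g z" "AE z in M. \<forall>k. norm (f (\<sigma> k) z) \<le> D z"
proof -
  have ex: "\<exists>n>N. (LINT z|M. norm (f n z - g z)) \<le> (1/2) ^ j" for N j :: nat
  proof -
    have "\<forall>\<^sub>F k in sequentially. (LINT z|M. norm (f k z - g z)) < (1/2) ^ j"
      by (intro order_tendstoD(2)[OF lim]) simp
    then have "\<forall>\<^sub>F k in sequentially. (LINT z|M. norm (f k z - g z)) < (1/2) ^ j \<and> k > N"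
      using eventually_gt_at_top[of N] by eventually_elim auto
    then obtain n where "(LINT z|M. norm (f n z - g z)) < (1/2) ^ j" "n > N"
      by (auto simp: eventually_sequentially)
    then show ?thesis by (intro exI[of _ n]) linarith
  qed
  obtain \<sigma> where \<sigma>: "\<And>j. (LINT z|M. norm (f (\<sigma> j) z - g z)) \<le> (1/2) ^ j" "\<And>j. \<sigma> j < \<sigma> (Suc j)"
    using dependent_nat_choice[of "\<lambda>j n. (LINT z|M. norm (f n z - g z)) \<le> (1/2) ^ j" "\<lambda>j n m. n < m"] ex
    by blast
  define a where "a j z = norm (f (\<sigma> j) z - g z)" for j z
  have a: "integrable M (a j)" "a j z \<ge> 0" for j z unfolding a_def using f g by auto
  have [measurable]: "\<And>j. a j \<in> borel_measurable M" using a by auto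
  have "(\<integral>\<^sup>+z. (\<Sum>j. ennreal (a j z)) \<partial>M) = (\<Sum>j. \<integral>\<^sup>+z. ennreal (a j z) \<partial>M)"
    by (rule nn_integral_suminf) measurable
  also have "\<dots> = (\<Sum>j. ennreal (LINT z|M. a j z))"
    using a by (simp add: nn_integral_eq_integral)
  also have "\<dots> \<le> (\<Sum>j. ennreal ((1/2) ^ j))"
    by (intro suminf_le) (use \<sigma>(1) in \<open>auto simp: a_def intro: ennreal_leI\<close>)
  also have "\<dots> = ennreal (\<Sum>j. (1/2) ^ j)" by (rule suminf_ennreal2) auto
  finally have fin: "(\<integral>\<^sup>+z. (\<Sum>j. ennreal (a j z)) \<partial>M) < \<infinity>"
    using le_less_trans ennreal_less_top by (metis infinity_ennreal_def)
  have ae: "AE z in M. (\<Sum>j. ennreal (a j z)) \<noteq> \<infinity>"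
    by (rule nn_integral_PInf_AE) (use fin in auto)
  define S where "S z = enn2real (\<Sum>j. ennreal (a j z))" for z
  have S: "integrable M S"
  proof (rule integrableI_bounded)
    show "S \<in> borel_measurable M" unfolding S_def by measurable
    have "(\<integral>\<^sup>+z. ennreal (norm (S z)) \<partial>M) \<le> (\<integral>\<^sup>+z. (\<Sum>j. ennreal (a j z)) \<partial>M)"
      by (rule nn_integral_mono_AE)
        (use ae in \<open>eventually_elim, auto simp: S_def ennreal_enn2real_if\<close>)
    then show "(\<integral>\<^sup>+z. ennreal (norm (S z)) \<partial>M) < \<infinity>" using fin by (rule le_less_trans)
  qed
  have sm: "AE z in M. summable (\<lambda>j. a j z) \<and> (\<forall>j. a j z \<le> S z)"
    using ae
  proof eventually_elim
    case (elim z)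
    have s: "summable (\<lambda>j. a j z)"
      by (rule summable_suminf_not_top) (use a elim in auto)
    have "S z = (\<Sum>j. a j z)" unfolding S_def
      using suminf_nonneg[OF s a(2)] by (subst suminf_ennreal2[OF a(2) s]) simp
    then show ?case using s a by (auto intro: sum_le_suminf[where I = "{j}" for j, simplified])
  qed
  show thesis
  proof (rule that[of \<sigma> "\<lambda>z. norm (g z) + S z"])
    show "strict_mono \<sigma>" using \<sigma>(2) by (simp add: strict_mono_Suc_iff)
    show "integrable M (\<lambda>z. norm (g z) + S z)" using g S by auto
    show "AE z in M. (\<lambda>k. f (\<sigma> k) z) \<longlonglongrightarrow> g z"
      using sm
    proof eventually_elim
      case (elim z)
      then have "(\<lambda>j. norm (f (\<sigma> j) z - g z)) \<longlonglongrightarrow> 0" unfolding a_def[symmetric]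
        by (intro summable_LIMSEQ_zero) auto
      then show ?case by (simp add: tendsto_norm_zero_iff LIM_zero_iff)
    qed
    show "AE z in M. \<forall>k. norm (f (\<sigma> k) z) \<le> norm (g z) + S z"
      using sm
    proof eventually_elim
      case (elim z)
      show ?case
      proof
        fix k
        have "norm (f (\<sigma> k) z) \<le> norm (g z) + a k z" unfolding a_def
          by (metis add.commute norm_triangle_sub)
        then show "norm (f (\<sigma> k) z) \<le> norm (g z) + S z" using elim by (smt (verit))
      qed
    qed
  qed
qed

section \<open>Integration by parts in a half-space\<close>

lemma lborel_integral_shift:
  fixes g :: "'b::euclidean_space \<Rightarrow> real"
  assumes "g \<in> borel_measurable borel"
  shows "(LINT z|lborel. g (z + a)) = (LINT z|lborel. g z)"
proof -
  have "(LINT z|lborel. g z) = integral\<^sup>L (distr lborel borel ((+) a)) g"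
    by (simp add: lborel_distr_plus)
  also have "\<dots> = (LINT z|lborel. g (a + z))"
    by (rule integral_distr) (use assms in auto)
  finally show ?thesis by (simp add: add.commute)
qed

text \<open>The integral of a difference quotient in a direction \<open>e\<close> that does not leave the half-space is, by
  translation, \<open>- 1 / h\<close> times the integral of \<open>f\<close> over the part of the half-space that the translation by \<open>h
  e\<close> uncovers. This is zero for horizontal \<open>e\<close>, and nonpositive for \<open>f \<ge> 0\<close>.\<close>

lemma integral_directional_derivative_le_0:
  fixes f :: "'a::euclidean_space \<times> real \<Rightarrow> real"
  defines "D \<equiv> {z::'a \<times> real. snd z > 0}"
  assumes der: "\<And>z. z \<in> D \<Longrightarrow> (f has_derivative f' z) (at z)"
    and bd: "\<And>z v. z \<in> D \<Longrightarrow> \<bar>f' z v\<bar> \<le> M * norm v"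
    and supp: "\<And>z. z \<in> D \<Longrightarrow> norm z > R \<Longrightarrow> f z = 0"
    and fb: "\<And>z. z \<in> D \<Longrightarrow> \<bar>f z\<bar> \<le> Bf"
    and e: "snd e \<ge> 0" and sgn: "snd e = 0 \<or> (\<forall>z\<in>D. f z \<ge> 0)"
  shows "integrable lborel (\<lambda>z. indicator D z * f' z e)"
    and "(LINT z|lborel. indicator D z * f' z e) \<le> 0"
proof -
  have D: "open D" unfolding D_def
    by (intro open_Collect_less continuous_intros)
  have shift: "z + h *\<^sub>R e \<in> D" if "z \<in> D" "h \<ge> 0" for z h
    using that e by (auto simp: D_def add_pos_nonneg)
  have cont: "continuous_on D f"
    using der by (meson continuous_at_imp_continuous_on has_derivative_continuous)
  define q where "q n z = indicator D z * (real (Suc n) * (f (z + (1 / real (Suc n)) *\<^sub>R e) - f z))" for n z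
  have fD: "(\<lambda>z. indicator D z * f z) \<in> borel_measurable borel"
    using borel_measurable_continuous_on_indicator[OF _ cont] D by simp
  have fDh: "(\<lambda>z. indicator D z * f (z + h *\<^sub>R e)) \<in> borel_measurable borel" if "h \<ge> 0" for h
  proof -
    have "continuous_on D (\<lambda>z. f (z + h *\<^sub>R e))"
      by (rule continuous_on_compose2[OF cont]) (use shift that in \<open>auto intro!: continuous_intros\<close>)
    then show ?thesis using borel_measurable_continuous_on_indicator[of D "\<lambda>z. f (z + h *\<^sub>R e)"] D by simp
  qed
  have q_meas: "q n \<in> borel_measurable borel" for n
  proof -
    have "q n = (\<lambda>z. real (Suc n) * (indicator D z * f (z + (1 / real (Suc n)) *\<^sub>R e) - indicator D z * f z))"
      by (auto simp: q_def fun_eq_iff indicator_def)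
    then show ?thesis using fD fDh[of "1 / real (Suc n)"] by simp
  qed
  have quot: "\<bar>f (z + h *\<^sub>R e) - f z\<bar> \<le> h * (M * norm e)" if "z \<in> D" "h \<ge> 0" for z h
  proof -
    have "norm (f (z + h *\<^sub>R e) - f z) \<le> norm (h *\<^sub>R e) * M"
    proof (rule differentiable_bound_segment[of z "h *\<^sub>R e" D f f'])
      show "z + t *\<^sub>R (h *\<^sub>R e) \<in> D" if "t \<in> {0..1}" for t
        using shift[of z "t * h"] that \<open>z \<in> D\<close> \<open>h \<ge> 0\<close> by simp
      show "(f has_derivative f' x) (at x within D)" if "x \<in> D" for x
        using der[OF that] by (rule has_derivative_at_withinI)
      have "onorm (f' (z + x *\<^sub>R (h *\<^sub>R e))) \<le> M" if "x \<in> {0..1}" for x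
        using shift[of z "x * h"] that \<open>z \<in> D\<close> \<open>h \<ge> 0\<close> by (intro onorm_le) (auto intro: bd)
      then show "onorm (f' (z + x *\<^sub>R (h *\<^sub>R e))) \<le> M" if "x \<in> {0..1}" for x using that by blast
    qed
    then show ?thesis using that(2) by (simp add: mult_ac)
  qed
  define B where "B = cball (0::'a \<times> real) (\<bar>R\<bar> + norm e)"
  define w where "w z = indicator B z *\<^sub>R (\<bar>M\<bar> * norm e)" for z
  have w: "integrable lborel w" unfolding w_def B_def
    by (rule borel_integrable_compact) auto
  have far: "norm (z + (1 / real (Suc n)) *\<^sub>R e) > R \<and> norm z > R" if "z \<notin> B" for z n
  proof -
    have n: "norm z > \<bar>R\<bar> + norm e" using that by (simp add: B_def)
    have he: "norm ((1 / real (Suc n)) *\<^sub>R e) \<le> norm e"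
      by (simp add: divide_le_eq mult_le_cancel_left1)
    have "norm z \<le> norm (z + (1 / real (Suc n)) *\<^sub>R e) + norm ((1 / real (Suc n)) *\<^sub>R e)"
      by (metis add_diff_cancel_right' norm_triangle_ineq4)
    then show ?thesis using n he norm_ge_zero[of e] by linarith
  qed
  have q_bd: "norm (q n z) \<le> w z" for n z
  proof (cases "z \<in> D")
    case True
    let ?h = "1 / real (Suc n)"
    have "\<bar>real (Suc n) * (f (z + ?h *\<^sub>R e) - f z)\<bar> \<le> real (Suc n) * (?h * (M * norm e))"
      unfolding abs_mult using quot[OF True, of ?h] by (intro mult_mono) auto
    also have "\<dots> \<le> \<bar>M\<bar> * norm e" by (simp add: mult_right_mono)
    finally have 1: "norm (q n z) \<le> \<bar>M\<bar> * norm e" using True by (simp add: q_def)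
    show ?thesis
    proof (cases "z \<in> B")
      case False
      then have "q n z = 0"
        using supp[OF True] supp[OF shift[OF True, of ?h]] far[of z n] by (simp add: q_def)
      then show ?thesis by (simp add: w_def)
    qed (use 1 in \<open>simp add: w_def\<close>)
  qed (simp add: q_def w_def)
  have q_lim: "(\<lambda>n. q n z) \<longlonglongrightarrow> indicator D z * f' z e" for z
  proof (cases "z \<in> D")
    case True
    have "((\<lambda>t. (f (z + t *\<^sub>R e) - f z) /\<^sub>R t) \<longlongrightarrow> f' z e) (at 0)"
    proof -
      have "((\<lambda>t. f (z + t *\<^sub>R e)) has_derivative (\<lambda>t. f' z (t *\<^sub>R e))) (at 0)"
        by (rule has_derivative_compose[where g = f and f = "\<lambda>t. z + t *\<^sub>R e"])
          (use der[OF True] in \<open>auto intro!: derivative_eq_intros\<close>)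
      moreover have "f' z (t *\<^sub>R e) = t * f' z e" for t
        using has_derivative_linear[OF der[OF True]] by (simp add: linear_scale)
      ultimately have "((\<lambda>t. f (z + t *\<^sub>R e)) has_real_derivative f' z e) (at 0)"
        unfolding has_field_derivative_def
        by (elim has_derivative_eq_rhs) (auto simp: fun_eq_iff)
      then show ?thesis by (simp add: DERIV_def divide_inverse mult.commute)
    qed
    moreover have "filterlim (\<lambda>n. 1 / real (Suc n)) (at 0) sequentially"
      using LIMSEQ_inverse_real_of_nat by (auto simp: filterlim_at inverse_eq_divide)
    ultimately have "(\<lambda>n. (f (z + (1 / real (Suc n)) *\<^sub>R e) - f z) /\<^sub>R (1 / real (Suc n))) \<longlonglongrightarrow> f' z e"
      by (rule filterlim_compose)
    then show ?thesis using True by (simp add: q_def mult.commute)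
  qed (simp add: q_def)
  have lim_meas: "(\<lambda>z. indicator D z * f' z e) \<in> borel_measurable lborel"
    by (rule borel_measurable_LIMSEQ_real[OF q_lim]) (use q_meas in simp)
  note dct = lim_meas _ w AE_I2[OF q_lim] AE_I2[OF q_bd]
  show "integrable lborel (\<lambda>z. indicator D z * f' z e)"
    by (rule integrable_dominated_convergence[OF dct]) (use q_meas in simp)
  have "(\<lambda>n. LINT z|lborel. q n z) \<longlonglongrightarrow> (LINT z|lborel. indicator D z * f' z e)"
    by (rule integral_dominated_convergence[OF dct]) (use q_meas in simp)
  moreover have "(LINT z|lborel. q n z) \<le> 0" for n
  proof -
    let ?h = "1 / real (Suc n)"
    have ibd: "integrable lborel (\<lambda>z. indicator B z *\<^sub>R Bf)" unfolding B_def
      by (rule borel_integrable_compact) auto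
    have "norm (indicator D z * f z) \<le> norm (indicator B z *\<^sub>R Bf)" for z
      using fb[of z] supp[of z] far[of z n] by (auto simp: indicator_def)
    then have ifD: "integrable lborel (\<lambda>z. indicator D z * f z)"
      by (intro Bochner_Integration.integrable_bound[OF ibd]) (use fD in auto)
    have "norm (indicator D z * f (z + ?h *\<^sub>R e)) \<le> norm (indicator B z *\<^sub>R Bf)" for z
      using fb[OF shift[of z ?h]] supp[OF shift[of z ?h]] far[of z n]
      by (cases "z \<in> D"; cases "z \<in> B") auto
    then have ifDh: "integrable lborel (\<lambda>z. indicator D z * f (z + ?h *\<^sub>R e))"
      by (intro Bochner_Integration.integrable_bound[OF ibd]) (use fDh[of ?h] in auto)
    define g where "g z = indicator D (z - ?h *\<^sub>R e) * f z" for z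
    have g_meas: "g \<in> borel_measurable borel"
    proof -
      have "(\<lambda>z. z - ?h *\<^sub>R e) \<in> borel_measurable borel" by measurable
      from measurable_compose[OF this fDh[of ?h]] show ?thesis by (simp add: g_def[abs_def])
    qed
    have eq: "(LINT z|lborel. indicator D z * f (z + ?h *\<^sub>R e)) = (LINT z|lborel. g z)"
      using lborel_integral_shift[OF g_meas, of "?h *\<^sub>R e"] by (simp add: g_def)
    have gle: "g z \<le> indicator D z * f z" for z
    proof -
      consider "z - ?h *\<^sub>R e \<in> D" "z \<in> D" | "z - ?h *\<^sub>R e \<notin> D" "z \<in> D" | "z - ?h *\<^sub>R e \<notin> D" "z \<notin> D"
        using shift[of "z - ?h *\<^sub>R e" ?h] by auto
      then show ?thesis
      proof cases
        case 2
        then have "snd e \<noteq> 0" by (auto simp: D_def)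
        then show ?thesis using sgn 2 by (auto simp: g_def)
      qed (auto simp: g_def)
    qed
    have "(LINT z|lborel. g z) \<le> (LINT z|lborel. indicator D z * f z)"
    proof (rule integral_mono[OF _ ifD gle])
      show "integrable lborel g"
        by (rule Bochner_Integration.integrable_bound[OF ifD])
          (use g_meas shift[of "z - ?h *\<^sub>R e" ?h for z] in \<open>auto simp: g_def indicator_def intro!: AE_I2\<close>)
    qed
    moreover have "(LINT z|lborel. q n z) = (LINT z|lborel. real (Suc n) * (indicator D z * f (z + ?h *\<^sub>R e) - indicator D z * f z))"
      by (rule Bochner_Integration.integral_cong) (auto simp: q_def indicator_def)
    ultimately show ?thesis using eq ifD ifDh
      by (simp add: mult_le_0_iff)
  qed
  ultimately show "(LINT z|lborel. indicator D z * f' z e) \<le> 0"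
    by (intro LIMSEQ_le_const2) auto
qed

text \<open>The differential inequality \<open>W \<le> - div a + \<partial>\<^sub>t w\<close> is multiplied by \<open>h (w) \<psi> \<ge> 0\<close> and integrated by parts
  over the half-space. Here \<open>Px\<close> and \<open>Pt\<close> are the derivatives of the cutoff \<open>\<psi>\<close>, and \<open>H\<close> is a primitive of \<open>h\<close>.\<close>

lemma smooth_energy_inequality:
  fixes w \<psi> Pt W h h' H :: "_ \<Rightarrow> real" and a Px :: "'a::euclidean_space \<times> real \<Rightarrow> 'a"
  defines "D \<equiv> {z::'a \<times> real. snd z > 0}"
  assumes w: "\<And>z. (w has_derivative (\<lambda>v. v \<bullet> Dw z)) (at z)" "\<And>z. norm (Dw z) \<le> B"
      "\<And>z. 0 \<le> w z" "\<And>z. w z \<le> B"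
    and a: "\<And>b z. b \<in> Basis \<Longrightarrow> ((\<lambda>z. a z \<bullet> b) has_derivative (\<lambda>v. v \<bullet> Da b z)) (at z)"
      "\<And>b z. b \<in> Basis \<Longrightarrow> norm (Da b z) \<le> B" "\<And>b z. b \<in> Basis \<Longrightarrow> \<bar>a z \<bullet> b\<bar> \<le> B"
    and h: "\<And>x. x \<ge> 0 \<Longrightarrow> (h has_real_derivative h' x) (at x)" "\<And>x. x \<ge> 0 \<Longrightarrow> (H has_real_derivative h x) (at x)"
      "\<And>x. x \<ge> 0 \<Longrightarrow> 0 \<le> h x \<and> h x \<le> Mh" "\<And>x. x \<ge> 0 \<Longrightarrow> \<bar>h' x\<bar> \<le> Mh"
      "\<And>x. x \<ge> 0 \<Longrightarrow> 0 \<le> H x \<and> H x \<le> Mh * x"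
    and \<psi>: "\<And>z. z \<in> D \<Longrightarrow> (\<psi> has_derivative (\<lambda>v. Px z \<bullet> fst v + Pt z * snd v)) (at z)"
      "\<And>z. z \<in> D \<Longrightarrow> 0 \<le> \<psi> z \<and> \<psi> z \<le> M" "\<And>z. z \<in> D \<Longrightarrow> norm (Px z) \<le> M"
      "\<And>z. z \<in> D \<Longrightarrow> \<bar>Pt z\<bar> \<le> M"
      "\<And>z. z \<in> D \<Longrightarrow> z \<notin> K \<Longrightarrow> \<psi> z = 0 \<and> Px z = 0 \<and> Pt z = 0"
    and K: "bounded K"
    and weak: "\<And>z. z \<in> D \<Longrightarrow> z \<in> K \<Longrightarrow> W z \<le> - (\<Sum>b\<in>Basis. (b, 0) \<bullet> Da b z) + snd (Dw z)"
  shows "(LINT z|lborel. indicator D z * (W z * h (w z) * \<psi> z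
    - (h' (w z) * \<psi> z * (a z \<bullet> fst (Dw z)) + h (w z) * (a z \<bullet> Px z)) + H (w z) * Pt z)) \<le> 0"
    (is "(LINT z|lborel. indicator D z * ?Q z) \<le> 0")
proof -
  obtain R where R: "\<And>z. z \<in> K \<Longrightarrow> norm z \<le> R" using K by (auto simp: bounded_iff)
  have pos: "0 \<le> B" "0 \<le> Mh" using w(3,4)[of 0] h(3)[of 0] by (linarith, force)
  have M0: "0 \<le> M" if "z \<in> D" for z using \<psi>(2)[OF that] by linarith
  define P where "P z v = Px z \<bullet> fst v + Pt z * snd v" for z v
  have P: "\<bar>P z v\<bar> \<le> 2 * M * norm v" if "z \<in> D" for z v
  proof -
    have "\<bar>Px z \<bullet> fst v\<bar> \<le> M * norm v"
    proof -
      have "norm (Px z) * norm (fst v) \<le> M * norm v"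
        using \<psi>(3)[OF that] norm_fst_le[of "fst v" "snd v"] M0[OF that] by (intro mult_mono) auto
      then show ?thesis using Cauchy_Schwarz_ineq2[of "Px z" "fst v"] by linarith
    qed
    moreover have "\<bar>Pt z * snd v\<bar> \<le> M * norm v"
      unfolding abs_mult using \<psi>(4)[OF that] norm_snd_le[of "snd v" "fst v"] M0[OF that]
      by (intro mult_mono) auto
    ultimately show ?thesis unfolding P_def by linarith
  qed
  have hw: "((\<lambda>z. h (w z)) has_derivative (\<lambda>v. h' (w z) * (v \<bullet> Dw z))) (at z)"
    and Hw: "((\<lambda>z. H (w z)) has_derivative (\<lambda>v. h (w z) * (v \<bullet> Dw z))) (at z)" for z
    using DERIV_compose_FDERIV[OF h(1)[OF w(3)] w(1)] DERIV_compose_FDERIV[OF h(2)[OF w(3)] w(1)]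
    by (auto simp: mult.commute)
  have Dwb: "\<bar>v \<bullet> Dw z\<bar> \<le> B * norm v" for v z
    using Cauchy_Schwarz_ineq2[of v "Dw z"] w(2)[of z]
    by (metis mult.commute mult_left_mono norm_ge_zero order_trans)
  have Dab: "\<bar>v \<bullet> Da b z\<bar> \<le> B * norm v" if "b \<in> Basis" for v z b
    using Cauchy_Schwarz_ineq2[of v "Da b z"] a(2)[OF that, of z]
    by (metis mult.commute mult_left_mono norm_ge_zero order_trans)
  \<comment> \<open>The flux times the test function: its horizontal derivatives integrate to zero.\<close>
  define F where "F b z = (a z \<bullet> b) * h (w z) * \<psi> z" for b z
  define F' where "F' b z v = (a z \<bullet> b) * (h' (w z) * (v \<bullet> Dw z) * \<psi> z + h (w z) * P z v)
      + (v \<bullet> Da b z) * (h (w z) * \<psi> z)" for b z v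
  have F: "(F b has_derivative F' b z) (at z)" if "z \<in> D" "b \<in> Basis" for b z
    unfolding F_def[abs_def] F'_def[abs_def] P_def
    by (rule has_derivative_eq_rhs, (rule derivative_intros a(1) hw \<psi>(1) that)+)
      (auto simp: fun_eq_iff algebra_simps)
  have F_bd: "\<bar>F' b z v\<bar> \<le> (B * (Mh * B * M + Mh * (2 * M)) + B * (Mh * M)) * norm v" if "z \<in> D" "b \<in> Basis" for b z v
  proof -
    note M = M0[OF that(1)]
    have "\<bar>h' (w z) * (v \<bullet> Dw z) * \<psi> z\<bar> \<le> Mh * (B * norm v) * M"
      unfolding abs_mult using h(4)[OF w(3)] Dwb \<psi>(2)[OF that(1)] pos M by (intro mult_mono) auto
    moreover have "\<bar>h (w z) * P z v\<bar> \<le> Mh * (2 * M * norm v)"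
      unfolding abs_mult using h(3)[OF w(3)] P[OF that(1)] pos M by (intro mult_mono) auto
    ultimately have "\<bar>h' (w z) * (v \<bullet> Dw z) * \<psi> z + h (w z) * P z v\<bar> \<le> Mh * (B * norm v) * M + Mh * (2 * M * norm v)"
      by linarith
    then have "\<bar>(a z \<bullet> b) * (h' (w z) * (v \<bullet> Dw z) * \<psi> z + h (w z) * P z v)\<bar> \<le> B * (Mh * (B * norm v) * M + Mh * (2 * M * norm v))"
      unfolding abs_mult using a(3)[OF that(2)] pos M by (intro mult_mono) auto
    moreover have "\<bar>(v \<bullet> Da b z) * (h (w z) * \<psi> z)\<bar> \<le> (B * norm v) * (Mh * M)"
      unfolding abs_mult using Dab[OF that(2)] h(3)[OF w(3)] \<psi>(2)[OF that(1)] pos M by (intro mult_mono) auto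
    ultimately show ?thesis unfolding F'_def by (simp add: algebra_simps)
  qed
  have F_fb: "\<bar>F b z\<bar> \<le> B * Mh * M" if "z \<in> D" "b \<in> Basis" for b z
    unfolding F_def abs_mult using a(3)[OF that(2)] h(3)[OF w(3)] \<psi>(2)[OF that(1)] pos M0[OF that(1)]
    by (intro mult_mono) auto
  have F_int: "integrable lborel (\<lambda>z. indicator D z * F' b z (b, 0))"
    and F_0: "(LINT z|lborel. indicator D z * F' b z (b, 0)) = 0" if b: "b \<in> Basis" for b
  proof -
    have sup: "F b z = 0" if "z \<in> D" "norm z > R" for z
      using \<psi>(5)[OF that(1)] R[of z] that(2) by (force simp: F_def)
    note ibp = integral_directional_derivative_le_0[where f = "F b" and f' = "F' b" and e = "(b, 0)",
      folded D_def, OF F[OF _ b] F_bd[OF _ b] sup F_fb[OF _ b]]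
    note ibp' = integral_directional_derivative_le_0[where f = "\<lambda>z. - F b z" and f' = "\<lambda>z v. - F' b z v" and e = "(b, 0)",
      folded D_def, OF has_derivative_minus[OF F[OF _ b]], where R = R and Bf = "B * Mh * M"
        and M = "(B * (Mh * B * M + Mh * (2 * M)) + B * (Mh * M))"]
    show "integrable lborel (\<lambda>z. indicator D z * F' b z (b, 0))" by (rule ibp(1)) auto
    have "(LINT z|lborel. indicator D z * F' b z (b, 0)) \<le> 0" by (rule ibp(2)) auto
    moreover have "(LINT z|lborel. indicator D z * (- F' b z (b, 0))) \<le> 0"
      by (rule ibp'(2)) (use F_bd[OF _ b] F_fb[OF _ b] sup in auto)
    ultimately show "(LINT z|lborel. indicator D z * F' b z (b, 0)) = 0" by simp
  qed
  \<comment> \<open>The primitive \<open>H\<close> turns \<open>h (w) \<partial>\<^sub>t w\<close> into a time derivative; at \<open>t = 0\<close> the boundary term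
    has the sign of \<open>- H (w) \<psi>\<close>, so only an inequality remains.\<close>
  define T where "T z = H (w z) * \<psi> z" for z
  define T' where "T' z v = H (w z) * P z v + h (w z) * (v \<bullet> Dw z) * \<psi> z" for z v
  have T: "(T has_derivative T' z) (at z)" if "z \<in> D" for z
    unfolding T_def[abs_def] T'_def[abs_def] P_def
    by (rule has_derivative_mult[OF Hw \<psi>(1)[OF that]])
  have Hb: "\<bar>H (w z)\<bar> \<le> Mh * B" for z
    using h(5)[OF w(3), of z] mult_left_mono[OF w(4) pos(2), of z] by linarith
  have T_bd: "\<bar>T' z v\<bar> \<le> (Mh * B * (2 * M) + Mh * B * M) * norm v" if "z \<in> D" for z v
  proof -
    have "\<bar>h (w z) * (v \<bullet> Dw z) * \<psi> z\<bar> \<le> Mh * (B * norm v) * M"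
      unfolding abs_mult using h(3)[OF w(3)] Dwb \<psi>(2)[OF that(1)] pos M0[OF that] by (intro mult_mono) auto
    moreover have "\<bar>H (w z) * P z v\<bar> \<le> (Mh * B) * (2 * M * norm v)"
      unfolding abs_mult using Hb P[OF that(1)] pos M0[OF that] by (intro mult_mono) auto
    ultimately show ?thesis unfolding T'_def by (simp add: algebra_simps)
  qed
  have T_int: "integrable lborel (\<lambda>z. indicator D z * T' z (0, 1))"
    and T_le: "(LINT z|lborel. indicator D z * T' z (0, 1)) \<le> 0"
  proof -
    have sup: "T z = 0" if "z \<in> D" "norm z > R" for z
      using \<psi>(5)[OF that(1)] R[of z] that(2) by (force simp: T_def)
    have fb: "\<bar>T z\<bar> \<le> Mh * B * M" if "z \<in> D" for z
      unfolding T_def abs_mult using Hb \<psi>(2)[OF that(1)] pos M0[OF that(1)] by (intro mult_mono) auto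
    have nn: "0 \<le> T z" if "z \<in> D" for z
      using h(5)[OF w(3), of z] \<psi>(2)[OF that] by (simp add: T_def)
    note ibp = integral_directional_derivative_le_0[where f = T and f' = T' and e = "(0, 1)",
      folded D_def, OF T T_bd sup fb]
    show "integrable lborel (\<lambda>z. indicator D z * T' z (0, 1))"
      "(LINT z|lborel. indicator D z * T' z (0, 1)) \<le> 0" by (rule ibp; use nn in simp)+
  qed
  have le: "?Q z \<le> T' z (0, 1) - (\<Sum>b\<in>Basis. F' b z (b, 0))" if zD: "z \<in> D" for z
  proof (cases "z \<in> K")
    case False
    then show ?thesis using \<psi>(5)[OF zD] by (simp add: T'_def F'_def P_def)
  next
    case True
    have "h (w z) * \<psi> z \<ge> 0" using h(3)[OF w(3), of z] \<psi>(2)[OF zD] by simp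
    then have "W z * (h (w z) * \<psi> z) \<le> (- (\<Sum>b\<in>Basis. (b, 0) \<bullet> Da b z) + snd (Dw z)) * (h (w z) * \<psi> z)"
      using weak[OF zD True] by (rule mult_right_mono[rotated])
    moreover have "(\<Sum>b\<in>Basis. F' b z (b, 0)) = h' (w z) * \<psi> z * (a z \<bullet> fst (Dw z)) + h (w z) * (a z \<bullet> Px z)
      + (\<Sum>b\<in>Basis. (b, 0) \<bullet> Da b z) * (h (w z) * \<psi> z)"
    proof -
      have "(\<Sum>b\<in>Basis. F' b z (b, 0)) = (\<Sum>b\<in>Basis. (h' (w z) * \<psi> z) * ((a z \<bullet> b) * (fst (Dw z) \<bullet> b)))
        + (\<Sum>b\<in>Basis. h (w z) * ((a z \<bullet> b) * (Px z \<bullet> b))) + (\<Sum>b\<in>Basis. ((b, 0) \<bullet> Da b z) * (h (w z) * \<psi> z))"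
        unfolding F'_def P_def sum.distrib[symmetric]
        by (rule sum.cong) (auto simp: inner_prod_def algebra_simps inner_commute)
      then show ?thesis
        by (simp only: sum_distrib_left[symmetric] sum_distrib_right[symmetric] euclidean_inner[symmetric])
    qed
    moreover have "T' z (0, 1) = H (w z) * Pt z + h (w z) * snd (Dw z) * \<psi> z"
      by (simp add: T'_def P_def inner_prod_def)
    ultimately show ?thesis by (simp add: algebra_simps)
  qed
  show ?thesis
  proof (cases "integrable lborel (\<lambda>z. indicator D z * ?Q z)")
    case True
    have "(LINT z|lborel. indicator D z * ?Q z)
      \<le> (LINT z|lborel. indicator D z * T' z (0, 1) - (\<Sum>b\<in>Basis. indicator D z * F' b z (b, 0)))"
    proof (rule integral_mono[OF True])
      show "integrable lborel (\<lambda>z. indicator D z * T' z (0, 1) - (\<Sum>b\<in>Basis. indicator D z * F' b z (b, 0)))"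
        by (intro Bochner_Integration.integrable_diff Bochner_Integration.integrable_sum T_int F_int)
      show "indicator D z * ?Q z \<le> indicator D z * T' z (0, 1) - (\<Sum>b\<in>Basis. indicator D z * F' b z (b, 0))" for z
        using le[of z] by (cases "z \<in> D") auto
    qed
    also have "\<dots> = (LINT z|lborel. indicator D z * T' z (0, 1)) - (\<Sum>b\<in>Basis. (LINT z|lborel. indicator D z * F' b z (b, 0)))"
      by (simp only: Bochner_Integration.integral_diff[OF T_int Bochner_Integration.integrable_sum[OF F_int]]
          Bochner_Integration.integral_sum[OF F_int])
    also have "\<dots> \<le> 0" using T_le F_0 by simp
    finally show ?thesis .
  qed (simp add: not_integrable_integral_eq)
qed

section \<open>Localised weak solutions\<close>

text \<open>The weak gradient of a weak solution as an explicit argument, so that all estimates refer to the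
  same representative.\<close>

definition weak_solution_grad ::
  "real \<Rightarrow> real \<Rightarrow> 'a::euclidean_space set \<Rightarrow> ('a \<times> real \<Rightarrow> real) \<Rightarrow> ('a \<Rightarrow> real)
    \<Rightarrow> ('a \<times> real \<Rightarrow> real) \<Rightarrow> ('a \<times> real \<Rightarrow> 'a \<times> real) \<Rightarrow> bool"
  where "weak_solution_grad p q \<Omega> V u0 u G \<longleftrightarrow>
    Lp_loc q V (\<Omega> \<times> {0..}) u \<and>
    (AE z in lebesgue. z \<in> \<Omega> \<times> {0<..} \<longrightarrow> u z \<ge> 0) \<and> W1p_loc p (\<Omega> \<times> {0..}) u G \<and>
      (\<forall>\<phi>. Lip_compact_support (\<Omega> \<times> {0..}) \<phi> \<and> (\<forall>z\<in>\<Omega> \<times> {0..}. \<phi> z \<ge> 0) \<longrightarrow>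
        set_lebesgue_integral lebesgue (\<Omega> \<times> {0..}) (\<lambda>z. V z * u z powr q * \<phi> z)
        \<le> set_lebesgue_integral lebesgue (\<Omega> \<times> {0..})
             (\<lambda>(x, t). norm (fst (G (x, t))) powr (p - 2)
                * (fst (G (x, t)) \<bullet> gradient (\<lambda>y. \<phi> (y, t)) x))
          - set_lebesgue_integral lebesgue (\<Omega> \<times> {0..})
             (\<lambda>(x, t). u (x, t) * deriv (\<lambda>s. \<phi> (x, s)) t)
          - set_lebesgue_integral lebesgue \<Omega> (\<lambda>x. u0 x * \<phi> (x, 0)))"

lemma weak_solution_iff_grad:
  "weak_solution p q \<Omega> V u0 u \<longleftrightarrow> (\<exists>G. weak_solution_grad p q \<Omega> V u0 u G)"
  unfolding weak_solution_def weak_solution_grad_def by blast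

lemma AE_snd_neq_0: "AE z in (lebesgue::('a::euclidean_space \<times> real) measure). snd z \<noteq> 0"
proof -
  have "negligible {z::'a \<times> real. (0, 1) \<bullet> z = 0}" by (rule negligible_hyperplane) (simp add: zero_prod_def)
  moreover have "{z::'a \<times> real. (0, 1) \<bullet> z = 0} = {z. snd z = 0}" by (auto simp: inner_prod_def)
  ultimately have "{z::'a \<times> real. snd z = 0} \<in> null_sets lebesgue" by (simp add: negligible_iff_null_sets)
  from AE_not_in[OF this] show ?thesis by simp
qed

lemma cylinder_borel:
  fixes \<Omega> :: "'a::euclidean_space set"
  assumes "open \<Omega>" shows "\<Omega> \<times> {0::real..} \<in> sets borel"
proof -
  have "\<Omega> \<times> {0::real..} = (\<Omega> \<times> UNIV) \<inter> (UNIV \<times> {0..})" by auto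
  then show ?thesis using open_Times[OF assms open_UNIV] closed_Times[OF closed_UNIV closed_atLeast]
    by (metis borel_closed borel_open sets.Int)
qed

lemma interior_cylinder:
  fixes \<Omega> :: "'a::euclidean_space set"
  assumes "open \<Omega>" shows "interior (\<Omega> \<times> {0::real..}) = \<Omega> \<times> {0<..}"
  using assms by (simp add: interior_Times interior_open)

lemma powr_le_1_plus: "0 \<le> x \<Longrightarrow> 0 \<le> a \<Longrightarrow> a \<le> b \<Longrightarrow> x powr a \<le> 1 + x powr b" for x :: real
proof (cases "x \<le> 1")
  case True
  assume "0 \<le> x" "0 \<le> a"
  then have "x powr a \<le> 1" using True powr_mono2[of a x 1] by simp
  then show ?thesis by (smt (verit) powr_ge_zero)
next
  case False
  assume "a \<le> b"
  then have "x powr a \<le> x powr b" using False by (intro powr_mono) auto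
  then show ?thesis by simp
qed

lemma norm_flux: 
  fixes v :: "'a::euclidean_space"
  assumes "p > 1" shows "norm (norm v powr (p - 2) *\<^sub>R v) = norm v powr (p - 1)"
proof (cases "v = 0")
  case False
  have "norm v powr (p - 2) * norm v powr 1 = norm v powr (p - 1)"
    unfolding powr_add[symmetric] by simp
  then show ?thesis using False by simp
qed (use assms in simp)

lemma inner_flux:
  fixes v :: "'a::euclidean_space"
  assumes "p > 1" shows "(norm v powr (p - 2) *\<^sub>R v) \<bullet> v = norm v powr p"
proof (cases "v = 0")
  case False
  have "norm v powr (p - 2) * norm v powr 2 = norm v powr p"
    unfolding powr_add[symmetric] by simp
  then show ?thesis using False by (simp add: dot_square_norm powr_numeral)
qed (use assms in simp)

text \<open>A weak solution and a compact set \<open>C\<close>. All functions are cut off outside \<open>C\<close>, which makes them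
  integrable on the whole space, so that they can be mollified.\<close>

locale localised_solution =
  fixes p q :: real and \<Omega> :: "'a::euclidean_space set" and V u :: "'a \<times> real \<Rightarrow> real"
    and u0 :: "'a \<Rightarrow> real" and G :: "'a \<times> real \<Rightarrow> 'a \<times> real" and C :: "('a \<times> real) set"
  assumes p: "p > 1" and open_\<Omega>: "open \<Omega>"
    and V_loc: "Lp_loc 1 (\<lambda>_. 1) (\<Omega> \<times> {0..}) V"
    and sol: "weak_solution_grad p q \<Omega> V u0 u G"
    and C: "compact C" "C \<subseteq> \<Omega> \<times> {0..}"
begin

abbreviation S where "S \<equiv> \<Omega> \<times> {0::real..}"

text \<open>The solution, its spatial gradient \<open>g\<close>, the flux \<open>A = |g|\<^sup>p\<^sup>-\<^sup>2 g\<close>, the energy density \<open>N = |g|\<^sup>p\<close> and the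
  source \<open>W = V u\<^sup>q\<close>.\<close>

definition "U z = indicator C z *\<^sub>R u z"
definition "g z = indicator C z *\<^sub>R fst (G z)"
definition "A z = indicator C z *\<^sub>R (norm (fst (G z)) powr (p - 2) *\<^sub>R fst (G z))"
definition "N z = indicator C z *\<^sub>R (norm (fst (G z)) powr p)"
definition "W z = indicator C z *\<^sub>R (V z * u z powr q)"

lemma C_meas: "C \<in> sets lebesgue" using C by (simp add: compact_imp_closed)

lemma S_meas: "S \<in> sets lebesgue" using cylinder_borel[OF open_\<Omega>] by auto

lemma localise_measurable:
  fixes f :: "'a \<times> real \<Rightarrow> 'c::euclidean_space"
  assumes "f \<in> borel_measurable (lebesgue_on S)"
  shows "(\<lambda>z. indicator C z *\<^sub>R f z) \<in> borel_measurable lebesgue"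
proof -
  have "(\<lambda>z. indicator S z *\<^sub>R f z) \<in> borel_measurable lebesgue"
    using assms borel_measurable_restrict_space_iff[of S lebesgue f] S_meas by simp
  then have "(\<lambda>z. indicator C z *\<^sub>R (indicator S z *\<^sub>R f z)) \<in> borel_measurable lebesgue"
    using C_meas by measurable
  moreover have "(\<lambda>z. indicator C z *\<^sub>R (indicator S z *\<^sub>R f z)) = (\<lambda>z. indicator C z *\<^sub>R f z)"
    using C by (auto simp: fun_eq_iff indicator_def)
  ultimately show ?thesis by simp
qed

lemma meas: "u \<in> borel_measurable (lebesgue_on S)" "G \<in> borel_measurable (lebesgue_on S)"
  "V \<in> borel_measurable (lebesgue_on S)"
  using sol V_loc unfolding weak_solution_grad_def W1p_loc_def Lp_loc_def by auto

lemma u_nonneg: "AE z in lebesgue. z \<in> S \<longrightarrow> u z \<ge> 0"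
proof -
  have "AE z in lebesgue. z \<in> \<Omega> \<times> {0<..} \<longrightarrow> u z \<ge> 0"
    using sol unfolding weak_solution_grad_def by blast
  then show ?thesis using AE_snd_neq_0 by eventually_elim force
qed

lemma int_C1: "integrable lebesgue (\<lambda>z. indicator C z *\<^sub>R (1::real))"
  by (rule integrable_compact_continuous[OF C(1)]) auto

lemma int_up: "integrable lebesgue (\<lambda>z. indicator C z *\<^sub>R (norm (u z) powr p))"
  and int_Gp: "integrable lebesgue (\<lambda>z. indicator C z *\<^sub>R (norm (G z) powr p))"
  using sol C unfolding weak_solution_grad_def W1p_loc_def Lp_loc_def set_integrable_def by auto

lemma int_U: "integrable lebesgue U"
  unfolding U_def
proof (rule Bochner_Integration.integrable_bound[OF Bochner_Integration.integrable_add[OF int_C1 int_up]])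
  have "norm (indicator C z *\<^sub>R u z) \<le> norm (indicator C z *\<^sub>R 1 + indicator C z *\<^sub>R norm (u z) powr p)" for z
    using powr_le_1_plus[of "\<bar>u z\<bar>" 1 p] p by (auto simp: indicator_def)
  then show "AE z in lebesgue. norm (indicator C z *\<^sub>R u z) \<le> norm (indicator C z *\<^sub>R 1 + indicator C z *\<^sub>R norm (u z) powr p)"
    by simp
qed (rule localise_measurable[OF meas(1)])

lemma fstG_meas: "(\<lambda>z. fst (G z)) \<in> borel_measurable (lebesgue_on S)"
  using meas(2) by (rule borel_measurable_continuous_on[rotated]) (intro continuous_intros)

lemma fst_le: "norm (fst (G z)) \<le> norm (G z)" using norm_fst_le[of "fst (G z)" "snd (G z)"] by simp

lemma int_N: "integrable lebesgue N"
  unfolding N_def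
proof (rule Bochner_Integration.integrable_bound[OF int_Gp])
  show "(\<lambda>z. indicator C z *\<^sub>R norm (fst (G z)) powr p) \<in> borel_measurable lebesgue"
    by (rule localise_measurable) (use fstG_meas in measurable)
  have "norm (fst (G z)) powr p \<le> norm (G z) powr p" for z
    using fst_le p by (intro powr_mono2) auto
  then show "AE z in lebesgue. norm (indicator C z *\<^sub>R norm (fst (G z)) powr p) \<le> norm (indicator C z *\<^sub>R norm (G z) powr p)"
    by (auto simp: indicator_def)
qed

lemma int_A: "integrable lebesgue A"
  unfolding A_def
proof (rule Bochner_Integration.integrable_bound[OF Bochner_Integration.integrable_add[OF int_C1 int_N[unfolded N_def]]])
  show "(\<lambda>z. indicator C z *\<^sub>R norm (fst (G z)) powr (p - 2) *\<^sub>R fst (G z)) \<in> borel_measurable lebesgue"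
    by (rule localise_measurable) (use fstG_meas in measurable)
  have "norm (indicator C z *\<^sub>R norm (fst (G z)) powr (p - 2) *\<^sub>R fst (G z))
      \<le> norm (indicator C z *\<^sub>R 1 + indicator C z *\<^sub>R norm (fst (G z)) powr p)" for z
    unfolding norm_scaleR[of "indicator C z"] norm_flux[OF p]
    using powr_le_1_plus[of "norm (fst (G z))" "p - 1" p] p by (auto simp: indicator_def)
  then show "AE z in lebesgue. norm (indicator C z *\<^sub>R norm (fst (G z)) powr (p - 2) *\<^sub>R fst (G z))
      \<le> norm (indicator C z *\<^sub>R 1 + indicator C z *\<^sub>R norm (fst (G z)) powr p)" by simp
qed

lemma int_g: "integrable lebesgue g"
  unfolding g_def
proof (rule Bochner_Integration.integrable_bound[OF Bochner_Integration.integrable_add[OF int_C1 int_N[unfolded N_def]]])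
  show "(\<lambda>z. indicator C z *\<^sub>R fst (G z)) \<in> borel_measurable lebesgue"
    by (rule localise_measurable[OF fstG_meas])
  have "norm (indicator C z *\<^sub>R fst (G z)) \<le> norm (indicator C z *\<^sub>R 1 + indicator C z *\<^sub>R norm (fst (G z)) powr p)" for z
    using powr_le_1_plus[of "norm (fst (G z))" 1 p] p by (auto simp: indicator_def)
  then show "AE z in lebesgue. norm (indicator C z *\<^sub>R fst (G z)) \<le> norm (indicator C z *\<^sub>R 1 + indicator C z *\<^sub>R norm (fst (G z)) powr p)" by simp
qed

lemma int_W: "integrable lebesgue W"
proof -
  have i: "integrable lebesgue (\<lambda>z. indicator C z *\<^sub>R (norm (u z) powr q * V z))"
    using sol C unfolding weak_solution_grad_def Lp_loc_def set_integrable_def by auto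
  have "(\<lambda>z. indicator C z *\<^sub>R (V z * u z powr q)) \<in> borel_measurable lebesgue"
    by (rule localise_measurable) (use meas in measurable)
  then show ?thesis unfolding W_def
  proof (subst integrable_cong_AE[OF _ _ _])
    show "AE z in lebesgue. indicator C z *\<^sub>R (V z * u z powr q) = indicator C z *\<^sub>R (norm (u z) powr q * V z)"
      using u_nonneg by eventually_elim (use C in \<open>auto simp: indicator_def\<close>)
  qed (use i in auto)
qed

lemma U_nonneg: "AE z in lebesgue. U z \<ge> 0"
  using u_nonneg by eventually_elim (use C in \<open>auto simp: U_def indicator_def\<close>)

text \<open>As long as the kernel with base point \<open>z\<close> is supported in \<open>C\<close> and at positive times, it is admissible
  both in the weak inequality and in the definition of the weak gradient. It vanishes at \<open>t = 0\<close>, so that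
  no initial term appears.\<close>

lemma mollifier_test:
  assumes r: "r > 0" and sub: "cball (c + z) r \<subseteq> C" and pos: "\<And>y. y \<in> cball (c + z) r \<Longrightarrow> snd y > 0"
  defines "\<rho> \<equiv> mollifier c r"
  shows "mollify \<rho> W z \<le> (LINT y|lebesgue. A y \<bullet> fst (gradient \<rho> (y - z)))
      - (LINT y|lebesgue. U y * snd (gradient \<rho> (y - z)))" (is ?th1)
    and "fst (LINT y|lebesgue. U y *\<^sub>R gradient \<rho> (y - z)) = - mollify \<rho> g z" (is ?th2)
proof -
  define \<phi> where "\<phi> = mollifier (c + z) r"
  have \<phi>: "\<phi> y = \<rho> (y - z)" "gradient \<phi> y = gradient \<rho> (y - z)" for y
    by (simp_all add: \<phi>_def \<rho>_def mollifier_translate[OF r] gradient_mollifier_translate[OF r])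
  have \<phi>0: "y \<in> C \<and> y \<in> S \<and> snd y > 0" if "\<phi> y \<noteq> 0 \<or> gradient \<phi> y \<noteq> 0" for y
  proof -
    have "y \<in> cball (c + z) r"
      using that mollifier_eq_0[OF r, of y "c + z"] gradient_mollifier_eq_0[OF r, of y "c + z"] by (auto simp: \<phi>_def)
    then show ?thesis using sub pos C by blast
  qed
  have der: "(\<phi> has_derivative (\<lambda>v. v \<bullet> gradient \<phi> y)) (at y)" for y
    using GDERIV_mollifier[OF r] by (simp add: \<phi>_def gderiv_def)
  obtain M where M: "M \<ge> 0" "\<And>y. norm (gradient \<phi> y) \<le> M"
    unfolding \<phi>_def by (rule gradient_mollifier_bounded[OF r, of "c + z"]) blast
  have lip: "Lip_compact_support S \<phi>"
    unfolding Lip_compact_support_def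
  proof
    have "M-lipschitz_on S \<phi>"
    proof (rule lipschitz_on_subset[OF _ subset_UNIV], rule bounded_derivative_imp_lipschitz)
      show "onorm (\<lambda>v. v \<bullet> gradient \<phi> y) \<le> M" for y
        using M Cauchy_Schwarz_ineq2[of _ "gradient \<phi> y"]
        by (intro onorm_le) (metis mult.commute mult_left_mono norm_ge_zero order_trans real_norm_def)
    qed (use der M in auto)
    then show "\<exists>L. L-lipschitz_on S \<phi>" by blast
    show "\<exists>K. compact K \<and> K \<subseteq> S \<and> (\<forall>z\<in>S - K. \<phi> z = 0)"
      using C \<phi>0 by blast
  qed
  have nonneg: "\<phi> y \<ge> 0" for y using mollifier_nonneg[OF r] by (simp add: \<phi>_def)
  have gx: "gradient (\<lambda>y. \<phi> (y, t)) x = fst (gradient \<phi> (x, t))" for x t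
  proof (rule gradient_eq)
    show "GDERIV (\<lambda>y. \<phi> (y, t)) x :> fst (gradient \<phi> (x, t))"
      unfolding gderiv_def
      by (rule has_derivative_compose[where g = \<phi> and f = "\<lambda>y. (y, t)", OF _ der, THEN has_derivative_eq_rhs])
        (auto intro!: derivative_eq_intros simp: inner_prod_def)
  qed
  have gt: "deriv (\<lambda>s. \<phi> (x, s)) t = snd (gradient \<phi> (x, t))" for x t
  proof (rule DERIV_imp_deriv)
    have "((\<lambda>s. \<phi> (x, s)) has_derivative (\<lambda>h. h * snd (gradient \<phi> (x, t)))) (at t)"
      by (rule has_derivative_compose[where g = \<phi> and f = "\<lambda>s. (x, s)", OF _ der, THEN has_derivative_eq_rhs])
        (auto intro!: derivative_eq_intros simp: inner_prod_def)
    then show "((\<lambda>s. \<phi> (x, s)) has_real_derivative snd (gradient \<phi> (x, t))) (at t)"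
      unfolding has_field_derivative_def by (elim has_derivative_eq_rhs) (auto simp: fun_eq_iff)
  qed
  have "set_lebesgue_integral lebesgue S (\<lambda>z. V z * u z powr q * \<phi> z)
        \<le> set_lebesgue_integral lebesgue S
             (\<lambda>(x, t). norm (fst (G (x, t))) powr (p - 2)
                * (fst (G (x, t)) \<bullet> gradient (\<lambda>y. \<phi> (y, t)) x))
          - set_lebesgue_integral lebesgue S
             (\<lambda>(x, t). u (x, t) * deriv (\<lambda>s. \<phi> (x, s)) t)
          - set_lebesgue_integral lebesgue \<Omega> (\<lambda>x. u0 x * \<phi> (x, 0))"
    using sol lip nonneg unfolding weak_solution_grad_def by blast
  moreover have "set_lebesgue_integral lebesgue S (\<lambda>z. V z * u z powr q * \<phi> z) = mollify \<rho> W z"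
    unfolding mollify_def set_lebesgue_integral_def \<phi>(1)[symmetric]
  proof (rule Bochner_Integration.integral_cong)
    show "indicator S y *\<^sub>R (V y * u y powr q * \<phi> y) = \<phi> y *\<^sub>R W y" for y
      using \<phi>0[of y] by (cases "\<phi> y = 0") (auto simp: W_def indicator_def)
  qed simp
  moreover have "set_lebesgue_integral lebesgue S
             (\<lambda>(x, t). norm (fst (G (x, t))) powr (p - 2) * (fst (G (x, t)) \<bullet> gradient (\<lambda>y. \<phi> (y, t)) x))
      = (LINT y|lebesgue. A y \<bullet> fst (gradient \<rho> (y - z)))"
    unfolding set_lebesgue_integral_def \<phi>(2)[symmetric]
  proof (rule Bochner_Integration.integral_cong)
    show "indicator S y *\<^sub>R (case y of (x, t) \<Rightarrow> norm (fst (G (x, t))) powr (p - 2) * (fst (G (x, t)) \<bullet> gradient (\<lambda>y. \<phi> (y, t)) x))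
       = A y \<bullet> fst (gradient \<phi> y)" for y
      using \<phi>0[of y] by (cases y; cases "gradient \<phi> y = 0") (auto simp: A_def indicator_def gx)
  qed simp
  moreover have "set_lebesgue_integral lebesgue S (\<lambda>(x, t). u (x, t) * deriv (\<lambda>s. \<phi> (x, s)) t)
      = (LINT y|lebesgue. U y * snd (gradient \<rho> (y - z)))"
    unfolding set_lebesgue_integral_def \<phi>(2)[symmetric]
  proof (rule Bochner_Integration.integral_cong)
    show "indicator S y *\<^sub>R (case y of (x, t) \<Rightarrow> u (x, t) * deriv (\<lambda>s. \<phi> (x, s)) t) = U y * snd (gradient \<phi> y)" for y
      using \<phi>0[of y] by (cases y; cases "gradient \<phi> y = 0") (auto simp: U_def indicator_def gt)
  qed simp
  moreover have "set_lebesgue_integral lebesgue \<Omega> (\<lambda>x. u0 x * \<phi> (x, 0)) = 0"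
  proof -
    have "\<phi> (x, 0) = 0" for x using \<phi>0[of "(x, 0)"] by auto
    then show ?thesis by (simp add: set_lebesgue_integral_def)
  qed
  ultimately show ?th1 by simp
  have "test_function (\<Omega> \<times> {0<..}) \<phi>"
    unfolding \<phi>_def by (rule test_function_mollifier[OF r]) (use sub C pos in fastforce)
  then have wg: "set_lebesgue_integral lebesgue (\<Omega> \<times> {0<..}) (\<lambda>z. u z *\<^sub>R gradient \<phi> z)
        = - set_lebesgue_integral lebesgue (\<Omega> \<times> {0<..}) (\<lambda>z. \<phi> z *\<^sub>R G z)"
    using sol unfolding weak_solution_grad_def W1p_loc_def has_weak_gradient_def interior_cylinder[OF open_\<Omega>] by blast
  have "set_lebesgue_integral lebesgue (\<Omega> \<times> {0<..}) (\<lambda>z. u z *\<^sub>R gradient \<phi> z) = (LINT y|lebesgue. U y *\<^sub>R gradient \<rho> (y - z))"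
    unfolding set_lebesgue_integral_def \<phi>(2)[symmetric]
  proof (rule Bochner_Integration.integral_cong)
    show "indicator (\<Omega> \<times> {0<..}) y *\<^sub>R (u y *\<^sub>R gradient \<phi> y) = U y *\<^sub>R gradient \<phi> y" for y
      using \<phi>0[of y] by (cases y; cases "gradient \<phi> y = 0") (auto simp: U_def indicator_def)
  qed simp
  moreover have "set_lebesgue_integral lebesgue (\<Omega> \<times> {0<..}) (\<lambda>z. \<phi> z *\<^sub>R G z) = mollify \<rho> (\<lambda>z. indicator C z *\<^sub>R G z) z"
    unfolding set_lebesgue_integral_def mollify_def \<phi>(1)[symmetric]
  proof (rule Bochner_Integration.integral_cong)
    show "indicator (\<Omega> \<times> {0<..}) y *\<^sub>R (\<phi> y *\<^sub>R G y) = \<phi> y *\<^sub>R (indicator C y *\<^sub>R G y)" for y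
      using \<phi>0[of y] by (cases y; cases "\<phi> y = 0") (auto simp: indicator_def)
  qed simp
  ultimately have "fst (LINT y|lebesgue. U y *\<^sub>R gradient \<rho> (y - z)) = - fst (mollify \<rho> (\<lambda>z. indicator C z *\<^sub>R G z) z)"
    using wg by (metis fst_uminus)
  moreover have "fst (mollify \<rho> (\<lambda>z. indicator C z *\<^sub>R G z) z) = mollify \<rho> g z"
  proof -
    have "integrable lebesgue (\<lambda>z. indicator C z *\<^sub>R G z)"
    proof (rule Bochner_Integration.integrable_bound[OF Bochner_Integration.integrable_add[OF int_C1 int_Gp]])
      show "(\<lambda>z. indicator C z *\<^sub>R G z) \<in> borel_measurable lebesgue"
        by (rule localise_measurable[OF meas(2)])
      have "norm (indicator C z *\<^sub>R G z) \<le> norm (indicator C z *\<^sub>R 1 + indicator C z *\<^sub>R norm (G z) powr p)" for z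
        using powr_le_1_plus[of "norm (G z)" 1 p] p by (auto simp: indicator_def)
      then show "AE z in lebesgue. norm (indicator C z *\<^sub>R G z) \<le> norm (indicator C z *\<^sub>R 1 + indicator C z *\<^sub>R norm (G z) powr p)" by simp
    qed
    from mollify_bounded_linear[OF r bounded_linear_fst this, of c z]
    show ?thesis by (simp add: \<rho>_def g_def[abs_def])
  qed
  ultimately show ?th2 by simp
qed

end

section \<open>The energy inequality\<close>

lemma integrable_Pair:
  fixes f :: "'a \<Rightarrow> 'b::euclidean_space" and g :: "'a \<Rightarrow> 'c::euclidean_space"
  assumes "integrable M f" "integrable M g"
  shows "integrable M (\<lambda>x. (f x, g x))"
proof -
  have "bounded_linear (\<lambda>x::'b. (x, 0::'c))" "bounded_linear (\<lambda>x::'c. (0::'b, x))"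
    by (intro bounded_linear_Pair bounded_linear_ident bounded_linear_zero)+
  from integrable_bounded_linear[OF this(1) assms(1)] integrable_bounded_linear[OF this(2) assms(2)]
  have "integrable M (\<lambda>x. (f x, 0) + (0, g x))" by (rule Bochner_Integration.integrable_add)
  then show ?thesis by simp
qed

context localised_solution begin

lemma norm_A: "norm (A z) = norm (g z) powr (p - 1)"
  unfolding A_def g_def using norm_flux[OF p, of "fst (G z)"] p by (auto simp: indicator_def)

lemma N_eq: "N z = norm (g z) powr p"
  unfolding N_def g_def using p by (auto simp: indicator_def)

lemma inner_A_g: "A z \<bullet> g z = N z"
  unfolding A_def g_def N_def using inner_flux[OF p, of "fst (G z)"] by (auto simp: indicator_def)

text \<open>Chebyshev's association inequality. With \<open>x = |g (y)|\<close> and \<open>m\<close> its mean against the kernel, the product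
  \<open>(x powr (p - 1) - m powr (p - 1)) * (x - m)\<close> is nonnegative, and its mean is the claim. Because of this
  bound, convergence in the mean of \<open>|g|\<^sup>p\<close> suffices to pass to the limit in the product of flux and
  gradient.\<close>

lemma mollified_flux_le:
  fixes c :: "'a \<times> real"
  assumes r: "r > 0" defines "\<rho> \<equiv> mollifier c r"
  shows "norm (mollify \<rho> A z) * norm (mollify \<rho> g z) \<le> mollify \<rho> N z"
proof -
  let ?x = "\<lambda>y. norm (g y)"
  have i1: "integrable lebesgue ?x" using int_g by auto
  have i2: "integrable lebesgue (\<lambda>y. ?x y powr (p - 1))" using int_A by (auto simp: norm_A[symmetric])
  have i3: "integrable lebesgue (\<lambda>y. ?x y powr p)" using int_N by (simp add: N_eq[abs_def])
  have i0: "integrable lebesgue (\<lambda>y. \<rho> (y - z))"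
    using integrable_mollifier[OF r, of "c + z"]
    by (simp add: \<rho>_def mollifier_translate[OF r] integrable_completion
        borel_measurable_continuous_onI continuous_on_mollifier[OF r])
  have J: "integrable lebesgue (\<lambda>y. \<rho> (y - z) * f y)" if "integrable lebesgue f" for f
    using integrable_mollify[OF r that, of c z] by (simp add: \<rho>_def)
  define m where "m = (LINT y|lebesgue. \<rho> (y - z) * ?x y)"
  have \<rho>0: "\<rho> y \<ge> 0" for y unfolding \<rho>_def by (rule mollifier_nonneg[OF r])
  have m0: "m \<ge> 0" unfolding m_def by (intro Bochner_Integration.integral_nonneg) (simp add: \<rho>0)
  have mg: "norm (mollify \<rho> g z) \<le> m"
    unfolding m_def mollify_def
    by (rule Bochner_Integration.integral_norm_bound_integral)
      (use J[OF i1] integrable_mollify[OF r int_g] in \<open>auto simp: \<rho>_def mollifier_nonneg[OF r]\<close>)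
  have mA: "norm (mollify \<rho> A z) \<le> (LINT y|lebesgue. \<rho> (y - z) * ?x y powr (p - 1))"
    unfolding mollify_def
    by (rule Bochner_Integration.integral_norm_bound_integral)
      (use J[OF i2] integrable_mollify[OF r int_A] in \<open>auto simp: norm_A \<rho>_def mollifier_nonneg[OF r]\<close>)
  have "norm (mollify \<rho> A z) * norm (mollify \<rho> g z) \<le> (LINT y|lebesgue. \<rho> (y - z) * ?x y powr (p - 1)) * m"
    by (intro mult_mono mA mg) (auto intro!: Bochner_Integration.integral_nonneg simp: \<rho>0)
  also have "\<dots> = (LINT y|lebesgue. m * (\<rho> (y - z) * ?x y powr (p - 1)) + m powr (p - 1) * (\<rho> (y - z) * ?x y) - m powr p * \<rho> (y - z))"
  proof -
    have "m powr (p - 1) * m = m powr p"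
      using m0 p by (cases "m = 0") (auto simp: powr_diff)
    moreover have "(LINT y|lebesgue. \<rho> (y - z)) = 1"
      unfolding \<rho>_def by (rule integral_mollifier_shift[OF r])
    ultimately show ?thesis using J[OF i2] J[OF i1] i0 by (simp add: m_def[symmetric] mult.commute)
  qed
  also have "\<dots> \<le> (LINT y|lebesgue. \<rho> (y - z) * ?x y powr p)"
  proof (rule integral_mono)
    fix y
    have "(?x y powr (p - 1) - m powr (p - 1)) * (?x y - m) \<ge> 0"
    proof (cases "?x y \<ge> m")
      case True
      then show ?thesis using m0 p powr_mono2[of "p - 1" m "?x y"] by (intro mult_nonneg_nonneg) auto
    next
      case False
      then show ?thesis using p powr_mono2[of "p - 1" "?x y" m] by (intro mult_nonpos_nonpos) auto
    qed
    moreover have "m powr (p - 1) * m = m powr p" "?x y powr (p - 1) * ?x y = ?x y powr p"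
      using m0 p by (cases "m = 0"; auto simp: powr_diff)+
    ultimately have "m * ?x y powr (p - 1) + m powr (p - 1) * ?x y - m powr p \<le> ?x y powr p"
      by (simp add: algebra_simps)
    then have "\<rho> (y - z) * (m * ?x y powr (p - 1) + m powr (p - 1) * ?x y - m powr p) \<le> \<rho> (y - z) * ?x y powr p"
      by (intro mult_left_mono \<rho>0)
    then show "m * (\<rho> (y - z) * ?x y powr (p - 1)) + m powr (p - 1) * (\<rho> (y - z) * ?x y) - m powr p * \<rho> (y - z)
      \<le> \<rho> (y - z) * ?x y powr p" by (simp add: algebra_simps)
  qed (use J[OF i2] J[OF i1] J[OF i3] i0 in auto)
  finally show ?thesis by (simp add: mollify_def N_eq)
qed

text \<open>The smooth inequality holds for the mollified functions at every point of \<open>K\<close>. Along a subsequence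
  they converge almost everywhere with an integrable bound, and the inequality passes to the limit.\<close>

lemma energy_inequality_local:
  fixes \<psi> Pt :: "'a \<times> real \<Rightarrow> real" and h h' H :: "real \<Rightarrow> real"
  defines "D \<equiv> {z::'a \<times> real. snd z > 0}"
  assumes K: "compact K" "\<And>z. z \<in> K \<Longrightarrow> snd z \<ge> 0" and "\<rho>0 > 0"
    and near: "\<And>z y. z \<in> K \<Longrightarrow> dist z y \<le> \<rho>0 \<Longrightarrow> snd y \<ge> 0 \<Longrightarrow> y \<in> C"
    and h: "\<And>x. x \<ge> 0 \<Longrightarrow> (h has_real_derivative h' x) (at x)" "\<And>x. x \<ge> 0 \<Longrightarrow> (H has_real_derivative h x) (at x)"
      "\<And>x. x \<ge> 0 \<Longrightarrow> 0 \<le> h x \<and> h x \<le> Mh" "\<And>x. x \<ge> 0 \<Longrightarrow> \<bar>h' x\<bar> \<le> Mh"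
      "\<And>x. x \<ge> 0 \<Longrightarrow> 0 \<le> H x \<and> H x \<le> Mh * x" "continuous_on {0..} h'"
    and \<psi>: "\<And>z. z \<in> D \<Longrightarrow> (\<psi> has_derivative (\<lambda>v. Px z \<bullet> fst v + Pt z * snd v)) (at z)"
      "\<And>z. z \<in> D \<Longrightarrow> 0 \<le> \<psi> z \<and> \<psi> z \<le> M" "\<And>z. z \<in> D \<Longrightarrow> norm (Px z) \<le> M"
      "\<And>z. z \<in> D \<Longrightarrow> \<bar>Pt z\<bar> \<le> M"
      "\<And>z. z \<in> D \<Longrightarrow> z \<notin> K \<Longrightarrow> \<psi> z = 0 \<and> Px z = 0 \<and> Pt z = 0"
    and Px_meas: "(\<lambda>z. indicator D z *\<^sub>R Px z) \<in> borel_measurable borel"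
    and Pt_meas: "(\<lambda>z. indicator D z *\<^sub>R Pt z) \<in> borel_measurable borel"
  defines "Q z \<equiv> W z * h (U z) * \<psi> z - (h' (U z) * \<psi> z * N z + h (U z) * (A z \<bullet> Px z)) + H (U z) * Pt z"
  shows "integrable lebesgue (\<lambda>z. indicator (K \<inter> D) z * Q z)"
    and "(LINT z|lebesgue. indicator (K \<inter> D) z * Q z) \<le> 0"
proof -
  have D: "open D" unfolding D_def by (intro open_Collect_less continuous_intros)
  have Mh: "Mh \<ge> 0" using h(3)[of 0] by force
  \<comment> \<open>The kernels are centred above their base points: lifting the centre by \<open>2 r k\<close> in time makes
    them vanish at times \<open>\<le> 0\<close>, for base points on the bottom \<open>t = 0\<close> as well.\<close>
  define r where "r k = \<rho>0 / (3 * real (Suc k))" for k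
  define c :: "nat \<Rightarrow> 'a \<times> real" where "c k = (0, 2 * r k)" for k
  have r: "r k > 0" for k using \<open>\<rho>0 > 0\<close> by (simp add: r_def)
  have r3e: "3 * r k = \<rho>0 / real (Suc k)" for k by (simp add: r_def field_simps)
  have r3: "3 * r k \<le> \<rho>0" for k
  proof -
    have "3 * r k = \<rho>0 / real (Suc k)" by (rule r3e)
    also have "\<dots> \<le> \<rho>0 / 1" using \<open>\<rho>0 > 0\<close> by (intro divide_left_mono) auto
    finally show ?thesis by simp
  qed
  have norm_c: "norm (c k) = 2 * r k" for k using r[of k] real_sqrt_abs[of "2 * r k"] by (simp add: c_def norm_Pair)
  have r_lim: "(\<lambda>k. norm (c k) + r k) \<longlonglongrightarrow> 0"
  proof -
    have "(\<lambda>k. \<rho>0 * (1 / real (Suc k))) \<longlonglongrightarrow> \<rho>0 * 0"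
      using LIMSEQ_inverse_real_of_nat by (intro tendsto_mult tendsto_const) (simp add: inverse_eq_divide)
    moreover have "norm (c k) + r k = \<rho>0 * (1 / real (Suc k))" for k
      using r3e[of k] by (simp add: norm_c)
    ultimately show ?thesis by simp
  qed
  define \<rho> where "\<rho> k = mollifier (c k) (r k)" for k
  have sub: "y \<in> C \<and> snd y > 0" if "z \<in> K" "y \<in> cball (c k + z) (r k)" for y z k
  proof -
    have d: "norm (y - z - c k) \<le> r k" using that(2) by (simp add: dist_norm norm_minus_commute algebra_simps)
    have "norm (y - z) \<le> norm (y - z - c k) + norm (c k)"
      using norm_triangle_ineq[of "y - z - c k" "c k"] by simp
    then have 1: "dist z y \<le> \<rho>0" using d r3[of k] norm_c[of k] by (simp add: dist_norm norm_minus_commute)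
    have "\<bar>snd (y - z - c k)\<bar> \<le> norm (y - z - c k)"
      by (metis norm_snd_le prod.collapse real_norm_def)
    then have "snd y > 0" using d K(2)[OF that(1)] r[of k] by (auto simp: c_def)
    then show ?thesis using near[OF that(1) 1] by simp
  qed
  \<comment> \<open>All localised functions are collected in one vector-valued function, so that one subsequence
    and one dominating function serve for all of them.\<close>
  define F where "F z = (U z, g z, A z, N z, W z)" for z
  have F: "integrable lebesgue F"
    unfolding F_def[abs_def] using int_U int_g int_A int_N int_W
    by (intro integrable_Pair) auto
  have Fm: "mollify (\<rho> k) F z = (mollify (\<rho> k) U z, mollify (\<rho> k) g z, mollify (\<rho> k) A z, mollify (\<rho> k) N z, mollify (\<rho> k) W z)" for k z
  proof -
    note ml = mollify_bounded_linear[OF r _ F, of _ "c k" k z, folded \<rho>_def]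
    show ?thesis
      using ml[of fst] ml[of "\<lambda>x. fst (snd x)"] ml[of "\<lambda>x. fst (snd (snd x))"]
        ml[of "\<lambda>x. fst (snd (snd (snd x)))"] ml[of "\<lambda>x. snd (snd (snd (snd x)))"]
      by (simp add: F_def prod_eq_iff bounded_linear_fst bounded_linear_fst_comp bounded_linear_snd_comp
          bounded_linear_snd)
  qed
  define Qf where "Qf z = (\<lambda>(uu, gg::'a, aa::'a, nn::real, ww). ww * h uu * \<psi> z
      - (h' uu * \<psi> z * (aa \<bullet> gg) + h uu * (aa \<bullet> Px z)) + H uu * Pt z)" for z
  define Qk where "Qk k z = indicator (K \<inter> D) z * Qf z (mollify (\<rho> k) F z)" for k z
  have Upos: "mollify (\<rho> k) U z \<ge> 0" for k z unfolding \<rho>_def by (rule mollify_nonneg[OF r U_nonneg])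
  have int_Ab: "integrable lebesgue (\<lambda>z. A z \<bullet> b)" for b using int_A by auto
  have conts: "continuous_on UNIV (mollify (\<rho> k) U)" "continuous_on UNIV (mollify (\<rho> k) g)"
    "continuous_on UNIV (mollify (\<rho> k) A)" "continuous_on UNIV (mollify (\<rho> k) N)" "continuous_on UNIV (mollify (\<rho> k) W)" for k
    unfolding \<rho>_def by (intro continuous_on_mollify r int_U int_g int_A int_N int_W)+
  have ch: "continuous_on {0..} h" "continuous_on {0..} H"
    using h(1,2) by (meson DERIV_isCont atLeast_iff continuous_at_imp_continuous_on)+
  have Qk_meas: "Qk k \<in> borel_measurable borel" for k
  proof -
    have c\<psi>: "continuous_on D \<psi>"
      using \<psi>(1) by (meson continuous_at_imp_continuous_on has_derivative_continuous)
    have "continuous_on UNIV (\<lambda>z. h (mollify (\<rho> k) U z))" "continuous_on UNIV (\<lambda>z. h' (mollify (\<rho> k) U z))"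
      "continuous_on UNIV (\<lambda>z. H (mollify (\<rho> k) U z))"
      using Upos by (auto intro!: continuous_on_compose2[OF ch(1) conts(1)] continuous_on_compose2[OF ch(2) conts(1)]
          continuous_on_compose2[OF h(6) conts(1)])
    then have [measurable]: "(\<lambda>z. h (mollify (\<rho> k) U z)) \<in> borel_measurable borel"
      "(\<lambda>z. h' (mollify (\<rho> k) U z)) \<in> borel_measurable borel" "(\<lambda>z. H (mollify (\<rho> k) U z)) \<in> borel_measurable borel"
      by (auto intro: borel_measurable_continuous_onI)
    have [measurable]: "mollify (\<rho> k) g \<in> borel_measurable borel" "mollify (\<rho> k) A \<in> borel_measurable borel"
      "mollify (\<rho> k) W \<in> borel_measurable borel"
      using conts by (auto intro: borel_measurable_continuous_onI)
    have [measurable]: "K \<in> sets borel" using K by (simp add: compact_imp_closed)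
    have [measurable]: "(\<lambda>z. indicator D z * \<psi> z) \<in> borel_measurable borel"
      using borel_measurable_continuous_on_indicator[OF _ c\<psi>] D by simp
    note [measurable] = Px_meas Pt_meas
    have "(\<lambda>z. indicator K z * (mollify (\<rho> k) W z * h (mollify (\<rho> k) U z) * (indicator D z * \<psi> z)
      - (h' (mollify (\<rho> k) U z) * (indicator D z * \<psi> z) * (mollify (\<rho> k) A z \<bullet> mollify (\<rho> k) g z)
        + h (mollify (\<rho> k) U z) * (mollify (\<rho> k) A z \<bullet> (indicator D z *\<^sub>R Px z)))
      + H (mollify (\<rho> k) U z) * (indicator D z *\<^sub>R Pt z))) \<in> borel_measurable borel" (is "?f \<in> _")
      by measurable
    moreover have "?f = Qk k"
      by (auto simp: fun_eq_iff Qk_def Qf_def Fm indicator_def)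
    ultimately show ?thesis by simp
  qed
  have Qk_le: "(LINT z|lebesgue. Qk k z) \<le> 0" for k
  proof -
    define Dw where "Dw z = - (LINT y|lebesgue. U y *\<^sub>R gradient (\<rho> k) (y - z))" for z
    define Da where "Da b z = - (LINT y|lebesgue. (A y \<bullet> b) *\<^sub>R gradient (\<rho> k) (y - z))" for b z
    obtain B1 where B1: "B1 \<ge> 0" "\<And>z. \<bar>mollify (\<rho> k) U z\<bar> \<le> B1" "\<And>z. norm (Dw z) \<le> B1"
      unfolding Dw_def \<rho>_def norm_minus_cancel by (rule mollify_bounded[OF r int_U, of "c k" k]) blast
    have Ab: "mollify (\<rho> k) (\<lambda>z. A z \<bullet> b) z = mollify (\<rho> k) A z \<bullet> b" for b z
      unfolding \<rho>_def by (rule mollify_bounded_linear[OF r bounded_linear_inner_left int_A])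
    have "\<exists>B\<ge>0. \<forall>z. \<bar>mollify (\<rho> k) A z \<bullet> b\<bar> \<le> B \<and> norm (Da b z) \<le> B" for b
    proof (rule mollify_bounded[OF r int_Ab, of "c k" k b])
      fix B assume B: "B \<ge> 0" "\<And>z. \<bar>mollify (mollifier (c k) (r k)) (\<lambda>z. A z \<bullet> b) z\<bar> \<le> B"
        "\<And>z. norm (LINT y|lebesgue. (A y \<bullet> b) *\<^sub>R gradient (mollifier (c k) (r k)) (y - z)) \<le> B"
      have "\<bar>mollify (\<rho> k) A z \<bullet> b\<bar> \<le> B \<and> norm (Da b z) \<le> B" for z
        using B(2,3)[of z] Ab[of b z] by (simp add: Da_def \<rho>_def)
      then show ?thesis using B(1) by blast
    qed
    then have "\<forall>b. \<exists>B. B \<ge> 0 \<and> (\<forall>z. \<bar>mollify (\<rho> k) A z \<bullet> b\<bar> \<le> B \<and> norm (Da b z) \<le> B)" by blast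
    from choice[OF this] obtain B2 where
      B2: "\<And>b. B2 b \<ge> 0" "\<And>b z. \<bar>mollify (\<rho> k) A z \<bullet> b\<bar> \<le> B2 b" "\<And>b z. norm (Da b z) \<le> B2 b"
      by blast
    define B where "B = B1 + (\<Sum>b\<in>(Basis::'a set). B2 b)"
    have B: "B1 \<le> B" "\<And>b. b \<in> (Basis::'a set) \<Longrightarrow> B2 b \<le> B"
    proof -
      have "B2 b \<le> (\<Sum>b\<in>(Basis::'a set). B2 b)" if "b \<in> Basis" for b
        using B2(1) that by (intro member_le_sum) auto
      then show "\<And>b. b \<in> (Basis::'a set) \<Longrightarrow> B2 b \<le> B" using B1(1) by (force simp: B_def)
      show "B1 \<le> B" using B2(1) by (simp add: B_def sum_nonneg)
    qed
    have fst_Dw: "fst (Dw z) = mollify (\<rho> k) g z" if "z \<in> K" for z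
      using mollifier_test(2)[OF r, of "c k" z k] sub[OF that] by (force simp: Dw_def \<rho>_def)
    have weak: "mollify (\<rho> k) W z \<le> - (\<Sum>b\<in>Basis. (b, 0) \<bullet> Da b z) + snd (Dw z)" if "z \<in> K" for z
    proof -
      have iG: "integrable lebesgue (\<lambda>y. f y *\<^sub>R gradient (\<rho> k) (y - z))" if "integrable lebesgue f" for f
        unfolding \<rho>_def by (rule integrable_mollify_gradient[OF r that])
      have i1: "integrable lebesgue (\<lambda>y. (A y \<bullet> b) * (fst (gradient (\<rho> k) (y - z)) \<bullet> b))" for b
        using integrable_inner_right[of "(b, 0)" lebesgue, OF iG[OF int_Ab[of b]]]
        by (simp add: inner_prod_def inner_commute)
      have "mollify (\<rho> k) W z \<le> (LINT y|lebesgue. A y \<bullet> fst (gradient (\<rho> k) (y - z)))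
          - (LINT y|lebesgue. U y * snd (gradient (\<rho> k) (y - z)))"
        unfolding \<rho>_def using sub[OF that, of _ k] by (intro mollifier_test(1)[OF r]) blast+
      also have "(LINT y|lebesgue. A y \<bullet> fst (gradient (\<rho> k) (y - z)))
        = (LINT y|lebesgue. (\<Sum>b\<in>Basis. (A y \<bullet> b) * (fst (gradient (\<rho> k) (y - z)) \<bullet> b)))"
        by (simp only: euclidean_inner[symmetric])
      also have "\<dots> = (\<Sum>b\<in>Basis. (LINT y|lebesgue. (A y \<bullet> b) * (fst (gradient (\<rho> k) (y - z)) \<bullet> b)))"
        by (rule Bochner_Integration.integral_sum) (rule i1)
      also have "\<dots> = (\<Sum>b\<in>Basis. - ((b, 0) \<bullet> Da b z))"
      proof (rule sum.cong[OF refl])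
        fix b :: 'a
        have "(b, 0) \<bullet> (LINT y|lebesgue. (A y \<bullet> b) *\<^sub>R gradient (\<rho> k) (y - z))
          = (LINT y|lebesgue. (b, 0) \<bullet> ((A y \<bullet> b) *\<^sub>R gradient (\<rho> k) (y - z)))"
          by (rule integral_inner_right[symmetric]) (rule iG[OF int_Ab])
        then show "(LINT y|lebesgue. (A y \<bullet> b) * (fst (gradient (\<rho> k) (y - z)) \<bullet> b)) = - ((b, 0) \<bullet> Da b z)"
          by (simp add: Da_def inner_prod_def inner_commute)
      qed
      also have "(LINT y|lebesgue. U y * snd (gradient (\<rho> k) (y - z))) = - snd (Dw z)"
        using integral_bounded_linear[OF bounded_linear_snd iG[OF int_U]] by (simp add: Dw_def)
      finally show ?thesis by (simp add: sum_negf)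
    qed
    have "(LINT z|lborel. indicator D z * (mollify (\<rho> k) W z * h (mollify (\<rho> k) U z) * \<psi> z
      - (h' (mollify (\<rho> k) U z) * \<psi> z * (mollify (\<rho> k) A z \<bullet> fst (Dw z)) + h (mollify (\<rho> k) U z) * (mollify (\<rho> k) A z \<bullet> Px z))
      + H (mollify (\<rho> k) U z) * Pt z)) \<le> 0"
      unfolding D_def
    proof (rule smooth_energy_inequality[where Da = Da and B = B and K = K and M = M and Mh = Mh])
      show "(mollify (\<rho> k) U has_derivative (\<lambda>v. v \<bullet> Dw z)) (at z)" for z
        using mollify_has_derivative[OF r int_U, of "c k" k z] by (simp add: Dw_def \<rho>_def)
      show "norm (Dw z) \<le> B" "mollify (\<rho> k) U z \<le> B" for z using B1(2,3)[of z] B(1) by linarith+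
      show "((\<lambda>z. mollify (\<rho> k) A z \<bullet> b) has_derivative (\<lambda>v. v \<bullet> Da b z)) (at z)" if "b \<in> Basis" for b z
        unfolding Ab[symmetric] using mollify_has_derivative[OF r int_Ab, of "c k" k b z] by (simp add: Da_def \<rho>_def)
      show "norm (Da b z) \<le> B" "\<bar>mollify (\<rho> k) A z \<bullet> b\<bar> \<le> B" if "b \<in> Basis" for b z
        using B2(2,3) B(2)[OF that] order_trans by blast+
      show "bounded K" using K(1) by (rule compact_imp_bounded)
    qed (use \<psi> h Upos weak in \<open>simp_all add: D_def\<close>)
    also have "(LINT z|lborel. indicator D z * (mollify (\<rho> k) W z * h (mollify (\<rho> k) U z) * \<psi> z
      - (h' (mollify (\<rho> k) U z) * \<psi> z * (mollify (\<rho> k) A z \<bullet> fst (Dw z)) + h (mollify (\<rho> k) U z) * (mollify (\<rho> k) A z \<bullet> Px z))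
      + H (mollify (\<rho> k) U z) * Pt z)) = (LINT z|lborel. Qk k z)"
    proof (rule Bochner_Integration.integral_cong[OF refl])
      fix z
      show "indicator D z * (mollify (\<rho> k) W z * h (mollify (\<rho> k) U z) * \<psi> z
      - (h' (mollify (\<rho> k) U z) * \<psi> z * (mollify (\<rho> k) A z \<bullet> fst (Dw z)) + h (mollify (\<rho> k) U z) * (mollify (\<rho> k) A z \<bullet> Px z))
      + H (mollify (\<rho> k) U z) * Pt z) = Qk k z"
        using \<psi>(5)[of z] fst_Dw[of z] by (cases "z \<in> D"; cases "z \<in> K") (auto simp: Qk_def Qf_def Fm)
    qed
    also have "\<dots> = (LINT z|lebesgue. Qk k z)"
      using Qk_meas by (intro integral_completion[symmetric]) simp
    finally show ?thesis .
  qed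
  have fi: "integrable lebesgue (\<lambda>z. indicator K z *\<^sub>R mollify (\<rho> k) F z)" for k
    unfolding \<rho>_def by (intro integrable_compact_continuous[OF K(1)] continuous_on_mollify[OF r F])
  have gi: "integrable lebesgue (\<lambda>z. indicator K z *\<^sub>R F z)"
    using F K(1) by (auto intro!: integrable_mult_indicator simp: compact_imp_closed)
  have "(\<lambda>k. LINT z|lebesgue. norm (indicator K z *\<^sub>R mollify (\<rho> k) F z - indicator K z *\<^sub>R F z)) \<longlonglongrightarrow> 0"
    using mollify_tendsto_L1[OF F K(1) r r_lim] unfolding scaleR_diff_right[symmetric] \<rho>_def .
  from L1_convergent_dominated_subseq[OF fi gi this]
  obtain \<sigma> Dm where \<sigma>: "strict_mono (\<sigma>::nat \<Rightarrow> nat)" "integrable lebesgue Dm"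
    "AE z in lebesgue. (\<lambda>k. indicator K z *\<^sub>R mollify (\<rho> (\<sigma> k)) F z) \<longlonglongrightarrow> indicator K z *\<^sub>R F z"
    "AE z in lebesgue. \<forall>k. norm (indicator K z *\<^sub>R mollify (\<rho> (\<sigma> k)) F z) \<le> Dm z" by blast
  have lim: "AE z in lebesgue. (\<lambda>k. Qk (\<sigma> k) z) \<longlonglongrightarrow> indicator (K \<inter> D) z * Q z"
    using \<sigma>(3) U_nonneg
  proof eventually_elim
    case (elim z)
    show ?case
    proof (cases "z \<in> K \<inter> D")
      case True
      then have l: "(\<lambda>k. mollify (\<rho> (\<sigma> k)) F z) \<longlonglongrightarrow> F z" using elim(1) by simp
      have l1: "(\<lambda>k. mollify (\<rho> (\<sigma> k)) U z) \<longlonglongrightarrow> U z" using tendsto_fst[OF l] by (simp add: Fm F_def)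
      have l2: "(\<lambda>k. mollify (\<rho> (\<sigma> k)) g z) \<longlonglongrightarrow> g z" using tendsto_fst[OF tendsto_snd[OF l]] by (simp add: Fm F_def)
      have l3: "(\<lambda>k. mollify (\<rho> (\<sigma> k)) A z) \<longlonglongrightarrow> A z" using tendsto_fst[OF tendsto_snd[OF tendsto_snd[OF l]]] by (simp add: Fm F_def)
      have l4: "(\<lambda>k. mollify (\<rho> (\<sigma> k)) W z) \<longlonglongrightarrow> W z" using tendsto_snd[OF tendsto_snd[OF tendsto_snd[OF tendsto_snd[OF l]]]] by (simp add: Fm F_def)
      have lh: "(\<lambda>k. f (mollify (\<rho> (\<sigma> k)) U z)) \<longlonglongrightarrow> f (U z)" if "continuous_on {0..} f" for f :: "real \<Rightarrow> real"
        by (rule continuous_on_tendsto_compose[OF that l1]) (use elim(2) Upos in auto)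
      have "(\<lambda>k. Qf z (mollify (\<rho> (\<sigma> k)) F z)) \<longlonglongrightarrow> W z * h (U z) * \<psi> z
        - (h' (U z) * \<psi> z * (A z \<bullet> g z) + h (U z) * (A z \<bullet> Px z)) + H (U z) * Pt z"
        unfolding Qf_def Fm prod.case
        by (intro tendsto_intros l2 l3 l4 lh ch h(6))
      then show ?thesis using True by (simp add: Qk_def Q_def inner_A_g)
    qed (simp add: Qk_def)
  qed
  have dom: "AE z in lebesgue. norm (Qk (\<sigma> k) z) \<le> 4 * Mh * \<bar>M\<bar> * Dm z" for k
    using \<sigma>(4)
  proof eventually_elim
    case (elim z)
    show ?case
    proof (cases "z \<in> K \<inter> D")
      case True
      then have zD: "z \<in> D" by simp
      have M: "0 \<le> M" using \<psi>(2)[OF zD] by linarith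
      let ?n = "norm (mollify (\<rho> (\<sigma> k)) F z)"
      define uu gg aa nn ww where "uu = mollify (\<rho> (\<sigma> k)) U z" and "gg = mollify (\<rho> (\<sigma> k)) g z" and
        "aa = mollify (\<rho> (\<sigma> k)) A z" and "nn = mollify (\<rho> (\<sigma> k)) N z" and "ww = mollify (\<rho> (\<sigma> k)) W z"
      note comp = uu_def gg_def aa_def nn_def ww_def
      have n: "?n = norm (uu, gg, aa, nn, ww)" by (simp add: Fm comp)
      have 1: "\<bar>uu\<bar> \<le> ?n" unfolding n using norm_fst_le[of uu] by simp
      have s1: "norm (gg, aa, nn, ww) \<le> ?n" unfolding n by (rule norm_snd_le)
      have s2: "norm (aa, nn, ww) \<le> ?n" using order_trans[OF norm_snd_le s1] .
      have 2: "norm aa \<le> ?n" using order_trans[OF norm_fst_le s2] .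
      have s3: "norm (nn, ww) \<le> ?n" using order_trans[OF norm_snd_le s2] .
      have 3: "\<bar>nn\<bar> \<le> ?n" "\<bar>ww\<bar> \<le> ?n" using order_trans[OF norm_fst_le s3] order_trans[OF norm_snd_le s3] by simp_all
      have 4: "\<bar>aa \<bullet> gg\<bar> \<le> ?n"
        using Cauchy_Schwarz_ineq2[of aa gg] mollified_flux_le[OF r, of "c (\<sigma> k)" "\<sigma> k" z] 3(1)
        by (simp add: comp \<rho>_def)
      have u0: "uu \<ge> 0" using Upos by (simp add: comp)
      have n0: "?n \<ge> 0" by simp
      have t1: "\<bar>ww * h uu * \<psi> z\<bar> \<le> ?n * Mh * M"
        unfolding abs_mult using 3(2) h(3)[OF u0] \<psi>(2)[OF zD] Mh M n0 by (intro mult_mono) auto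
      have t2: "\<bar>h' uu * \<psi> z * (aa \<bullet> gg)\<bar> \<le> Mh * M * ?n"
        unfolding abs_mult using 4 h(4)[OF u0] \<psi>(2)[OF zD] Mh M n0 by (intro mult_mono) auto
      have "\<bar>aa \<bullet> Px z\<bar> \<le> ?n * M"
        using Cauchy_Schwarz_ineq2[of aa "Px z"] mult_mono[OF 2 \<psi>(3)[OF zD] n0 norm_ge_zero] by linarith
      then have t3: "\<bar>h uu * (aa \<bullet> Px z)\<bar> \<le> Mh * (?n * M)"
        unfolding abs_mult[of "h uu"] using h(3)[OF u0] Mh by (intro mult_mono) auto
      have "\<bar>H uu\<bar> \<le> Mh * ?n"
        using h(5)[OF u0] mult_left_mono[OF 1 Mh] u0 by auto
      then have t4: "\<bar>H uu * Pt z\<bar> \<le> Mh * ?n * M"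
        unfolding abs_mult using \<psi>(4)[OF zD] Mh M n0 by (intro mult_mono) auto
      have "Qk (\<sigma> k) z = ww * h uu * \<psi> z - (h' uu * \<psi> z * (aa \<bullet> gg) + h uu * (aa \<bullet> Px z)) + H uu * Pt z"
        using True by (simp add: Qk_def Qf_def Fm comp)
      then have "\<bar>Qk (\<sigma> k) z\<bar> \<le> 4 * Mh * M * ?n"
        using t1 t2 t3 t4 by (simp add: mult_ac)
      also have "\<dots> \<le> 4 * Mh * M * Dm z"
        using elim[rule_format, of k] True Mh M by (intro mult_left_mono) auto
      finally show ?thesis using M by simp
    next
      case False
      have "0 \<le> Dm z" using elim[rule_format, of k] norm_ge_zero order_trans by blast
      then show ?thesis using False Mh by (auto simp: Qk_def)
    qed
  qed
  have Qk_meas': "Qk k \<in> borel_measurable lebesgue" for k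
    using Qk_meas by (intro measurable_completion) simp
  have meas: "(\<lambda>z. indicator (K \<inter> D) z * Q z) \<in> borel_measurable lebesgue"
  proof (rule borel_measurable_AE)
    show "(\<lambda>z. lim (\<lambda>k. Qk (\<sigma> k) z)) \<in> borel_measurable lebesgue"
      by (rule borel_measurable_lim_metric) (rule Qk_meas')
    show "AE z in lebesgue. lim (\<lambda>k. Qk (\<sigma> k) z) = indicator (K \<inter> D) z * Q z"
      using lim by eventually_elim (rule limI)
  qed
  have di: "integrable lebesgue (\<lambda>z. 4 * Mh * \<bar>M\<bar> * Dm z)" using \<sigma>(2) by simp
  show "integrable lebesgue (\<lambda>z. indicator (K \<inter> D) z * Q z)"
    by (rule integrable_dominated_convergence[OF meas Qk_meas' di lim dom])
  have "(\<lambda>k. LINT z|lebesgue. Qk (\<sigma> k) z) \<longlonglongrightarrow> (LINT z|lebesgue. indicator (K \<inter> D) z * Q z)"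
    by (rule integral_dominated_convergence[OF meas Qk_meas' di lim dom])
  then show "(LINT z|lebesgue. indicator (K \<inter> D) z * Q z) \<le> 0"
    by (rule LIMSEQ_le_const2) (use Qk_le in auto)
qed

end

text \<open>The weak inequality tested with \<open>h (u) \<psi>\<close>. Because \<open>h (u) \<partial>\<^sub>t u = \<partial>\<^sub>t H (u)\<close>, the time derivative can be moved to the
  cutoff; the uniform bounds on \<open>h\<close> and \<open>h'\<close> let each term of the mollified inequality pass to the limit.\<close>

lemma energy_inequality:
  fixes \<Omega> :: "'a::euclidean_space set" and \<psi> Pt :: "'a \<times> real \<Rightarrow> real" and h h' H :: "real \<Rightarrow> real"
  defines "D \<equiv> {z::'a \<times> real. snd z > 0}"
  assumes p: "p > 1" and \<Omega>: "open \<Omega>" and V: "Lp_loc 1 (\<lambda>_. 1) (\<Omega> \<times> {0..}) V"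
    and sol: "weak_solution_grad p q \<Omega> V u0 u G"
    and K: "compact K" "K \<subseteq> \<Omega> \<times> {0..}"
    and h: "\<And>x. x \<ge> 0 \<Longrightarrow> (h has_real_derivative h' x) (at x)" "\<And>x. x \<ge> 0 \<Longrightarrow> (H has_real_derivative h x) (at x)"
      "\<And>x. x \<ge> 0 \<Longrightarrow> 0 \<le> h x \<and> h x \<le> Mh" "\<And>x. x \<ge> 0 \<Longrightarrow> \<bar>h' x\<bar> \<le> Mh"
      "\<And>x. x \<ge> 0 \<Longrightarrow> 0 \<le> H x \<and> H x \<le> Mh * x" "continuous_on {0..} h'"
    and \<psi>: "\<And>z. z \<in> D \<Longrightarrow> (\<psi> has_derivative (\<lambda>v. Px z \<bullet> fst v + Pt z * snd v)) (at z)"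
      "\<And>z. z \<in> D \<Longrightarrow> 0 \<le> \<psi> z \<and> \<psi> z \<le> M" "\<And>z. z \<in> D \<Longrightarrow> norm (Px z) \<le> M"
      "\<And>z. z \<in> D \<Longrightarrow> \<bar>Pt z\<bar> \<le> M"
      "\<And>z. z \<in> D \<Longrightarrow> z \<notin> K \<Longrightarrow> \<psi> z = 0 \<and> Px z = 0 \<and> Pt z = 0"
    and Pmeas: "(\<lambda>z. indicator D z *\<^sub>R Px z) \<in> borel_measurable borel"
      "(\<lambda>z. indicator D z *\<^sub>R Pt z) \<in> borel_measurable borel"
  defines "Q z \<equiv> V z * u z powr q * h (u z) * \<psi> z
    - (h' (u z) * \<psi> z * norm (fst (G z)) powr p
      + h (u z) * (norm (fst (G z)) powr (p - 2) * (fst (G z) \<bullet> Px z))) + H (u z) * Pt z"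
  shows "integrable lebesgue (\<lambda>z. indicator (K \<inter> D) z * Q z)"
    and "(LINT z|lebesgue. indicator (K \<inter> D) z * Q z) \<le> 0"
proof -
  have "compact (fst ` K)" "fst ` K \<subseteq> \<Omega>"
    using K by (auto intro!: compact_continuous_image continuous_intros)
  then obtain \<rho> where \<rho>: "\<rho> > 0" "(\<Union>x\<in>fst ` K. cball x \<rho>) \<subseteq> \<Omega>"
    using compact_subset_open_imp_cball_epsilon_subset[OF _ \<Omega>] by metis
  \<comment> \<open>A compact neighbourhood of \<open>K\<close> relative to the closed upper half-space: the kernels with base point
    in \<open>K\<close> live there.\<close>
  define C where "C = {x + y | x y. x \<in> K \<and> y \<in> cball 0 \<rho>} \<inter> {z::'a \<times> real. snd z \<ge> 0}"
  have C: "compact C" unfolding C_def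
    by (intro compact_Int_closed compact_sums K compact_cball closed_Collect_le continuous_intros)
  have "C \<subseteq> \<Omega> \<times> {0..}"
  proof
    fix z assume "z \<in> C"
    then obtain x y where xy: "z = x + y" "x \<in> K" "norm y \<le> \<rho>" "snd z \<ge> 0" by (auto simp: C_def)
    have "norm (fst y) \<le> norm y" by (metis norm_fst_le prod.collapse)
    then have "fst z \<in> cball (fst x) \<rho>" using xy by (auto simp: dist_norm)
    then have "fst z \<in> \<Omega>" using \<rho>(2) xy(2) by blast
    then show "z \<in> \<Omega> \<times> {0..}" using xy(4) by (cases z) auto
  qed
  then interpret localised_solution p q \<Omega> V u u0 G C
    using p \<Omega> V sol C by unfold_locales
  have near: "y \<in> C" if "z \<in> K" "dist z y \<le> \<rho>" "snd y \<ge> 0" for z y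
  proof -
    have "y = z + (y - z)" "y - z \<in> cball 0 \<rho>" using that by (auto simp: dist_norm norm_minus_commute)
    then show ?thesis unfolding C_def using that by blast
  qed
  have KC: "z \<in> C" if "z \<in> K" for z using near[OF that, of z] K that \<rho>(1) by force
  note E = energy_inequality_local[OF K(1) _ \<rho>(1) near, where h = h and h' = h' and H = H and \<psi> = \<psi>
      and Px = Px and Pt = Pt and M = M and Mh = Mh, folded D_def]
  have eq: "indicator (K \<inter> D) z * (W z * h (U z) * \<psi> z - (h' (U z) * \<psi> z * N z + h (U z) * (A z \<bullet> Px z)) + H (U z) * Pt z)
    = indicator (K \<inter> D) z * Q z" for z
    using KC[of z] by (auto simp: indicator_def W_def U_def N_def A_def Q_def)
  have "integrable lebesgue (\<lambda>z. indicator (K \<inter> D) z *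
      (W z * h (U z) * \<psi> z - (h' (U z) * \<psi> z * N z + h (U z) * (A z \<bullet> Px z)) + H (U z) * Pt z))"
    by (rule E(1)) (use K h \<psi> Pmeas in auto)
  moreover have "(LINT z|lebesgue. indicator (K \<inter> D) z *
      (W z * h (U z) * \<psi> z - (h' (U z) * \<psi> z * N z + h (U z) * (A z \<bullet> Px z)) + H (U z) * Pt z)) \<le> 0"
    by (rule E(2)) (use K h \<psi> Pmeas in auto)
  ultimately show "integrable lebesgue (\<lambda>z. indicator (K \<inter> D) z * Q z)"
    and "(LINT z|lebesgue. indicator (K \<inter> D) z * Q z) \<le> 0"
    unfolding eq by simp_all
qed

section \<open>The test function and Young's inequality\<close>

text \<open>The function of \<open>u\<close> in the test function. Its constant part yields the mass of \<open>V u\<^sup>q\<close>; the derivative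
  of the negative power yields the energy term \<open>\<beta> \<gamma> |\<nabla>u|\<^sup>p (u + \<eta>)\<^sup>-\<^sup>\<gamma>\<^sup>-\<^sup>1\<close> with the favourable sign. The
  shift \<open>\<eta>\<close> keeps both bounded at \<open>u = 0\<close>.\<close>

context
  fixes \<beta> \<gamma> \<eta> :: real
  assumes \<beta>: "0 \<le> \<beta>" and \<gamma>: "0 < \<gamma>" "\<gamma> \<le> 1 / 2" and \<eta>: "0 < \<eta>"
begin

definition "damping x = 1 + \<beta> * (x + \<eta>) powr (- \<gamma>)"
definition "damping' x = - (\<beta> * \<gamma> * (x + \<eta>) powr (- \<gamma> - 1))"
definition "damping_primitive x = x + \<beta> * ((x + \<eta>) powr (1 - \<gamma>) - \<eta> powr (1 - \<gamma>)) / (1 - \<gamma>)"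
definition "damping_bound = 1 + \<beta> * \<eta> powr (- \<gamma>) + \<beta> * \<gamma> * \<eta> powr (- \<gamma> - 1)"

lemma damping_deriv: "x \<ge> 0 \<Longrightarrow> (damping has_real_derivative damping' x) (at x)"
  unfolding damping_def[abs_def] damping'_def using \<eta>
  by (auto intro!: derivative_eq_intros simp: powr_diff field_simps)

lemma damping_primitive_deriv: "x \<ge> 0 \<Longrightarrow> (damping_primitive has_real_derivative damping x) (at x)"
proof -
  assume x: "x \<ge> 0"
  have "((\<lambda>x. (x + \<eta>) powr (1 - \<gamma>)) has_real_derivative (1 - \<gamma>) * (x + \<eta>) powr (- \<gamma>)) (at x)"
    using DERIV_fun_powr[of "\<lambda>x. x + \<eta>" 1 x "1 - \<gamma>"] x \<eta> by (auto intro!: derivative_eq_intros)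
  then have "((\<lambda>x. x + \<beta> / (1 - \<gamma>) * ((x + \<eta>) powr (1 - \<gamma>) - \<eta> powr (1 - \<gamma>))) has_real_derivative
    1 + \<beta> / (1 - \<gamma>) * ((1 - \<gamma>) * (x + \<eta>) powr (- \<gamma>) - 0)) (at x)"
    by (intro DERIV_add DERIV_ident DERIV_cmult DERIV_diff DERIV_const)
  then show ?thesis using \<gamma> by (simp add: damping_primitive_def[abs_def] damping_def)
qed

lemma powr_shift_le: "x \<ge> 0 \<Longrightarrow> a \<le> 0 \<Longrightarrow> (x + \<eta>) powr a \<le> \<eta> powr a"
  using \<eta> by (intro powr_mono2') auto

lemma damping_bounds: "x \<ge> 0 \<Longrightarrow> 1 \<le> damping x \<and> damping x \<le> damping_bound"
  using powr_shift_le[of x "-\<gamma>"] \<beta> \<gamma> mult_left_mono[of "(x + \<eta>) powr - \<gamma>" "\<eta> powr - \<gamma>" \<beta>]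
  by (auto simp: damping_def damping_bound_def intro: add_increasing2)

lemma damping'_bound: "x \<ge> 0 \<Longrightarrow> \<bar>damping' x\<bar> \<le> damping_bound"
proof -
  assume x: "x \<ge> 0"
  have "\<beta> * \<gamma> * (x + \<eta>) powr (- \<gamma> - 1) \<le> \<beta> * \<gamma> * \<eta> powr (- \<gamma> - 1)"
    using powr_shift_le[OF x, of "-\<gamma> - 1"] \<beta> \<gamma> by (intro mult_left_mono) auto
  moreover have "0 \<le> \<beta> * \<eta> powr (- \<gamma>)" "0 \<le> \<beta> * \<gamma> * (x + \<eta>) powr (- \<gamma> - 1)" using \<beta> \<gamma> by auto
  ultimately show ?thesis unfolding damping'_def damping_bound_def by linarith
qed

lemma damping_primitive_bounds: assumes "x \<ge> 0" shows "0 \<le> damping_primitive x" "damping_primitive x \<le> damping_bound * x"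
  "damping_primitive x \<le> x + 2 * \<beta> * (x + \<eta>) powr (1 - \<gamma>)"
proof -
  have "0 \<le> damping_primitive x \<and> damping_primitive x \<le> damping_bound * x"
  proof (cases "x = 0")
    case False
    then have "x > 0" using assms by simp
    then obtain y where "0 < y" "y < x" "damping_primitive x - damping_primitive 0 = (x - 0) * damping y"
      using MVT2[of 0 x damping_primitive damping] damping_primitive_deriv by auto
    then show ?thesis using damping_bounds[of y] \<open>x > 0\<close> by (auto simp: damping_primitive_def[of 0])
  qed (simp add: damping_primitive_def)
  then show "0 \<le> damping_primitive x" "damping_primitive x \<le> damping_bound * x" by auto
  have "((x + \<eta>) powr (1 - \<gamma>) - \<eta> powr (1 - \<gamma>)) / (1 - \<gamma>) \<le> (x + \<eta>) powr (1 - \<gamma>) / (1 - \<gamma>)"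
    using \<gamma> by (intro divide_right_mono) auto
  also have "\<dots> \<le> (x + \<eta>) powr (1 - \<gamma>) / (1 / 2)"
    using \<gamma> by (intro divide_left_mono) auto
  finally have "\<beta> * (((x + \<eta>) powr (1 - \<gamma>) - \<eta> powr (1 - \<gamma>)) / (1 - \<gamma>)) \<le> \<beta> * (2 * (x + \<eta>) powr (1 - \<gamma>))"
    using \<beta> by (intro mult_left_mono) auto
  then show "damping_primitive x \<le> x + 2 * \<beta> * (x + \<eta>) powr (1 - \<gamma>)" by (simp add: damping_primitive_def)
qed

lemma continuous_damping': "continuous_on {0..} damping'"
  unfolding damping'_def[abs_def] using \<eta> by (intro continuous_intros) auto

end

text \<open>Either the first term on the right dominates, or \<open>x powr (n - m) \<le> c / v\<close>, and then the second one
  does.\<close>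

lemma young_powr:
  fixes c v x m n :: real
  assumes "c \<ge> 0" "v > 0" "x \<ge> 0" "0 < m" "m < n"
  shows "c * x powr m \<le> v * x powr n + c powr (n / (n - m)) * v powr (1 - n / (n - m))"
proof (cases "c * x powr m \<le> v * x powr n")
  case True
  then show ?thesis by (smt (verit) mult_nonneg_nonneg powr_ge_zero)
next
  case False
  have "x \<noteq> 0"
  proof
    assume "x = 0" then show False using False by simp
  qed
  moreover have "c \<noteq> 0"
  proof
    assume "c = 0" then show False using False assms by simp
  qed
  ultimately
  have x: "x > 0" and c: "c > 0" using assms by auto
  have "v * x powr (n - m) < c"
  proof -
    have "v * x powr (n - m) * x powr m < c * x powr m"
      using False x by (simp add: powr_diff)
    then show ?thesis using x by simp
  qed
  then have "x powr (n - m) \<le> c / v" using assms by (simp add: field_simps)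
  then have "(x powr (n - m)) powr (m / (n - m)) \<le> (c / v) powr (m / (n - m))"
    using assms by (intro powr_mono2) auto
  then have "x powr m \<le> (c / v) powr (m / (n - m))" using assms by (simp add: powr_powr)
  then have "c * x powr m \<le> c * (c / v) powr (m / (n - m))" using c by simp
  also have "\<dots> = c powr (n / (n - m)) * v powr (1 - n / (n - m))"
  proof -
    have e: "n / (n - m) = 1 + m / (n - m)" "1 - n / (n - m) = - (m / (n - m))"
      using assms by (simp_all add: field_simps)
    show ?thesis unfolding e using c assms
      by (simp add: powr_add powr_divide powr_minus_divide)
  qed
  also have "\<dots> \<le> v * x powr n + \<dots>" using assms by simp
  finally show ?thesis .
qed


text \<open>Young's inequality for \<open>\<phi> powr (s / n) * x\<close>: a high power of the cutoff on the right leaves room for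
  the power of the cutoff that differentiation has removed on the left.\<close>

lemma young_powr_cutoff:
  fixes c v x m n \<phi> s j :: real
  assumes "c \<ge> 0" "v > 0" "x \<ge> 0" "0 < m" "m < n" "0 < \<phi>" "\<phi> \<le> 1" "s * m / n \<le> j"
  shows "c * \<phi> powr j * x powr m \<le> v * \<phi> powr s * x powr n + c powr (n / (n - m)) * v powr (1 - n / (n - m))"
proof -
  have "\<phi> powr j * x powr m \<le> \<phi> powr (s * m / n) * x powr m"
    using assms by (intro mult_right_mono powr_mono') auto
  also have "\<dots> = (\<phi> powr (s / n) * x) powr m"
    using assms by (simp add: powr_mult powr_powr)
  finally have "c * (\<phi> powr j * x powr m) \<le> c * (\<phi> powr (s / n) * x) powr m"
    using assms by (intro mult_left_mono) auto
  also have "\<dots> \<le> v * (\<phi> powr (s / n) * x) powr n + c powr (n / (n - m)) * v powr (1 - n / (n - m))"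
    using assms by (intro young_powr) auto
  also have "(\<phi> powr (s / n) * x) powr n = \<phi> powr s * x powr n"
    using assms by (simp add: powr_mult powr_powr)
  finally show ?thesis by (simp add: mult.assoc)
qed

text \<open>The pointwise core of the argument, for \<open>x = u\<close>, \<open>g = |\<nabla>u|\<close>, \<open>v = V\<close>. The flux is first absorbed into the
  energy term \<open>l \<gamma> y\<^sup>-\<^sup>\<gamma>\<^sup>-\<^sup>1 g\<^sup>p\<close>, where \<open>y = x + \<eta>\<close>; this leaves powers of \<open>y\<close>. The terms that come from the
  negative power of the test function carry a factor \<open>l\<close> and are absorbed into \<open>l v x\<^sup>q y\<^sup>-\<^sup>\<gamma>\<close>; those that
  come from its constant part are absorbed up to \<open>2 \<mu> v x\<^sup>q\<close>. What remains are products of powers of \<open>v\<close> and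
  of the derivatives of the cutoff, where \<open>Z\<close> stands for \<open>|\<nabla>\<phi>|\<^sup>p \<gamma>\<^sup>1\<^sup>-\<^sup>p\<close> and \<open>B\<close> for \<open>|\<partial>\<^sub>t \<phi>|\<close> up to constants,
  with total exponent one, and an error that vanishes with \<open>\<eta>\<close>.\<close>

lemma energy_absorption_pointwise:
  fixes p q \<gamma> l \<mu> \<eta> v x g \<phi> s Pn Tn Hn Z B e1 e2 e3 e4 m :: real
  assumes p: "p > 1" and q: "q > p - 1" "q > 1"
    and \<gamma>: "0 < \<gamma>" "\<gamma> \<le> 1" "\<gamma> < p - 1" "\<gamma> < 1" 
    and m_def: "m = (1 + \<gamma>) * (p - 1)" and mq: "m < q"
    and s: "s * m / q \<le> s - p" "s / q \<le> s - 1" and s0: "s \<ge> p" 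
    and l: "0 < l" "l \<le> 1" and \<mu>: "0 < \<mu>" and \<eta>: "0 < \<eta>"
    and v: "v > 0" and x: "x \<ge> 0" and g: "g \<ge> 0" and \<phi>: "0 < \<phi>" "\<phi> \<le> 1"
    and Pn: "0 \<le> Pn" "Pn powr p * (2 / \<gamma>) powr (p - 1) \<le> Z * \<phi> powr (p * (s - 1))"
    and Tn: "0 \<le> Tn" "Tn \<le> B * \<phi> powr (s - 1)"
    and Hn: "Hn \<le> x + 2 * l * (x + \<eta>) powr (1 - \<gamma>)"
    and e: "e1 = (q - \<gamma>) / (q - p + 1)" "e2 = q / (q - m)" "e3 = (q - \<gamma>) / (q - 1)" "e4 = q / (q - 1)"
  shows "(1 + l * (x + \<eta>) powr (- \<gamma>)) * (g powr (p - 1) * Pn) + Hn * Tn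
      - l * v * x powr q * (x + \<eta>) powr (- \<gamma>) * \<phi> powr s
      - l * \<gamma> * (x + \<eta>) powr (- \<gamma> - 1) * g powr p * \<phi> powr s
    \<le> 2 * \<mu> * v * \<phi> powr s * x powr q
      + l * ((2 powr (p - 1) * Z) powr e1 * (v / 4) powr (1 - e1))
      + (l powr (1 - p) * 4 powr (p - 1) * Z) powr e2 * (\<mu> * v) powr (1 - e2)
      + l * ((4 * B) powr e3 * (v / 4) powr (1 - e3))
      + B powr e4 * (\<mu> * v) powr (1 - e4)
      + (Z * (l * (2 * \<eta>) powr (p - 1 - \<gamma>) + l powr (1 - p) * (2 * \<eta>) powr m)
         + B * (\<eta> + 2 * l * (2 * \<eta>) powr (1 - \<gamma>)))"
proof -
  define y where "y = x + \<eta>"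
  have y: "y > 0" "x \<le> y" using x \<eta> by (auto simp: y_def)
  have fin: "0 < \<phi> powr a" for a using \<phi> by simp
  have Z: "Z \<ge> 0"
  proof -
    have "0 \<le> Z * \<phi> powr (p * (s - 1))" using Pn(2) by (smt (verit) mult_nonneg_nonneg powr_ge_zero)
    then show ?thesis using fin[of "p * (s - 1)"] by (simp add: zero_le_mult_iff)
  qed
  have B: "B \<ge> 0"
  proof -
    have "0 \<le> B * \<phi> powr (s - 1)" using Tn by linarith
    then show ?thesis using fin[of "s - 1"] by (simp add: zero_le_mult_iff)
  qed
  define k where "k = l * \<gamma> * y powr (- \<gamma> - 1) / 2"
  have k: "k > 0" using l \<gamma> y by (simp add: k_def)
  \<comment> \<open>Young's inequality in \<open>g\<close>: the flux is paid for with half of the gradient term. The two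
    summands of the test function correspond to \<open>c = 1\<close> and \<open>c = l y powr (- \<gamma>)\<close>.\<close>
  have grad: "c * (g powr (p - 1) * Pn) \<le> k * g powr p * \<phi> powr s + c powr p * (l * y powr (- \<gamma> - 1)) powr (1 - p) * (Z * \<phi> powr (s - p))"
    if "c \<ge> 0" for c
  proof -
    have "(c * Pn) * g powr (p - 1) \<le> (k * \<phi> powr s) * g powr p + (c * Pn) powr (p / (p - (p - 1))) * (k * \<phi> powr s) powr (1 - p / (p - (p - 1)))"
      using that Pn k fin g p by (intro young_powr) auto
    also have "(c * Pn) powr (p / (p - (p - 1))) * (k * \<phi> powr s) powr (1 - p / (p - (p - 1)))
      = c powr p * (l * y powr (- \<gamma> - 1)) powr (1 - p) * ((Pn powr p * (2 / \<gamma>) powr (p - 1)) * \<phi> powr (s * (1 - p)))"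
    proof -
      have "k powr (1 - p) = (l * y powr (- \<gamma> - 1)) powr (1 - p) * (2 / \<gamma>) powr (p - 1)"
      proof -
        have "k = (l * y powr (- \<gamma> - 1)) * (2 / \<gamma>) powr (- 1)"
          using \<gamma> by (simp add: k_def powr_minus field_simps)
        then have "k powr (1 - p) = (l * y powr (- \<gamma> - 1)) powr (1 - p) * ((2 / \<gamma>) powr (- 1)) powr (1 - p)"
          using l \<gamma> by (simp only: powr_mult)
        also have "((2 / \<gamma>) powr (- 1)) powr (1 - p) = (2 / \<gamma>) powr (p - 1)"
          by (simp only: powr_powr) simp
        finally show ?thesis .
      qed
      then show ?thesis using that Pn k by (simp add: powr_mult powr_powr mult_ac)
    qed
    also have "\<dots> \<le> c powr p * (l * y powr (- \<gamma> - 1)) powr (1 - p) * ((Z * \<phi> powr (p * (s - 1))) * \<phi> powr (s * (1 - p)))"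
      using Pn(2) by (intro mult_left_mono mult_right_mono) auto
    also have "(Z * \<phi> powr (p * (s - 1))) * \<phi> powr (s * (1 - p)) = Z * \<phi> powr (s - p)"
      unfolding mult.assoc powr_add[symmetric] by (simp add: algebra_simps)
    finally show ?thesis by (simp add: mult_ac)
  qed
  have g1: "1 * (g powr (p - 1) * Pn) \<le> k * g powr p * \<phi> powr s + l powr (1 - p) * y powr m * (Z * \<phi> powr (s - p))"
  proof -
    have "(l * y powr (- \<gamma> - 1)) powr (1 - p) = l powr (1 - p) * y powr m"
      using l y by (simp add: powr_mult powr_powr m_def algebra_simps)
    then show ?thesis using grad[of 1] by simp
  qed
  have g2: "(l * y powr (- \<gamma>)) * (g powr (p - 1) * Pn) \<le> k * g powr p * \<phi> powr s + l * y powr (p - 1 - \<gamma>) * (Z * \<phi> powr (s - p))"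
  proof -
    have "(l * y powr (- \<gamma>)) powr p * (l * y powr (- \<gamma> - 1)) powr (1 - p)
      = (l powr p * l powr (1 - p)) * (y powr (- \<gamma> * p) * y powr ((- \<gamma> - 1) * (1 - p)))"
      using l y by (simp add: powr_mult powr_powr mult_ac)
    also have "\<dots> = l * y powr (p - 1 - \<gamma>)"
      unfolding powr_add[symmetric] using l by (simp add: algebra_simps)
    finally show ?thesis using grad[of "l * y powr (- \<gamma>)"] l by simp
  qed
  have hT: "Hn * Tn \<le> (x + 2 * l * y powr (1 - \<gamma>)) * (B * \<phi> powr (s - 1))"
  proof -
    have "Hn * Tn \<le> (x + 2 * l * y powr (1 - \<gamma>)) * Tn" using Hn Tn by (intro mult_right_mono) (auto simp: y_def)
    also have "\<dots> \<le> (x + 2 * l * y powr (1 - \<gamma>)) * (B * \<phi> powr (s - 1))"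
      using Tn x l by (intro mult_left_mono) auto
    finally show ?thesis .
  qed
  have two_k: "2 * (k * g powr p * \<phi> powr s) = l * \<gamma> * y powr (- \<gamma> - 1) * g powr p * \<phi> powr s"
    by (simp add: k_def)
  define R where "R = l powr (1 - p) * y powr m * (Z * \<phi> powr (s - p)) + l * y powr (p - 1 - \<gamma>) * (Z * \<phi> powr (s - p))
    + (x + 2 * l * y powr (1 - \<gamma>)) * (B * \<phi> powr (s - 1)) - l * v * x powr q * y powr (- \<gamma>) * \<phi> powr s"
  have LHS: "(1 + l * y powr (- \<gamma>)) * (g powr (p - 1) * Pn) + Hn * Tn - l * v * x powr q * y powr (- \<gamma>) * \<phi> powr s
      - l * \<gamma> * y powr (- \<gamma> - 1) * g powr p * \<phi> powr s \<le> R"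
  proof -
    have "(1 + l * y powr (- \<gamma>)) * (g powr (p - 1) * Pn) = 1 * (g powr (p - 1) * Pn) + (l * y powr (- \<gamma>)) * (g powr (p - 1) * Pn)"
      by (rule distrib_right)
    then show ?thesis unfolding R_def using g1 g2 hT two_k by linarith
  qed
  define E where "E = Z * (l * (2 * \<eta>) powr (p - 1 - \<gamma>) + l powr (1 - p) * (2 * \<eta>) powr m) + B * (\<eta> + 2 * l * (2 * \<eta>) powr (1 - \<gamma>))"
  define T1 where "T1 = (2 powr (p - 1) * Z) powr e1 * (v / 4) powr (1 - e1)"
  define T2 where "T2 = (l powr (1 - p) * 4 powr (p - 1) * Z) powr e2 * (\<mu> * v) powr (1 - e2)"
  define T3 where "T3 = (4 * B) powr e3 * (v / 4) powr (1 - e3)"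
  define T4 where "T4 = B powr e4 * (\<mu> * v) powr (1 - e4)"
  have Tpos: "T1 \<ge> 0" "T2 \<ge> 0" "T3 \<ge> 0" "T4 \<ge> 0" by (simp_all add: T1_def T2_def T3_def T4_def)
  have Epos: "E \<ge> 0" using Z B l \<eta> by (simp add: E_def)
  have m0: "0 < m" using p \<gamma> by (simp add: m_def)
  have m1: "p - 1 < m" using p \<gamma> by (simp add: m_def)
  have "R \<le> 2 * \<mu> * v * \<phi> powr s * x powr q + l * T1 + T2 + l * T3 + T4 + E"
  \<comment> \<open>Where \<open>x \<ge> \<eta>\<close>, the quantities \<open>x\<close> and \<open>y\<close> are comparable and Young's inequality applies;
    elsewhere \<open>y\<close> is small and everything goes into the error term \<open>E\<close>.\<close>
  proof (cases "x < \<eta>")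
    case True
    then have y2: "y \<le> 2 * \<eta>" by (simp add: y_def)
    have \<phi>1: "\<phi> powr (s - p) \<le> 1" "\<phi> powr (s - 1) \<le> 1" using \<phi> s0 p by (auto intro!: powr_le1)
    have Z1: "0 \<le> Z * \<phi> powr (s - p)" "Z * \<phi> powr (s - p) \<le> Z" "0 \<le> B * \<phi> powr (s - 1)" "B * \<phi> powr (s - 1) \<le> B"
      using Z B \<phi>1 by (auto intro: mult_left_le)
    have "l powr (1 - p) * y powr m * (Z * \<phi> powr (s - p)) \<le> l powr (1 - p) * (2 * \<eta>) powr m * Z"
      using y y2 m0 Z1 by (intro mult_mono mult_left_mono powr_mono2) auto
    moreover have "l * y powr (p - 1 - \<gamma>) * (Z * \<phi> powr (s - p)) \<le> l * (2 * \<eta>) powr (p - 1 - \<gamma>) * Z"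
      using y y2 \<gamma> Z1 l by (intro mult_mono powr_mono2) auto
    moreover have "(x + 2 * l * y powr (1 - \<gamma>)) * (B * \<phi> powr (s - 1)) \<le> (\<eta> + 2 * l * (2 * \<eta>) powr (1 - \<gamma>)) * B"
      using True y y2 \<gamma> Z1 l \<eta> by (intro mult_mono add_mono powr_mono2) auto
    moreover have "0 \<le> l * v * x powr q * y powr (- \<gamma>) * \<phi> powr s" using l v by simp
    ultimately have "R \<le> E" unfolding R_def E_def by (simp add: algebra_simps)
    moreover have "0 \<le> 2 * \<mu> * v * \<phi> powr s * x powr q" using \<mu> v by simp
    moreover have "0 \<le> l * T1" "0 \<le> l * T3" using l Tpos by auto
    ultimately show ?thesis using Tpos by linarith
  next
    case False
    then have xp: "x > 0" and y2: "y \<le> 2 * x" using \<eta> by (auto simp: y_def)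
    have b1: "y powr (p - 1 - \<gamma>) \<le> 2 powr (p - 1) * x powr (p - 1 - \<gamma>)"
    proof -
      have "y powr (p - 1 - \<gamma>) \<le> (2 * x) powr (p - 1 - \<gamma>)" using y y2 \<gamma> by (intro powr_mono2) auto
      also have "\<dots> = 2 powr (p - 1 - \<gamma>) * x powr (p - 1 - \<gamma>)" using xp by (simp add: powr_mult)
      also have "\<dots> \<le> 2 powr (p - 1) * x powr (p - 1 - \<gamma>)" using \<gamma> by (intro mult_right_mono powr_mono) auto
      finally show ?thesis .
    qed
    have b2: "y powr m \<le> 4 powr (p - 1) * x powr m"
    proof -
      have "y powr m \<le> (2 * x) powr m" using y y2 m0 by (intro powr_mono2) auto
      also have "\<dots> = 2 powr m * x powr m" using xp by (simp add: powr_mult)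
      also have "\<dots> \<le> 2 powr (2 * (p - 1)) * x powr m"
        unfolding m_def using \<gamma> p by (intro mult_right_mono powr_mono) auto
      also have "2 powr (2 * (p - 1)) = (4::real) powr (p - 1)"
        using powr_powr[of 2 2 "p - 1"] by simp
      finally show ?thesis .
    qed
    have b3: "y powr (1 - \<gamma>) \<le> 2 * x powr (1 - \<gamma>)"
    proof -
      have "y powr (1 - \<gamma>) \<le> (2 * x) powr (1 - \<gamma>)" using y y2 \<gamma> by (intro powr_mono2) auto
      also have "\<dots> = 2 powr (1 - \<gamma>) * x powr (1 - \<gamma>)" using xp by (simp add: powr_mult)
      also have "\<dots> \<le> 2 powr 1 * x powr (1 - \<gamma>)" using \<gamma> by (intro mult_right_mono powr_mono) auto
      finally show ?thesis by simp
    qed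
    have b4: "x powr (q - \<gamma>) / 2 \<le> x powr q * y powr (- \<gamma>)"
    proof -
      have "(2 * x) powr (- \<gamma>) \<le> y powr (- \<gamma>)" using y y2 \<gamma> by (intro powr_mono2') auto
      moreover have "x powr (- \<gamma>) / 2 \<le> (2 * x) powr (- \<gamma>)"
      proof -
        have "(2::real) powr (- 1) \<le> 2 powr (- \<gamma>)" using \<gamma> by (intro powr_mono) auto
        then have "2 powr (- 1) * x powr (- \<gamma>) \<le> 2 powr (- \<gamma>) * x powr (- \<gamma>)" by (intro mult_right_mono) auto
        then show ?thesis using xp by (simp add: powr_mult powr_minus field_simps)
      qed
      ultimately have "x powr q * (x powr (- \<gamma>) / 2) \<le> x powr q * y powr (- \<gamma>)"
        by (intro mult_left_mono) auto
      then show ?thesis using xp by (simp add: powr_diff powr_minus field_simps)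
    qed
    have sq: "s * (p - 1 - \<gamma>) / (q - \<gamma>) \<le> s - p" "s * (1 - \<gamma>) / (q - \<gamma>) \<le> s - 1"
    proof -
      have s00: "0 \<le> s" using s0 p by linarith
      have "(p - 1 - \<gamma>) / (q - \<gamma>) \<le> m / q"
      proof -
        have "(p - 1 - \<gamma>) / (q - \<gamma>) \<le> (p - 1) / q"
          using \<gamma> q p mult_left_mono[of p "1 + q" \<gamma>] by (simp add: divide_simps algebra_simps)
        also have "\<dots> \<le> m / q" using m1 q by (intro divide_right_mono) auto
        finally show ?thesis .
      qed
      from mult_left_mono[OF this s00] show "s * (p - 1 - \<gamma>) / (q - \<gamma>) \<le> s - p" using s(1) by simp
      have "(1 - \<gamma>) / (q - \<gamma>) \<le> 1 / q"
        using \<gamma> q p mult_left_mono[of 1 q \<gamma>] by (simp add: divide_simps algebra_simps)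
      from mult_left_mono[OF this s00] show "s * (1 - \<gamma>) / (q - \<gamma>) \<le> s - 1" using s(2) by simp
    qed
    have t1: "l * y powr (p - 1 - \<gamma>) * (Z * \<phi> powr (s - p)) \<le> l * ((v / 4) * \<phi> powr s * x powr (q - \<gamma>) + T1)"
    proof -
      have "y powr (p - 1 - \<gamma>) * (Z * \<phi> powr (s - p)) \<le> (2 powr (p - 1) * x powr (p - 1 - \<gamma>)) * (Z * \<phi> powr (s - p))"
        using b1 Z by (intro mult_right_mono) auto
      also have "\<dots> = (2 powr (p - 1) * Z) * \<phi> powr (s - p) * x powr (p - 1 - \<gamma>)" by simp
      also have "\<dots> \<le> (v / 4) * \<phi> powr s * x powr (q - \<gamma>) + (2 powr (p - 1) * Z) powr ((q - \<gamma>) / ((q - \<gamma>) - (p - 1 - \<gamma>)))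
          * (v / 4) powr (1 - (q - \<gamma>) / ((q - \<gamma>) - (p - 1 - \<gamma>)))"
        using Z v x \<gamma> q \<phi> sq by (intro young_powr_cutoff) auto
      also have "(q - \<gamma>) - (p - 1 - \<gamma>) = q - p + 1" by simp
      finally have "y powr (p - 1 - \<gamma>) * (Z * \<phi> powr (s - p)) \<le> (v / 4) * \<phi> powr s * x powr (q - \<gamma>) + T1"
        by (simp add: T1_def e)
      from mult_left_mono[OF this, of l] show ?thesis using l by (simp add: mult_ac)
    qed
    have t3: "2 * l * y powr (1 - \<gamma>) * (B * \<phi> powr (s - 1)) \<le> l * ((v / 4) * \<phi> powr s * x powr (q - \<gamma>) + T3)"
    proof -
      have "2 * y powr (1 - \<gamma>) * (B * \<phi> powr (s - 1)) \<le> 2 * (2 * x powr (1 - \<gamma>)) * (B * \<phi> powr (s - 1))"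
        using b3 B by (intro mult_right_mono mult_left_mono) auto
      also have "\<dots> = (4 * B) * \<phi> powr (s - 1) * x powr (1 - \<gamma>)" by simp
      also have "\<dots> \<le> (v / 4) * \<phi> powr s * x powr (q - \<gamma>) + (4 * B) powr ((q - \<gamma>) / ((q - \<gamma>) - (1 - \<gamma>)))
          * (v / 4) powr (1 - (q - \<gamma>) / ((q - \<gamma>) - (1 - \<gamma>)))"
        using B v x \<gamma> q \<phi> sq by (intro young_powr_cutoff) auto
      also have "(q - \<gamma>) - (1 - \<gamma>) = q - 1" by simp
      finally have "2 * y powr (1 - \<gamma>) * (B * \<phi> powr (s - 1)) \<le> (v / 4) * \<phi> powr s * x powr (q - \<gamma>) + T3"
        by (simp add: T3_def e)
      from mult_left_mono[OF this, of l] show ?thesis using l by (simp add: mult_ac)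
    qed
    have t2: "l powr (1 - p) * y powr m * (Z * \<phi> powr (s - p)) \<le> \<mu> * v * \<phi> powr s * x powr q + T2"
    proof -
      have "l powr (1 - p) * y powr m * (Z * \<phi> powr (s - p)) \<le> l powr (1 - p) * (4 powr (p - 1) * x powr m) * (Z * \<phi> powr (s - p))"
        using b2 Z by (intro mult_right_mono mult_left_mono) auto
      also have "\<dots> = (l powr (1 - p) * 4 powr (p - 1) * Z) * \<phi> powr (s - p) * x powr m" by simp
      also have "\<dots> \<le> (\<mu> * v) * \<phi> powr s * x powr q + (l powr (1 - p) * 4 powr (p - 1) * Z) powr (q / (q - m)) * (\<mu> * v) powr (1 - q / (q - m))"
        using Z v x \<mu> q \<phi> s m0 mq by (intro young_powr_cutoff) auto
      finally show ?thesis by (simp add: T2_def e)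
    qed
    have t4: "x * (B * \<phi> powr (s - 1)) \<le> \<mu> * v * \<phi> powr s * x powr q + T4"
    proof -
      have "x * (B * \<phi> powr (s - 1)) = B * \<phi> powr (s - 1) * x powr 1" using xp by simp
      also have "\<dots> \<le> (\<mu> * v) * \<phi> powr s * x powr q + B powr (q / (q - 1)) * (\<mu> * v) powr (1 - q / (q - 1))"
        using B v x \<mu> q \<phi> s by (intro young_powr_cutoff) auto
      finally show ?thesis by (simp add: T4_def e)
    qed
    have "l * v * \<phi> powr s * (x powr (q - \<gamma>) / 2) \<le> l * v * \<phi> powr s * (x powr q * y powr (- \<gamma>))"
      using b4 l v by (intro mult_left_mono) auto
    then have t5: "l * ((v / 4) * \<phi> powr s * x powr (q - \<gamma>)) + l * ((v / 4) * \<phi> powr s * x powr (q - \<gamma>))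
      \<le> l * v * x powr q * y powr (- \<gamma>) * \<phi> powr s"
      by (simp add: mult_ac)
    have "R = l powr (1 - p) * y powr m * (Z * \<phi> powr (s - p)) + l * y powr (p - 1 - \<gamma>) * (Z * \<phi> powr (s - p))
      + x * (B * \<phi> powr (s - 1)) + 2 * l * y powr (1 - \<gamma>) * (B * \<phi> powr (s - 1)) - l * v * x powr q * y powr (- \<gamma>) * \<phi> powr s"
      unfolding R_def by (simp add: distrib_right)
    then show ?thesis using t1 t2 t3 t4 t5 Epos unfolding distrib_left[of l] by linarith
  qed
  then show ?thesis using LHS unfolding y_def T1_def T2_def T3_def T4_def E_def by linarith
qed

section \<open>A logarithmic cutoff\<close>

text \<open>The distance to the complement vanishes outside the domain, in contrast to the distance to the
  boundary, and is therefore the better function to smooth.\<close>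

lemma infdist_complement_eq_bdist:
  fixes \<Omega> :: "'a::euclidean_space set"
  assumes "open \<Omega>" "bounded \<Omega>" "x \<in> \<Omega>"
  shows "infdist x (- \<Omega>) = bdist \<Omega> x"
proof -
  have ne: "- \<Omega> \<noteq> {}" using assms(2) not_bounded_UNIV by (metis Compl_eq_Diff_UNIV Diff_eq_empty_iff top.extremum_uniqueI)
  have fr: "frontier \<Omega> \<noteq> {}" using assms(3) ne frontier_eq_empty by auto
  have "infdist x (- \<Omega>) \<le> infdist x (frontier \<Omega>)"
    using assms(1) fr by (intro infdist_mono) (auto simp: frontier_def interior_open)
  moreover have "infdist x (frontier \<Omega>) \<le> dist x y" if "y \<in> - \<Omega>" for y
  proof -
    have "closed_segment x y \<inter> frontier \<Omega> \<noteq> {}"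
      by (rule connected_Int_frontier) (use assms that in auto)
    then obtain z where z: "z \<in> closed_segment x y" "z \<in> frontier \<Omega>" by blast
    have "infdist x (frontier \<Omega>) \<le> dist x z" by (rule infdist_le[OF z(2)])
    also have "\<dots> \<le> dist x y" using z(1) dist_in_closed_segment by (metis dist_commute)
    finally show ?thesis .
  qed
  then have "infdist x (frontier \<Omega>) \<le> infdist x (- \<Omega>)"
    using ne by (subst infdist_notempty[of "- \<Omega>"]) (auto intro: cINF_greatest)
  ultimately show ?thesis by (simp add: bdist_def)
qed

lemma norm_gradient_le_1:
  fixes f :: "'a::euclidean_space \<Rightarrow> real"
  assumes der: "(f has_derivative (\<lambda>v. v \<bullet> D)) (at x)" and lip: "\<And>y. \<bar>f y - f x\<bar> \<le> norm (y - x)"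
  shows "norm D \<le> 1"
proof (cases "D = 0")
  case False
  show ?thesis
  proof (rule field_le_epsilon)
    fix e :: real assume "e > 0"
    then obtain d where d: "d > 0" "\<And>y. norm (y - x) < d \<Longrightarrow> norm (f y - f x - (y - x) \<bullet> D) \<le> e * norm (y - x)"
      using der unfolding has_derivative_at_alt by blast
    define t where "t = d / (2 * norm D)"
    have t: "t > 0" using d False by (simp add: t_def)
    let ?y = "x + t *\<^sub>R D"
    have "norm (?y - x) = d / 2" using False d by (simp add: t_def)
    then have "\<bar>f ?y - f x - t * (D \<bullet> D)\<bar> \<le> e * (t * norm D)"
      using d(2)[of ?y] d(1) t by simp
    moreover have "\<bar>f ?y - f x\<bar> \<le> t * norm D" using lip[of ?y] t by simp
    ultimately have "t * (D \<bullet> D) \<le> t * norm D + e * (t * norm D)" by linarith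
    also have "\<dots> = (t * norm D) * (1 + e)" by (simp add: algebra_simps)
    finally have "(t * norm D) * norm D \<le> (t * norm D) * (1 + e)"
      by (simp add: power2_norm_eq_inner[symmetric] power2_eq_square mult_ac)
    then show "norm D \<le> 1 + e" using t False by simp
  qed
qed simp

lemma gradient_borel_measurable:
  fixes f :: "'a::euclidean_space \<Rightarrow> real"
  assumes der: "\<And>x. (f has_derivative (\<lambda>v. v \<bullet> D x)) (at x)"
  shows "D \<in> borel_measurable borel"
proof (subst borel_measurable_euclidean_space, intro ballI)
  fix b :: 'a assume "b \<in> Basis"
  have [measurable]: "f \<in> borel_measurable borel"
    using der by (intro borel_measurable_continuous_onI) (meson continuous_at_imp_continuous_on has_derivative_continuous)
  show "(\<lambda>x. D x \<bullet> b) \<in> borel_measurable borel"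
  proof (rule borel_measurable_LIMSEQ_real)
    fix x
    have "((\<lambda>t. f (x + t *\<^sub>R b)) has_derivative (\<lambda>t. (t *\<^sub>R b) \<bullet> D x)) (at 0)"
      by (rule has_derivative_compose[where g = f and f = "\<lambda>t. x + t *\<^sub>R b"])
        (use der[of x] in \<open>auto intro!: derivative_eq_intros\<close>)
    then have "((\<lambda>t. f (x + t *\<^sub>R b)) has_real_derivative (D x \<bullet> b)) (at 0)"
      unfolding has_field_derivative_def
      by (elim has_derivative_eq_rhs) (auto simp: fun_eq_iff inner_commute)
    then have "((\<lambda>t. (f (x + t *\<^sub>R b) - f x) / t) \<longlongrightarrow> D x \<bullet> b) (at 0)" by (simp add: DERIV_def)
    moreover have "filterlim (\<lambda>n. 1 / real (Suc n)) (at 0) sequentially"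
      using LIMSEQ_inverse_real_of_nat by (auto simp: filterlim_at inverse_eq_divide)
    ultimately show "(\<lambda>n. (f (x + (1 / real (Suc n)) *\<^sub>R b) - f x) / (1 / real (Suc n))) \<longlonglongrightarrow> D x \<bullet> b"
      by (rule filterlim_compose)
  qed measurable
qed

text \<open>Mollification preserves the Lipschitz constant one. The smoothed distance is differentiable
  everywhere, and so is every cutoff built from it.\<close>

lemma smooth_distance_exists:
  fixes \<Omega> :: "'a::euclidean_space set"
  assumes \<Omega>: "bounded \<Omega>" and \<tau>: "\<tau> > 0"
  obtains \<delta> D where "\<And>x. (\<delta> has_derivative (\<lambda>v. v \<bullet> D x)) (at x)" "\<And>x. norm (D x) \<le> 1"
    "\<And>x. \<bar>\<delta> x - infdist x (- \<Omega>)\<bar> \<le> \<tau>" "D \<in> borel_measurable borel"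
proof -
  let ?d = "\<lambda>x. infdist x (- \<Omega>)"
  have ne: "- \<Omega> \<noteq> {}" using \<Omega> not_bounded_UNIV by (metis Compl_eq_Diff_UNIV Diff_eq_empty_iff top.extremum_uniqueI)
  have lip: "\<bar>?d x - ?d y\<bar> \<le> norm (x - y)" for x y
    using infdist_triangle_abs[of x "- \<Omega>" y] by (simp add: dist_norm)
  obtain R where "\<And>x. x \<in> \<Omega> \<Longrightarrow> norm x \<le> R" using \<Omega> unfolding bounded_iff by blast
  then have R: "\<Omega> \<subseteq> cball 0 R" by auto
  have cont: "continuous_on A ?d" for A by (intro continuous_intros)
  have int: "integrable lebesgue ?d"
  proof -
    have "integrable lebesgue (\<lambda>x. indicator (cball 0 R) x *\<^sub>R ?d x)"
      by (rule integrable_compact_continuous[OF compact_cball cont])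
    moreover have "(\<lambda>x. indicator (cball 0 R) x *\<^sub>R ?d x) = ?d"
    proof
      fix x show "indicator (cball 0 R) x *\<^sub>R ?d x = ?d x"
      proof (cases "x \<in> cball 0 R")
        case False
        then have "x \<in> - \<Omega>" using R by blast
        then show ?thesis by simp
      qed simp
    qed
    ultimately show ?thesis by simp
  qed
  let ?\<rho> = "mollifier (0::'a) \<tau>"
  define \<delta> where "\<delta> = mollify ?\<rho> ?d"
  define D where "D z = - (LINT y|lebesgue. ?d y *\<^sub>R gradient ?\<rho> (y - z))" for z
  have der: "(\<delta> has_derivative (\<lambda>v. v \<bullet> D z)) (at z)" for z
    using mollify_has_derivative[OF \<tau> int, of 0 z] by (simp add: \<delta>_def D_def)
  have i\<rho>: "integrable lebesgue (\<lambda>y. ?\<rho> (y - z))" for z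
    using integrable_mollifier[OF \<tau>, of "0 + z"]
    by (simp add: mollifier_translate[OF \<tau>] integrable_completion
        borel_measurable_continuous_onI continuous_on_mollifier[OF \<tau>])
  have imd: "integrable lebesgue (\<lambda>y. ?\<rho> (y - z) * ?d y)" for z
    using integrable_mollify[OF \<tau> int, of 0 z] by simp
  have close: "\<bar>\<delta> z - ?d z\<bar> \<le> \<tau>" for z
  proof -
    have "\<delta> z - ?d z = (LINT y|lebesgue. ?\<rho> (y - z) * ?d y) - (LINT y|lebesgue. ?\<rho> (y - z) * ?d z)"
      using i\<rho> by (simp add: \<delta>_def mollify_def integral_mollifier_shift[OF \<tau>])
    also have "\<dots> = (LINT y|lebesgue. ?\<rho> (y - z) * ?d y - ?\<rho> (y - z) * ?d z)"
      using i\<rho>[of z] imd[of z] by simp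
    also have "norm \<dots> \<le> (LINT y|lebesgue. ?\<rho> (y - z) * \<tau>)"
    proof (rule Bochner_Integration.integral_norm_bound_integral)
      fix y
      show "norm (?\<rho> (y - z) * ?d y - ?\<rho> (y - z) * ?d z) \<le> ?\<rho> (y - z) * \<tau>"
      proof (cases "?\<rho> (y - z) = 0")
        case False
        then have "norm (y - z) \<le> \<tau>" using mollifier_eq_0[OF \<tau>, of "y - z" 0] by auto
        then have "\<bar>?d y - ?d z\<bar> \<le> \<tau>" using lip[of y z] by linarith
        then have "?\<rho> (y - z) * \<bar>?d y - ?d z\<bar> \<le> ?\<rho> (y - z) * \<tau>"
          by (intro mult_left_mono mollifier_nonneg[OF \<tau>])
        then show ?thesis using mollifier_nonneg[OF \<tau>, of 0 "y - z"]
          by (simp add: right_diff_distrib[symmetric] abs_mult)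
      qed simp
    qed (use i\<rho>[of z] imd[of z] in auto)
    also have "\<dots> = \<tau>" using i\<rho> by (simp add: integral_mollifier_shift[OF \<tau>])
    finally show ?thesis by simp
  qed
  have shift: "\<delta> z = (LINT y|lborel. ?\<rho> y * ?d (y + z))" and ishift: "integrable lborel (\<lambda>y. ?\<rho> y * ?d (y + z))" for z
  proof -
    have m: "(\<lambda>y. ?\<rho> (y - z) * ?d y) \<in> borel_measurable borel"
      by (intro borel_measurable_continuous_onI continuous_intros cont
          continuous_on_compose2[OF continuous_on_mollifier[OF \<tau>, of UNIV]]) auto
    have "\<delta> z = (LINT y|lborel. ?\<rho> (y - z) * ?d y)"
      unfolding \<delta>_def mollify_def using m by (simp add: integral_completion)
    also have "\<dots> = integral\<^sup>L (distr lborel borel ((+) z)) (\<lambda>y. ?\<rho> (y - z) * ?d y)"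
      by (simp add: lborel_distr_plus)
    also have "\<dots> = (LINT y|lborel. ?\<rho> (z + y - z) * ?d (z + y))"
      by (rule integral_distr) (use m in auto)
    finally show "\<delta> z = (LINT y|lborel. ?\<rho> y * ?d (y + z))" by (simp add: add.commute)
    have "integrable lborel (\<lambda>y. ?\<rho> (y - z) * ?d y)"
      using imd[of z] m by (simp add: integrable_completion)
    then have "integrable (distr lborel borel ((+) z)) (\<lambda>y. ?\<rho> (y - z) * ?d y)"
      by (simp add: lborel_distr_plus)
    then have "integrable lborel (\<lambda>y. ?\<rho> (z + y - z) * ?d (z + y))"
      by (subst (asm) integrable_distr_eq) (use m in auto)
    then show "integrable lborel (\<lambda>y. ?\<rho> y * ?d (y + z))" by (simp add: add.commute)
  qed
  have lip\<delta>: "\<bar>\<delta> y - \<delta> x\<bar> \<le> norm (y - x)" for x y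
  proof -
    have "\<delta> y - \<delta> x = (LINT v|lborel. ?\<rho> v * ?d (v + y) - ?\<rho> v * ?d (v + x))"
      using ishift by (simp add: shift)
    also have "norm \<dots> \<le> (LINT v|lborel. ?\<rho> v * norm (y - x))"
    proof (rule Bochner_Integration.integral_norm_bound_integral)
      fix v
      have "?\<rho> v * \<bar>?d (v + y) - ?d (v + x)\<bar> \<le> ?\<rho> v * norm (y - x)"
        using lip[of "v + y" "v + x"] by (intro mult_left_mono mollifier_nonneg[OF \<tau>]) simp
      then show "norm (?\<rho> v * ?d (v + y) - ?\<rho> v * ?d (v + x)) \<le> ?\<rho> v * norm (y - x)"
        using mollifier_nonneg[OF \<tau>, of 0 v] by (simp add: right_diff_distrib[symmetric] abs_mult)
    qed (use ishift integrable_mollifier[OF \<tau>] in auto)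
    also have "\<dots> = norm (y - x)" using integrable_mollifier[OF \<tau>] integral_mollifier[OF \<tau>, of "0::'a"] by simp
    finally show ?thesis by simp
  qed
  show thesis
    by (rule that[OF der norm_gradient_le_1[OF der lip\<delta>] close gradient_borel_measurable[OF der]])
qed

text \<open>A cubic transition from 1 to 0 on the unit interval whose derivative vanishes at both ends.\<close>

definition smoothstep :: "real \<Rightarrow> real"
  where "smoothstep y = (if y \<le> 0 then 1 else if y \<ge> 1 then 0 else (1 - y)\<^sup>2 * (1 + 2 * y))"

definition smoothstep' :: "real \<Rightarrow> real"
  where "smoothstep' y = (if y \<le> 0 then 0 else if y \<ge> 1 then 0 else - 6 * y * (1 - y))"

lemma DERIV_0_if_quadratic_bound:
  fixes f :: "real \<Rightarrow> real"
  assumes "\<And>h. \<bar>f (x + h) - f x\<bar> \<le> c * h\<^sup>2"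
  shows "(f has_real_derivative 0) (at x)"
  unfolding DERIV_def
proof (rule Lim_null_comparison)
  show "\<forall>\<^sub>F h in at 0. norm ((f (x + h) - f x) / h) \<le> c * \<bar>h\<bar>"
    unfolding eventually_at_filter
  proof (intro always_eventually allI impI)
    fix h :: real assume "h \<noteq> 0"
    then show "norm ((f (x + h) - f x) / h) \<le> c * \<bar>h\<bar>"
      using assms[of h] by (simp add: divide_le_eq power2_eq_square abs_mult[symmetric] mult.assoc)
  qed
  have "((\<lambda>h. c * \<bar>h\<bar>) \<longlongrightarrow> c * \<bar>0\<bar>) (at (0::real))" by (intro tendsto_intros)
  then show "((\<lambda>h. c * \<bar>h\<bar>) \<longlongrightarrow> 0) (at (0::real))" by simp
qed

lemma smoothstep_deriv: "(smoothstep has_real_derivative smoothstep' y) (at y)"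
proof -
  consider "y < 0" | "y = 0" | "0 < y" "y < 1" | "y = 1" | "y > 1" by linarith
  then show ?thesis
  proof cases
    case 1
    have "((\<lambda>y. 1) has_real_derivative smoothstep' y) (at y)" using 1 by (simp add: smoothstep'_def)
    then show ?thesis
      by (rule has_field_derivative_transform_within_open[where S = "{..<0}"])
        (use 1 in \<open>auto simp: smoothstep_def\<close>)
  next
    case 2
    have "\<bar>smoothstep h - 1\<bar> \<le> 3 * h\<^sup>2" for h
    proof -
      consider "h \<le> 0" | "0 < h" "h < 1" | "h \<ge> 1" by linarith
      then show ?thesis
      proof cases
        case 2
        have "(1 - h)\<^sup>2 * (1 + 2 * h) - 1 = h\<^sup>2 * (2 * h - 3)" by (simp add: algebra_simps power2_eq_square)
        moreover have "\<bar>h\<^sup>2 * (2 * h - 3)\<bar> \<le> h\<^sup>2 * 3" unfolding abs_mult using 2 by (intro mult_mono) auto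
        ultimately show ?thesis using 2 by (simp add: smoothstep_def)
      qed (auto simp: smoothstep_def intro: order_trans[OF _ mult_left_mono[of 1 "h\<^sup>2" 3]])
    qed
    then have "(smoothstep has_real_derivative 0) (at 0)"
      by (intro DERIV_0_if_quadratic_bound[where c = 3]) (simp add: smoothstep_def)
    then show ?thesis using 2 by (simp add: smoothstep'_def)
  next
    case 3
    have "((\<lambda>y. (1 - y)\<^sup>2 * (1 + 2 * y)) has_real_derivative smoothstep' y) (at y)"
      using 3 by (auto intro!: derivative_eq_intros simp: smoothstep'_def algebra_simps power2_eq_square)
    then show ?thesis
      by (rule has_field_derivative_transform_within_open[where S = "{0<..<1}"])
        (use 3 in \<open>auto simp: smoothstep_def\<close>)
  next
    case 4
    have "\<bar>smoothstep (1 + h)\<bar> \<le> 3 * h\<^sup>2" for h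
    proof -
      consider "h \<le> -1" | "-1 < h" "h < 0" | "h \<ge> 0" by linarith
      then show ?thesis
      proof cases
        case 1
        have "1 \<le> h\<^sup>2" using power_mono[of 1 "-h" 2] 1 by simp
        then show ?thesis using 1 by (simp add: smoothstep_def)
      next
        case 2
        have "\<bar>h\<^sup>2 * (3 + 2 * h)\<bar> \<le> h\<^sup>2 * 3" unfolding abs_mult using 2 by (intro mult_mono) auto
        then show ?thesis using 2 by (simp add: smoothstep_def algebra_simps)
      qed (auto simp: smoothstep_def)
    qed
    then have "(smoothstep has_real_derivative 0) (at 1)"
      by (intro DERIV_0_if_quadratic_bound[where c = 3]) (simp add: smoothstep_def)
    then show ?thesis using 4 by (simp add: smoothstep'_def)
  next
    case 5
    have "((\<lambda>y. 0) has_real_derivative smoothstep' y) (at y)" using 5 by (simp add: smoothstep'_def)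
    then show ?thesis
      by (rule has_field_derivative_transform_within_open[where S = "{1<..}"])
        (use 5 in \<open>auto simp: smoothstep_def\<close>)
  qed
qed

lemma smoothstep_bounds: "0 \<le> smoothstep y" "smoothstep y \<le> 1"
proof -
  show "0 \<le> smoothstep y" by (simp add: smoothstep_def)
  have "(1 - y)\<^sup>2 * (1 + 2 * y) = 1 - y\<^sup>2 * (3 - 2 * y)" by (simp add: algebra_simps power2_eq_square)
  then show "smoothstep y \<le> 1" by (auto simp: smoothstep_def)
qed

lemma smoothstep'_bound: "\<bar>smoothstep' y\<bar> \<le> 2"
proof -
  have "(y - 1 / 2)\<^sup>2 \<ge> 0" by simp
  then have "6 * y * (1 - y) \<le> 3 / 2" by (simp add: algebra_simps power2_eq_square)
  then show ?thesis by (auto simp: smoothstep'_def abs_mult)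
qed

lemma smoothstep_measurable [measurable]: "smoothstep \<in> borel_measurable borel" "smoothstep' \<in> borel_measurable borel"
  unfolding smoothstep_def[abs_def] smoothstep'_def[abs_def] by measurable

text \<open>The points with \<open>2 powr (k \<theta>2) < d powr (- \<theta>2) + t powr \<theta>1 \<le> 2 powr (Suc k * \<theta>2)\<close>, where \<open>d\<close> is the
  distance to the boundary.\<close>

abbreviation annulus :: "'a::euclidean_space set \<Rightarrow> real \<Rightarrow> real \<Rightarrow> nat \<Rightarrow> ('a \<times> real) set"
  where "annulus \<Omega> \<theta>1 \<theta>2 k \<equiv> E_set \<Omega> \<theta>1 \<theta>2 ((1/2) ^ k / 2) - E_set \<Omega> \<theta>1 \<theta>2 ((1/2) ^ k)"

lemma half_powr: "((1/2) ^ k) powr - a = 2 powr (real k * a)"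
proof -
  have "(1/2::real) ^ k = 2 powr (- real k)"
    by (simp add: powr_minus powr_realpow power_divide inverse_eq_divide)
  then show ?thesis by (simp add: powr_powr)
qed

text \<open>A logarithmic cutoff. With \<open>gg = \<delta> powr (- \<theta>2) + t powr \<theta>1\<close> for a smoothed distance \<open>\<delta>\<close>, the function \<open>\<phi>\<close>
  is the smooth step of \<open>log 2 gg / (\<theta>2 n) - 1\<close>. It descends from 1 to 0 over about \<open>n\<close> annuli, and the
  logarithmic derivative of \<open>gg\<close> produces the factor \<open>1 / n\<close> in the bounds. On the annulus \<open>k\<close> the factor \<open>1 /
  gg\<close> is comparable to \<open>2 powr (- k \<theta>2)\<close>. A power of \<open>\<phi>\<close> is used as the cutoff, so that derivatives are
  controlled by a slightly lower power.\<close>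

lemma cutoff_exists:
  fixes \<Omega> :: "'a::euclidean_space set" and n s :: nat
  defines "D \<equiv> {z::'a \<times> real. snd z > 0}"
  assumes \<Omega>: "open \<Omega>" "bounded \<Omega>" and \<theta>: "\<theta>1 \<ge> 1" "\<theta>2 \<ge> 1" and n: "n \<ge> 1" and s: "s \<ge> 2"
  obtains \<phi> :: "'a \<times> real \<Rightarrow> real" and Px Pt M K where
    "compact K" "K \<subseteq> \<Omega> \<times> {0..}"
    "\<And>z. z \<in> D \<Longrightarrow> ((\<lambda>z. \<phi> z ^ s) has_derivative (\<lambda>v. Px z \<bullet> fst v + Pt z * snd v)) (at z)"
    "\<And>z. 0 \<le> \<phi> z \<and> \<phi> z \<le> 1" "\<And>z. z \<in> D \<Longrightarrow> norm (Px z) \<le> M \<and> \<bar>Pt z\<bar> \<le> M"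
    "\<And>z. z \<in> D \<Longrightarrow> z \<notin> K \<Longrightarrow> \<phi> z = 0 \<and> Px z = 0 \<and> Pt z = 0"
    "Px \<in> borel_measurable borel" "Pt \<in> borel_measurable borel" "\<phi> \<in> borel_measurable borel"
    "\<And>z. z \<in> D \<Longrightarrow> z \<in> E_set \<Omega> \<theta>1 \<theta>2 ((1/2) ^ (n - 1)) \<Longrightarrow> \<phi> z = 1"
    "\<And>z. z \<in> D \<Longrightarrow> Px z \<noteq> 0 \<or> Pt z \<noteq> 0 \<Longrightarrow> \<exists>k\<in>{n-1..2*n}. z \<in> annulus \<Omega> \<theta>1 \<theta>2 k \<and> \<phi> z > 0 \<and>
      norm (Px z) \<le> real s * \<phi> z ^ (s - 1) * (\<theta>1 * 4 powr (\<theta>2 + 2) / real n * 2 powr (- real k * \<theta>2) * bdist \<Omega> (fst z) powr (- \<theta>2 - 1)) \<and>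
      \<bar>Pt z\<bar> \<le> real s * \<phi> z ^ (s - 1) * (\<theta>1 * 4 powr (\<theta>2 + 2) / real n * 2 powr (- real k * \<theta>2) * snd z powr (\<theta>1 - 1))"
proof -
  let ?d = "\<lambda>x. infdist x (- \<Omega>)"
  \<comment> \<open>The cutoff will vanish where the smoothed distance is below \<open>2 * \<tau>\<close>; elsewhere an error of
    size \<open>\<tau>\<close> changes the distance by a factor of at most two.\<close>
  define \<tau> where "\<tau> = (1/2::real) ^ (2 * n) / 2"
  have \<tau>: "\<tau> > 0" by (simp add: \<tau>_def)
  have \<tau>2: "(1/2) ^ (2 * n) = 2 * \<tau>" by (simp add: \<tau>_def)
  obtain \<delta> Dd where \<delta>: "\<And>x. (\<delta> has_derivative (\<lambda>v. v \<bullet> Dd x)) (at x)" "\<And>x. norm (Dd x) \<le> 1"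
    "\<And>x. \<bar>\<delta> x - ?d x\<bar> \<le> \<tau>" "Dd \<in> borel_measurable borel"
    using smooth_distance_exists[OF \<Omega>(2) \<tau>] by blast
  have \<delta>c: "continuous_on UNIV \<delta>" using \<delta>(1) by (meson continuous_at_imp_continuous_on has_derivative_continuous)
  have ln2: "ln (2::real) \<ge> 1/2" using ln2_ge_two_thirds by simp
  have n1: "real n \<ge> 1" using n by simp
  define gg where "gg z = \<delta> (fst z) powr - \<theta>2 + snd z powr \<theta>1" for z :: "'a \<times> real"
  define y where "y z = ln (gg z) / (\<theta>2 * ln 2) / real n - 1" for z
  define \<phi> where "\<phi> z = (if \<delta> (fst z) > 0 then smoothstep (y z) else 0)" for z
  \<comment> \<open>The derivative of the cutoff with respect to \<open>gg\<close>.\<close>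
  define c where "c z = real s * \<phi> z ^ (s - 1) * smoothstep' (y z) / (real n * \<theta>2 * ln 2 * gg z)" for z
  define Px where "Px z = (if \<delta> (fst z) > 0 then (c z * (- \<theta>2) * \<delta> (fst z) powr (- \<theta>2 - 1)) *\<^sub>R Dd (fst z) else 0)" for z
  define Pt where "Pt z = (if \<delta> (fst z) > 0 then c z * (\<theta>1 * snd z powr (\<theta>1 - 1)) else 0)" for z
  have gg_pos: "gg z > 0" if "\<delta> (fst z) > 0" for z
    using that by (simp add: gg_def add_pos_nonneg)
  have y_iff: "y z < 1 \<longleftrightarrow> gg z < 2 powr (2 * real n * \<theta>2)" "y z > 0 \<longleftrightarrow> gg z > 2 powr (real n * \<theta>2)"
    if "\<delta> (fst z) > 0" for z
  proof -
    have c: "\<theta>2 * ln 2 * real n > 0" using \<theta> ln2 n1 by simp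
    have "y z < 1 \<longleftrightarrow> ln (gg z) < 2 * (\<theta>2 * ln 2 * real n)" "y z > 0 \<longleftrightarrow> ln (gg z) > \<theta>2 * ln 2 * real n"
      using c by (simp_all add: y_def divide_divide_eq_left pos_divide_less_eq pos_less_divide_eq)
    moreover have "2 * (\<theta>2 * ln 2 * real n) = ln (2 powr (2 * real n * \<theta>2))" "\<theta>2 * ln 2 * real n = ln (2 powr (real n * \<theta>2))"
      by (simp_all add: ln_powr)
    ultimately show "y z < 1 \<longleftrightarrow> gg z < 2 powr (2 * real n * \<theta>2)" "y z > 0 \<longleftrightarrow> gg z > 2 powr (real n * \<theta>2)"
      using ln_less_cancel_iff[OF gg_pos[OF that], of "2 powr (2 * real n * \<theta>2)"]
        ln_less_cancel_iff[OF _ gg_pos[OF that], of "2 powr (real n * \<theta>2)"] by (simp_all add: mult_ac)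
  qed
  have small: "y z \<ge> 1" if "\<delta> (fst z) > 0" "\<delta> (fst z) \<le> 2 * \<tau>" for z
  proof -
    have "2 powr (2 * real n * \<theta>2) = (2 * \<tau>) powr - \<theta>2"
      using half_powr[of "2 * n" \<theta>2] by (simp add: \<tau>2)
    also have "\<dots> \<le> \<delta> (fst z) powr - \<theta>2" using that \<theta> by (intro powr_mono2') auto
    also have "\<dots> \<le> gg z" by (simp add: gg_def)
    finally show ?thesis using y_iff(1)[OF that(1)] by linarith
  qed
  have step0: "smoothstep v = 0" "smoothstep' v = 0" if "v \<ge> 1" for v using that by (simp_all add: smoothstep_def smoothstep'_def)
  have der: "((\<lambda>z. \<phi> z ^ s) has_derivative (\<lambda>v. Px z \<bullet> fst v + Pt z * snd v)) (at z)" if "z \<in> D" for z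
  proof (cases "\<delta> (fst z) > 0")
    case True
    have A: "((\<lambda>z. \<delta> (fst z) powr - \<theta>2) has_derivative (\<lambda>v. (fst v \<bullet> Dd (fst z)) * (- \<theta>2 * \<delta> (fst z) powr (- \<theta>2 - 1)))) (at z)"
    proof (rule DERIV_compose_FDERIV[where f = "\<lambda>r. r powr - \<theta>2" and g = "\<lambda>z. \<delta> (fst z)"])
      show "((\<lambda>r. r powr - \<theta>2) has_real_derivative - \<theta>2 * \<delta> (fst z) powr (- \<theta>2 - 1)) (at (\<delta> (fst z)))"
        by (rule has_real_derivative_powr[OF True])
      show "((\<lambda>z. \<delta> (fst z)) has_derivative (\<lambda>v. fst v \<bullet> Dd (fst z))) (at z)"
        by (rule has_derivative_compose[where g = \<delta> and f = fst]) (use \<delta>(1) in \<open>auto intro!: derivative_eq_intros\<close>)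
    qed
    have B: "((\<lambda>z. snd z powr \<theta>1) has_derivative (\<lambda>v. snd v * (\<theta>1 * snd z powr (\<theta>1 - 1)))) (at z)"
    proof (rule DERIV_compose_FDERIV[where f = "\<lambda>r. r powr \<theta>1" and g = snd])
      show "((\<lambda>r. r powr \<theta>1) has_real_derivative \<theta>1 * snd z powr (\<theta>1 - 1)) (at (snd z))"
        by (rule has_real_derivative_powr) (use that in \<open>simp add: D_def\<close>)
    qed (auto intro!: derivative_eq_intros)
    have f: "((\<lambda>r. smoothstep (ln r / (\<theta>2 * ln 2) / real n - 1) ^ s) has_real_derivative
        real s * smoothstep (y z) ^ (s - 1) * (smoothstep' (y z) * (1 / gg z / (\<theta>2 * ln 2) / real n))) (at (gg z))"
    proof -
      have i: "((\<lambda>r. ln r / (\<theta>2 * ln 2) / real n - 1) has_real_derivative 1 / gg z / (\<theta>2 * ln 2) / real n) (at (gg z))"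
        using gg_pos[OF True] \<theta> n1 by (auto intro!: derivative_eq_intros simp: field_simps)
      have "((\<lambda>r. smoothstep (ln r / (\<theta>2 * ln 2) / real n - 1)) has_real_derivative
          smoothstep' (y z) * (1 / gg z / (\<theta>2 * ln 2) / real n)) (at (gg z))"
        unfolding y_def by (rule DERIV_chain2[OF smoothstep_deriv i])
      from DERIV_power[OF this, of s] show ?thesis by (simp add: y_def mult_ac)
    qed
    have "((\<lambda>z. smoothstep (ln (gg z) / (\<theta>2 * ln 2) / real n - 1) ^ s) has_derivative
        (\<lambda>v. ((fst v \<bullet> Dd (fst z)) * (- \<theta>2 * \<delta> (fst z) powr (- \<theta>2 - 1)) + snd v * (\<theta>1 * snd z powr (\<theta>1 - 1)))
          * (real s * smoothstep (y z) ^ (s - 1) * (smoothstep' (y z) * (1 / gg z / (\<theta>2 * ln 2) / real n))))) (at z)"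
      by (rule DERIV_compose_FDERIV[where g = gg and f = "\<lambda>r. smoothstep (ln r / (\<theta>2 * ln 2) / real n - 1) ^ s"])
        (use f has_derivative_add[OF A B] in \<open>simp_all add: gg_def[abs_def]\<close>)
    moreover have "(\<lambda>v. ((fst v \<bullet> Dd (fst z)) * (- \<theta>2 * \<delta> (fst z) powr (- \<theta>2 - 1)) + snd v * (\<theta>1 * snd z powr (\<theta>1 - 1)))
          * (real s * smoothstep (y z) ^ (s - 1) * (smoothstep' (y z) * (1 / gg z / (\<theta>2 * ln 2) / real n))))
        = (\<lambda>v. Px z \<bullet> fst v + Pt z * snd v)"
      using True by (auto simp: fun_eq_iff Px_def Pt_def c_def \<phi>_def inner_commute divide_simps) (simp add: algebra_simps)
    ultimately have "((\<lambda>z. smoothstep (y z) ^ s) has_derivative (\<lambda>v. Px z \<bullet> fst v + Pt z * snd v)) (at z)"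
      by (simp add: y_def[abs_def])
    then show ?thesis
    proof (rule has_derivative_transform_within_open)
      show "open {z::'a \<times> real. \<delta> (fst z) > 0}"
        by (intro open_Collect_less continuous_intros continuous_on_compose2[OF \<delta>c]) auto
    qed (use True in \<open>auto simp: \<phi>_def\<close>)
  next
    case False
    have "((\<lambda>z. 0) has_derivative (\<lambda>v. Px z \<bullet> fst v + Pt z * snd v)) (at z)"
      using False by (simp add: Px_def Pt_def)
    then show ?thesis
    proof (rule has_derivative_transform_within_open)
      show "open {z::'a \<times> real. \<delta> (fst z) < 2 * \<tau>}"
        by (intro open_Collect_less continuous_intros continuous_on_compose2[OF \<delta>c]) auto
      show "z \<in> {z. \<delta> (fst z) < 2 * \<tau>}" using False \<tau> by simp
      show "0 = \<phi> z ^ s" if "z \<in> {z. \<delta> (fst z) < 2 * \<tau>}" for z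
        using small[of z] step0 that s by (auto simp: \<phi>_def)
    qed
  qed
  have cmp: "b powr - \<theta> \<le> 2 powr \<theta> * a powr - \<theta>" if "0 < a" "a \<le> 2 * b" "\<theta> \<ge> 0" for a b \<theta> :: real
  proof -
    have "b powr - \<theta> \<le> (a / 2) powr - \<theta>" using that by (intro powr_mono2') auto
    also have "\<dots> = 2 powr \<theta> * a powr - \<theta>" using that by (simp add: powr_divide powr_minus field_simps)
    finally show ?thesis .
  qed
  have d_pos: "?d x > 0 \<Longrightarrow> x \<in> \<Omega>" for x using infdist_zero[of x "- \<Omega>"] by fastforce
  define g where "g z = ?d (fst z) powr - \<theta>2 + snd z powr \<theta>1" for z :: "'a \<times> real"
  have ggg: "gg z \<le> 2 powr \<theta>2 * g z" if "0 < ?d (fst z)" "?d (fst z) \<le> 2 * \<delta> (fst z)" for z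
  proof -
    have "snd z powr \<theta>1 \<le> 2 powr \<theta>2 * snd z powr \<theta>1" using \<theta> mult_right_mono[of 1 "2 powr \<theta>2" "snd z powr \<theta>1"] by (simp add: ge_one_powr_ge_zero)
    then show ?thesis using cmp[OF that, of \<theta>2] \<theta> by (simp add: gg_def g_def distrib_left)
  qed
  have ggg': "g z \<le> 2 powr \<theta>2 * gg z" if "0 < \<delta> (fst z)" "\<delta> (fst z) \<le> 2 * ?d (fst z)" for z
  proof -
    have "snd z powr \<theta>1 \<le> 2 powr \<theta>2 * snd z powr \<theta>1" using \<theta> mult_right_mono[of 1 "2 powr \<theta>2" "snd z powr \<theta>1"] by (simp add: ge_one_powr_ge_zero)
    then show ?thesis using cmp[OF that, of \<theta>2] \<theta> by (simp add: gg_def g_def distrib_left)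
  qed
  have Emem: "z \<in> E_set \<Omega> \<theta>1 \<theta>2 ((1/2) ^ k) \<longleftrightarrow> g z \<le> 2 powr (real k * \<theta>2)" if "fst z \<in> \<Omega>" "z \<in> D" for z k
    using that infdist_complement_eq_bdist[OF \<Omega> that(1)] half_powr[of k \<theta>2]
    by (cases z) (auto simp: E_set_def g_def D_def)
  have near: "\<tau> < ?d (fst z) \<and> fst z \<in> \<Omega> \<and> \<delta> (fst z) \<le> 2 * ?d (fst z) \<and> ?d (fst z) \<le> 2 * \<delta> (fst z)"
    if "\<delta> (fst z) > 2 * \<tau>" for z
    using \<delta>(3)[of "fst z"] that \<tau> d_pos[of "fst z"] by auto
  define T where "T = 2 powr (real (2 * n + 1) * \<theta>2)"
  have T: "2 powr (2 * real n * \<theta>2) \<le> T" "T \<ge> 1" "2 powr \<theta>2 * 2 powr (2 * real n * \<theta>2) = T"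
    using \<theta> n1 by (auto simp: T_def ge_one_powr_ge_zero powr_add[symmetric] algebra_simps)
  define K where "K = {x. ?d x \<ge> \<tau>} \<times> {0..T}"
  have in_K: "z \<in> K" if "z \<in> D" "\<delta> (fst z) > 0" "y z < 1" for z
  proof -
    have "\<delta> (fst z) > 2 * \<tau>" using small[OF that(2)] that(3) by linarith
    then have "?d (fst z) \<ge> \<tau>" using near by force
    moreover have "snd z \<le> T"
    proof (cases "snd z \<le> 1")
      case False
      have "snd z powr 1 \<le> snd z powr \<theta>1" using False \<theta> by (intro powr_mono) auto
      also have "\<dots> \<le> gg z" by (simp add: gg_def)
      also have "\<dots> < T" using y_iff(1)[OF that(2)] that(3) T by linarith
      finally show ?thesis using False by simp
    qed (use T in linarith)
    ultimately show ?thesis using that(1) by (cases z) (auto simp: K_def D_def)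
  qed
  have active: "\<delta> (fst z) > 0 \<and> 0 < y z \<and> y z < 1" if "Px z \<noteq> 0 \<or> Pt z \<noteq> 0" for z
  proof -
    have "\<delta> (fst z) > 0" using that by (auto simp: Px_def Pt_def split: if_splits)
    moreover have "smoothstep' (y z) \<noteq> 0"
    proof
      assume "smoothstep' (y z) = 0"
      then have "c z = 0" by (simp add: c_def)
      then have "Px z = 0" "Pt z = 0" by (simp_all add: Px_def Pt_def)
      then show False using that by simp
    qed
    ultimately show ?thesis by (auto simp: smoothstep'_def split: if_splits)
  qed
  let ?c0 = "\<theta>1 * 4 powr (\<theta>2 + 2) / real n"
  have annulus: "\<exists>k\<in>{n-1..2*n}. z \<in> annulus \<Omega> \<theta>1 \<theta>2 k \<and> \<phi> z > 0 \<and>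
      norm (Px z) \<le> real s * \<phi> z ^ (s - 1) * (?c0 * 2 powr (- real k * \<theta>2) * bdist \<Omega> (fst z) powr (- \<theta>2 - 1)) \<and>
      \<bar>Pt z\<bar> \<le> real s * \<phi> z ^ (s - 1) * (?c0 * 2 powr (- real k * \<theta>2) * snd z powr (\<theta>1 - 1)) \<and> \<tau> < bdist \<Omega> (fst z) \<and> snd z powr \<theta>1 \<le> T"
    if zD: "z \<in> D" and nz: "Px z \<noteq> 0 \<or> Pt z \<noteq> 0" for z
  proof -
    have \<delta>0: "\<delta> (fst z) > 0" and y01: "0 < y z" "y z < 1" using active[OF nz] by auto
    have \<delta>\<tau>: "\<delta> (fst z) > 2 * \<tau>" using small[OF \<delta>0] y01 by linarith
    note nr = near[OF \<delta>\<tau>]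
    have d0: "?d (fst z) > 0" using nr \<tau> by linarith
    have bd: "bdist \<Omega> (fst z) = ?d (fst z)" using infdist_complement_eq_bdist[OF \<Omega>] nr by simp
    have gb: "2 powr (real n * \<theta>2) < gg z" "gg z < 2 powr (2 * real n * \<theta>2)" using y_iff[OF \<delta>0] y01 by auto
    have g_lo: "2 powr ((real n - 1) * \<theta>2) < g z"
    proof -
      have "2 powr \<theta>2 * 2 powr ((real n - 1) * \<theta>2) = 2 powr (real n * \<theta>2)"
        by (simp add: powr_add[symmetric] algebra_simps)
      also have "\<dots> < 2 powr \<theta>2 * g z" using gb ggg[OF d0] nr by linarith
      finally show ?thesis by simp
    qed
    have g_hi: "g z < T"
    proof -
      have "g z \<le> 2 powr \<theta>2 * gg z" using ggg'[OF \<delta>0] nr by simp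
      also have "\<dots> < 2 powr \<theta>2 * 2 powr (2 * real n * \<theta>2)" using gb by simp
      finally show ?thesis using T by simp
    qed
    have g_pos: "g z > 0" using d0 by (simp add: g_def add_pos_nonneg)
    \<comment> \<open>The annulus index is the dyadic logarithm of \<open>g\<close>, rounded up, minus one. Replacing the smoothed
    distance by the distance shifts it by at most one, which gives the range \<open>n - 1, \<dots>, 2 * n\<close>.\<close>
    define Wg where "Wg = log 2 (g z) / \<theta>2"
    have gW: "g z = 2 powr (Wg * \<theta>2)" using g_pos \<theta> by (simp add: Wg_def)
    have W: "real n - 1 < Wg" "Wg < real (2 * n + 1)"
      using g_lo g_hi \<theta> unfolding gW T_def by simp_all
    define k where "k = nat (\<lceil>Wg\<rceil> - 1)"
    have k: "real k < Wg" "Wg \<le> real (k + 1)" "k \<in> {n-1..2*n}"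
    proof -
      have c: "\<lceil>Wg\<rceil> \<ge> int n" "\<lceil>Wg\<rceil> \<le> int (2 * n + 1)" using W n by linarith+
      then have "0 \<le> \<lceil>Wg\<rceil> - 1" using n by linarith
      then have kk: "int k = \<lceil>Wg\<rceil> - 1" unfolding k_def by (rule nat_0_le)
      then have "real k = real_of_int \<lceil>Wg\<rceil> - 1" by (metis of_int_1 of_int_diff of_int_of_nat_eq)
      then show "real k < Wg" "Wg \<le> real (k + 1)" by linarith+
      show "k \<in> {n-1..2*n}" using kk c by auto
    qed
    have gk: "2 powr (real k * \<theta>2) < g z" "g z \<le> 2 powr (real (Suc k) * \<theta>2)"
      unfolding gW using k \<theta> by (auto intro!: mult_right_mono)
    have ringz: "z \<in> annulus \<Omega> \<theta>1 \<theta>2 k"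
      using Emem[of z k] Emem[of z "Suc k"] nr zD gk by auto
    have \<phi>p: "\<phi> z > 0" using \<delta>0 y01 by (simp add: \<phi>_def smoothstep_def)
    have inv_gg: "1 / gg z \<le> 2 powr \<theta>2 * 2 powr (- real k * \<theta>2)"
    proof -
      have "2 powr (real k * \<theta>2) \<le> 2 powr \<theta>2 * gg z" using gk(1) ggg'[OF \<delta>0] nr by linarith
      then show ?thesis using gg_pos[OF \<delta>0] by (simp add: powr_minus field_simps)
    qed
    have cb: "\<bar>c z\<bar> * \<theta>2 \<le> real s * \<phi> z ^ (s - 1) * (4 / real n * (2 powr \<theta>2 * 2 powr (- real k * \<theta>2)))"
    proof -
      have "\<bar>c z\<bar> * \<theta>2 = real s * \<phi> z ^ (s - 1) * ((\<bar>smoothstep' (y z)\<bar> / ln 2) / real n * (1 / gg z))"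
        using \<theta> \<phi>p gg_pos[OF \<delta>0] by (simp add: c_def abs_mult mult_ac)
      also have "\<dots> \<le> real s * \<phi> z ^ (s - 1) * (4 / real n * (2 powr \<theta>2 * 2 powr (- real k * \<theta>2)))"
      proof (intro mult_left_mono mult_mono divide_right_mono inv_gg)
        have "\<bar>smoothstep' (y z)\<bar> / ln 2 \<le> 2 / (1 / 2)"
          using smoothstep'_bound[of "y z"] ln2 by (intro frac_le) auto
        then show "\<bar>smoothstep' (y z)\<bar> / ln 2 \<le> 4" by simp
      qed (use gg_pos[OF \<delta>0] \<phi>p in auto)
      finally show ?thesis .
    qed
    have four: "2 powr \<theta>2 * 2 powr (\<theta>2 + 1) * 4 \<le> 4 powr (\<theta>2 + 2)"
    proof -
      have "4 powr (\<theta>2 + 2) = 2 powr (2 * (\<theta>2 + 2))" using powr_powr[of 2 2 "\<theta>2 + 2"] by simp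
      moreover have "2 powr \<theta>2 * 2 powr (\<theta>2 + 1) * 4 = 2 powr (2 * \<theta>2 + 3)"
        using powr_add[of 2 \<theta>2 "\<theta>2 + 1"] powr_add[of 2 "2 * \<theta>2 + 1" 2] by (simp add: add.commute)
      ultimately show ?thesis by simp
    qed
    have P1: "norm (Px z) \<le> real s * \<phi> z ^ (s - 1) * (?c0 * 2 powr (- real k * \<theta>2) * bdist \<Omega> (fst z) powr (- \<theta>2 - 1))"
    proof -
      have "norm (Px z) = (\<bar>c z\<bar> * \<theta>2) * \<delta> (fst z) powr (- \<theta>2 - 1) * norm (Dd (fst z))"
        using \<delta>0 \<theta> by (simp add: Px_def abs_mult)
      also have "\<dots> \<le> (\<bar>c z\<bar> * \<theta>2) * \<delta> (fst z) powr (- \<theta>2 - 1)"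
        using \<delta>(2)[of "fst z"] \<theta> by (intro mult_left_le) auto
      also have "\<dots> \<le> (real s * \<phi> z ^ (s - 1) * (4 / real n * (2 powr \<theta>2 * 2 powr (- real k * \<theta>2))))
          * (2 powr (\<theta>2 + 1) * ?d (fst z) powr (- \<theta>2 - 1))"
        using cmp[OF d0, of "\<delta> (fst z)" "\<theta>2 + 1"] nr \<theta> \<phi>p by (intro mult_mono cb) auto
      also have "\<dots> = real s * \<phi> z ^ (s - 1) * ((2 powr \<theta>2 * 2 powr (\<theta>2 + 1) * 4) / real n * 2 powr (- real k * \<theta>2) * ?d (fst z) powr (- \<theta>2 - 1))"
        by simp
      also have "\<dots> \<le> real s * \<phi> z ^ (s - 1) * (?c0 * 2 powr (- real k * \<theta>2) * ?d (fst z) powr (- \<theta>2 - 1))"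
        using four \<theta> \<phi>p by (intro mult_left_mono mult_right_mono divide_right_mono) (auto intro: order_trans[OF _ mult_right_mono[of 1]])
      finally show ?thesis unfolding bd .
    qed
    have P2: "\<bar>Pt z\<bar> \<le> real s * \<phi> z ^ (s - 1) * (?c0 * 2 powr (- real k * \<theta>2) * snd z powr (\<theta>1 - 1))"
    proof -
      have c\<theta>: "\<bar>c z\<bar> \<le> \<bar>c z\<bar> * \<theta>2" using \<theta> by (simp add: mult_le_cancel_left1)
      have "\<bar>Pt z\<bar> = \<bar>c z\<bar> * (\<theta>1 * snd z powr (\<theta>1 - 1))" using \<delta>0 \<theta> by (simp add: Pt_def abs_mult)
      also have "\<dots> \<le> (real s * \<phi> z ^ (s - 1) * (4 / real n * (2 powr \<theta>2 * 2 powr (- real k * \<theta>2)))) * (\<theta>1 * snd z powr (\<theta>1 - 1))"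
        using cb c\<theta> \<theta> by (intro mult_right_mono) auto
      also have "\<dots> = real s * \<phi> z ^ (s - 1) * (\<theta>1 * (2 powr \<theta>2 * 4) / real n * 2 powr (- real k * \<theta>2) * snd z powr (\<theta>1 - 1))"
        by simp
      also have "\<dots> \<le> real s * \<phi> z ^ (s - 1) * (?c0 * 2 powr (- real k * \<theta>2) * snd z powr (\<theta>1 - 1))"
      proof (intro mult_left_mono mult_right_mono divide_right_mono)
        have "2 powr \<theta>2 * 4 \<le> 2 powr \<theta>2 * 2 powr (\<theta>2 + 1) * 4"
          using \<theta> by (simp add: ge_one_powr_ge_zero)
        then show "2 powr \<theta>2 * 4 \<le> 4 powr (\<theta>2 + 2)" using four by linarith
      qed (use \<theta> \<phi>p in auto)
      finally show ?thesis .
    qed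
    have "snd z powr \<theta>1 \<le> T" using g_hi by (simp add: g_def) (smt (verit) powr_ge_zero)
    then show ?thesis using k(3) ringz \<phi>p P1 P2 nr bd by auto
  qed
  define M where "M = real s * (?c0 * (\<tau> powr (- \<theta>2 - 1) + 1 + T))"
  have \<phi>01: "0 \<le> \<phi> z \<and> \<phi> z \<le> 1" for z by (simp add: \<phi>_def smoothstep_bounds)
  have bound: "norm (Px z) \<le> M \<and> \<bar>Pt z\<bar> \<le> M" if zD: "z \<in> D" for z
  proof (cases "Px z \<noteq> 0 \<or> Pt z \<noteq> 0")
    case True
    from annulus[OF zD this] obtain k where k:
      "norm (Px z) \<le> real s * \<phi> z ^ (s - 1) * (?c0 * 2 powr (- real k * \<theta>2) * bdist \<Omega> (fst z) powr (- \<theta>2 - 1))"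
      "\<bar>Pt z\<bar> \<le> real s * \<phi> z ^ (s - 1) * (?c0 * 2 powr (- real k * \<theta>2) * snd z powr (\<theta>1 - 1))"
      "\<tau> < bdist \<Omega> (fst z)" "snd z powr \<theta>1 \<le> T" by blast
    have gen: "real s * \<phi> z ^ (s - 1) * (?c0 * 2 powr (- real k * \<theta>2) * r) \<le> M" if "0 \<le> r" "r \<le> \<tau> powr (- \<theta>2 - 1) + 1 + T" for r
    proof -
      have "2 powr (- real k * \<theta>2) \<le> 2 powr 0" using \<theta> by (intro powr_mono) auto
      then have t1: "2 powr (- real k * \<theta>2) \<le> 1" by simp
      have "\<phi> z ^ (s - 1) \<le> 1" using \<phi>01 by (simp add: power_le_one)
      then have "real s * \<phi> z ^ (s - 1) * (?c0 * 2 powr (- real k * \<theta>2) * r) \<le> real s * 1 * (?c0 * 1 * (\<tau> powr (- \<theta>2 - 1) + 1 + T))"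
        using t1 that \<phi>01 \<theta> by (intro mult_mono) auto
      then show ?thesis by (simp add: M_def)
    qed
    have "bdist \<Omega> (fst z) powr (- \<theta>2 - 1) \<le> \<tau> powr (- \<theta>2 - 1)" using k(3) \<tau> \<theta> by (intro powr_mono2') auto
    then have "norm (Px z) \<le> M" using order_trans[OF k(1) gen[of "bdist \<Omega> (fst z) powr (- \<theta>2 - 1)"]] T by simp
    moreover have "snd z powr (\<theta>1 - 1) \<le> 1 + T"
    proof (cases "snd z \<le> 1")
      case True
      then have "snd z powr (\<theta>1 - 1) \<le> 1" using zD \<theta> by (auto simp: D_def intro!: powr_le1)
      then show ?thesis using T by linarith
    next
      case False
      then have "snd z powr (\<theta>1 - 1) \<le> snd z powr \<theta>1" by (intro powr_mono) auto
      then show ?thesis using k(4) by linarith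
    qed
    then have "snd z powr (\<theta>1 - 1) \<le> \<tau> powr (- \<theta>2 - 1) + 1 + T"
      using powr_ge_zero[of \<tau> "- \<theta>2 - 1"] by linarith
    from order_trans[OF k(2) gen[OF powr_ge_zero this]] have "\<bar>Pt z\<bar> \<le> M" .
    ultimately show ?thesis by simp
  next
    case False
    have "M \<ge> 0" using \<theta> T by (simp add: M_def)
    then show ?thesis using False by simp
  qed
  show thesis
  proof (rule that[of K \<phi> Px Pt M])
    have "closed {x. ?d x \<ge> \<tau>}" by (intro closed_Collect_le continuous_intros)
    moreover have sub: "{x. ?d x \<ge> \<tau>} \<subseteq> \<Omega>" using d_pos \<tau> by force
    ultimately have "compact {x. ?d x \<ge> \<tau>}" using \<Omega>(2) bounded_subset compact_eq_bounded_closed by blast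
    then show "compact K" unfolding K_def by (intro compact_Times) auto
    show "K \<subseteq> \<Omega> \<times> {0..}" unfolding K_def using sub by auto
    show "\<phi> z = 0 \<and> Px z = 0 \<and> Pt z = 0" if "z \<in> D" "z \<notin> K" for z
    proof -
      have nk: "\<not> (\<delta> (fst z) > 0 \<and> y z < 1)" using in_K[OF that(1)] that(2) by blast
      then have "\<phi> z = 0" using step0 by (auto simp: \<phi>_def)
      moreover have "Px z = 0 \<and> Pt z = 0" using active[of z] nk by blast
      ultimately show ?thesis by simp
    qed
    have fs: "fst \<in> borel_measurable (borel::('a \<times> real) measure)" "snd \<in> borel_measurable (borel::('a \<times> real) measure)"
      by (intro borel_measurable_continuous_onI continuous_intros)+
    have "\<delta> \<in> borel_measurable borel" using \<delta>c by (rule borel_measurable_continuous_onI)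
    note [measurable] = measurable_compose[OF fs(1) this] fs(2) measurable_compose[OF fs(1) \<delta>(4)]
    have [measurable]: "gg \<in> borel_measurable borel" unfolding gg_def[abs_def] by measurable
    have [measurable]: "y \<in> borel_measurable borel" unfolding y_def[abs_def] by measurable
    show \<phi>m [measurable]: "\<phi> \<in> borel_measurable borel" unfolding \<phi>_def[abs_def] by measurable
    have [measurable]: "c \<in> borel_measurable borel" unfolding c_def[abs_def] by measurable
    show "Px \<in> borel_measurable borel" unfolding Px_def[abs_def] by measurable
    show "Pt \<in> borel_measurable borel" unfolding Pt_def[abs_def] by measurable
    show "\<phi> z = 1" if zD: "z \<in> D" and zE: "z \<in> E_set \<Omega> \<theta>1 \<theta>2 ((1/2) ^ (n - 1))" for z
    proof -
      have x: "fst z \<in> \<Omega>" using zE by (auto simp: E_set_def)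
      have gz: "g z \<le> 2 powr (real (n - 1) * \<theta>2)" using Emem[OF x zD] zE by blast
      have ne: "- \<Omega> \<noteq> {}" using \<Omega>(2) not_bounded_UNIV by (metis Compl_eq_Diff_UNIV Diff_eq_empty_iff top.extremum_uniqueI)
      have d0: "?d (fst z) > 0" using infdist_pos_not_in_closed[of "- \<Omega>" "fst z"] \<Omega>(1) ne x by auto
      have "(1/2) ^ (n - 1) \<le> ?d (fst z)"
      proof (rule ccontr)
        assume "\<not> ?thesis"
        then have "((1/2) ^ (n - 1)) powr - \<theta>2 < ?d (fst z) powr - \<theta>2"
          using d0 \<theta> by (intro powr_less_mono2_neg) auto
        also have "\<dots> \<le> g z" by (simp add: g_def)
        finally show False using gz half_powr[of "n - 1" \<theta>2] by linarith
      qed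
      moreover have "2 * \<tau> \<le> (1/2) ^ (n - 1)" unfolding \<tau>2[symmetric] using n by (intro power_decreasing) auto
      ultimately have dd: "?d (fst z) \<le> 2 * \<delta> (fst z)" using \<delta>(3)[of "fst z"] by linarith
      then have \<delta>0: "\<delta> (fst z) > 0" using d0 by linarith
      have "gg z \<le> 2 powr \<theta>2 * 2 powr (real (n - 1) * \<theta>2)" using ggg[OF d0 dd] gz by (smt (verit) mult_left_mono powr_ge_zero)
      also have "\<dots> = 2 powr (real n * \<theta>2)" using n by (simp add: powr_add[symmetric] algebra_simps of_nat_diff)
      finally have "y z \<le> 0" using y_iff(2)[OF \<delta>0] by linarith
      then show ?thesis using \<delta>0 by (simp add: \<phi>_def smoothstep_def)
    qed
    show "\<exists>k\<in>{n-1..2*n}. z \<in> annulus \<Omega> \<theta>1 \<theta>2 k \<and> \<phi> z > 0 \<and>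
      norm (Px z) \<le> real s * \<phi> z ^ (s - 1) * (?c0 * 2 powr (- real k * \<theta>2) * bdist \<Omega> (fst z) powr (- \<theta>2 - 1)) \<and>
      \<bar>Pt z\<bar> \<le> real s * \<phi> z ^ (s - 1) * (?c0 * 2 powr (- real k * \<theta>2) * snd z powr (\<theta>1 - 1))"
      if "z \<in> D" "Px z \<noteq> 0 \<or> Pt z \<noteq> 0" for z
      using annulus[OF that] by blast
  qed (use der bound \<phi>01 in auto)
qed

section \<open>Integrals over dyadic annuli\<close>

lemma le_sum_if_square_eq_mult:
  fixes X Y Z :: real
  assumes "Z * Z = X * Y" "0 \<le> X" "0 \<le> Y"
  shows "Z \<le> X + Y"
proof (rule power2_le_imp_le)
  have "(X + Y)\<^sup>2 = Z\<^sup>2 + (X * X + Y * Y + X * Y)" using assms(1) by (simp add: power2_eq_square algebra_simps)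
  then show "Z\<^sup>2 \<le> (X + Y)\<^sup>2" using assms by simp
qed (use assms in simp)

text \<open>The integrability conditions concern exponents on both sides of the critical one. The critical
  integrand is the geometric mean of two such integrands.\<close>

lemma geometric_mean_le_sum:
  fixes A v e \<epsilon> :: real
  shows "A powr e * v powr (1 - e) \<le> A powr (e + \<epsilon>) * v powr (1 - (e + \<epsilon>)) + A powr (e - \<epsilon>) * v powr (1 - (e - \<epsilon>))"
proof (rule le_sum_if_square_eq_mult)
  have "(A powr e * v powr (1 - e)) * (A powr e * v powr (1 - e)) = A powr (e + e) * v powr ((1 - e) + (1 - e))"
    by (simp only: powr_add mult_ac)
  also have "\<dots> = A powr ((e + \<epsilon>) + (e - \<epsilon>)) * v powr ((1 - (e + \<epsilon>)) + (1 - (e - \<epsilon>)))"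
    by (simp add: algebra_simps)
  also have "\<dots> = (A powr (e + \<epsilon>) * v powr (1 - (e + \<epsilon>))) * (A powr (e - \<epsilon>) * v powr (1 - (e - \<epsilon>)))"
    by (simp only: powr_add mult_ac)
  finally show "(A powr e * v powr (1 - e)) * (A powr e * v powr (1 - e)) = \<dots>" .
qed auto

lemma nat_powr_inverse_le_exp: "n \<ge> 1 \<Longrightarrow> B \<ge> 0 \<Longrightarrow> real n powr (B / real n) \<le> exp B"
proof -
  assume n: "n \<ge> 1" and B: "B \<ge> 0"
  have "ln (real n) \<le> real n" using n ln_le_minus_one[of "real n"] by linarith
  then have "B * (ln (real n) / real n) \<le> B * 1" using n B by (intro mult_left_mono) auto
  then show ?thesis using n by (simp add: powr_def mult.commute)
qed

text \<open>The balance of powers of \<open>n\<close> at the critical exponent. On the annulus \<open>k\<close>, with \<open>k\<close> of order \<open>n\<close>, the factor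
  \<open>2 powr (- k \<theta> e)\<close> cancels \<open>\<delta> powr (- \<theta> Q0)\<close>, the factor \<open>(1 / n) powr e\<close> meets \<open>|log \<delta>| powr (Q0 - 1)\<close>, which
  is of order \<open>n powr (Q0 - 1)\<close>, and \<open>1 / n\<close> remains. Deviations of order \<open>1 / n\<close> from the critical exponent
  change the result by bounded factors only.\<close>

lemma annulus_integral_bound:
  fixes \<Omega> :: "'a::euclidean_space set" and m V :: "'a \<times> real \<Rightarrow> real"
  assumes hyp: "\<And>\<delta> e. 0 < \<delta> \<Longrightarrow> \<delta> < \<delta>0 \<Longrightarrow> e \<noteq> Q0 \<Longrightarrow> \<bar>e - Q0\<bar> < \<epsilon>0 \<Longrightarrow>
      (\<integral>\<^sup>+z\<in>E_set \<Omega> \<theta>1 \<theta>2 (\<delta> / 2) - E_set \<Omega> \<theta>1 \<theta>2 \<delta>. ennreal (m z powr e * V z powr (1 - e)) \<partial>lebesgue)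
        \<le> ennreal (C * \<delta> powr (- (\<theta> * Q0) - C0 * \<bar>e - Q0\<bar>) * \<bar>ln \<delta>\<bar> powr (Q0 - 1))"
    and meas: "\<And>e k. (\<lambda>z. ennreal (m z powr e * V z powr (1 - e)) * indicator (annulus \<Omega> \<theta>1 \<theta>2 k) z) \<in> borel_measurable lebesgue"
    and m0: "\<And>z. m z \<ge> 0"
    and c: "\<delta>0 > 0" "\<epsilon>0 > 0" "C > 0" "C0 \<ge> 0" "\<theta> \<ge> 0" "Q0 \<ge> 1" "B \<ge> 1"
  obtains K N where "K \<ge> 0" "\<And>n k e. n \<ge> N \<Longrightarrow> k \<in> {n-1..2*n} \<Longrightarrow> \<bar>e - Q0\<bar> \<le> B / real n \<Longrightarrow>
    (\<integral>\<^sup>+z. ennreal ((1 / real n * 2 powr (- real k * \<theta>) * m z) powr e * V z powr (1 - e)) * indicator (annulus \<Omega> \<theta>1 \<theta>2 k) z \<partial>lebesgue)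
    \<le> ennreal (K / real n)"
proof -
  define K where "K = C * exp B * 2 powr (2 * \<theta> * B + 2 * C0 * B) * 2 powr (Q0 - 1)"
  have K: "K > 0" using c by (simp add: K_def)
  have "(\<lambda>n. (1/2::real) ^ (n - 1)) \<longlonglongrightarrow> 0"
    using LIMSEQ_realpow_zero[of "1/2::real"] by (subst filterlim_sequentially_Suc[symmetric]) simp
  then have "\<forall>\<^sub>F n in sequentially. (1/2::real) ^ (n - 1) < \<delta>0" using c(1) by (rule order_tendstoD)
  moreover have "\<forall>\<^sub>F n in sequentially. B / real n < \<epsilon>0"
    using order_tendstoD(2)[OF lim_const_over_n[of B] c(2)] by simp
  ultimately have "\<forall>\<^sub>F n in sequentially. (1/2::real) ^ (n - 1) < \<delta>0 \<and> B / real n < \<epsilon>0 \<and> n \<ge> 2"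
    using eventually_ge_at_top[of 2] by eventually_elim auto
  then obtain N where N: "\<And>n. n \<ge> N \<Longrightarrow> (1/2::real) ^ (n - 1) < \<delta>0 \<and> B / real n < \<epsilon>0 \<and> n \<ge> 2"
    by (auto simp: eventually_sequentially)
  have ne: "(\<integral>\<^sup>+z. ennreal ((1 / real n * 2 powr (- real k * \<theta>) * m z) powr e * V z powr (1 - e)) * indicator (annulus \<Omega> \<theta>1 \<theta>2 k) z \<partial>lebesgue)
    \<le> ennreal (K / real n)" if n: "n \<ge> N" and k: "k \<in> {n-1..2*n}" and e: "\<bar>e - Q0\<bar> \<le> B / real n" "e \<noteq> Q0" for n k e
  proof -
    note Nn = N[OF n]
    have n1: "real n \<ge> 1" using Nn by simp
    have k1: "real k \<ge> 1" "real k \<le> 2 * real n" using k Nn by auto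
    define a where "a = 1 / real n * 2 powr (- real k * \<theta>)"
    have a: "a \<ge> 0" by (simp add: a_def)
    have \<delta>: "(1/2::real) ^ k < \<delta>0"
    proof -
      have "(1/2::real) ^ k \<le> (1/2) ^ (n - 1)" using k by (intro power_decreasing) auto
      then show ?thesis using Nn by linarith
    qed
    have "(\<integral>\<^sup>+z. ennreal ((1 / real n * 2 powr (- real k * \<theta>) * m z) powr e * V z powr (1 - e)) * indicator (annulus \<Omega> \<theta>1 \<theta>2 k) z \<partial>lebesgue)
      = (\<integral>\<^sup>+z. ennreal (a powr e) * (ennreal (m z powr e * V z powr (1 - e)) * indicator (annulus \<Omega> \<theta>1 \<theta>2 k) z) \<partial>lebesgue)"
    proof (rule nn_integral_cong)
      fix z
      show "ennreal ((1 / real n * 2 powr (- real k * \<theta>) * m z) powr e * V z powr (1 - e)) * indicator (annulus \<Omega> \<theta>1 \<theta>2 k) z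
        = ennreal (a powr e) * (ennreal (m z powr e * V z powr (1 - e)) * indicator (annulus \<Omega> \<theta>1 \<theta>2 k) z)"
        unfolding a_def[symmetric] powr_mult mult.assoc[of "a powr e"]
        by (simp add: ennreal_mult mult.assoc)
    qed
    also have "\<dots> = ennreal (a powr e) * (\<integral>\<^sup>+z. ennreal (m z powr e * V z powr (1 - e)) * indicator (annulus \<Omega> \<theta>1 \<theta>2 k) z \<partial>lebesgue)"
      by (rule nn_integral_cmult[OF meas])
    also have "\<dots> \<le> ennreal (a powr e) * ennreal (C * ((1/2) ^ k) powr (- (\<theta> * Q0) - C0 * \<bar>e - Q0\<bar>) * \<bar>ln ((1/2) ^ k)\<bar> powr (Q0 - 1))"
      using e Nn \<delta> by (intro mult_left_mono hyp) auto
    also have "\<dots> = ennreal (a powr e * (C * ((1/2) ^ k) powr (- (\<theta> * Q0) - C0 * \<bar>e - Q0\<bar>) * \<bar>ln ((1/2) ^ k)\<bar> powr (Q0 - 1)))"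
      using c by (intro ennreal_mult[symmetric]) auto
    also have "\<dots> \<le> ennreal (K / real n)"
    proof (rule ennreal_leI)
      \<comment> \<open>Replacing \<open>e\<close> by \<open>Q0\<close> costs only constants, since \<open>\<bar>e - Q0\<bar>\<close> is of order \<open>1 / n\<close> while the bases are
    at least \<open>2 powr (- 2 * n)\<close> and \<open>1 / n\<close>.\<close>
      have b1: "a powr e \<le> real n powr (- Q0) * exp B * (2 powr (- real k * \<theta> * Q0) * 2 powr (2 * \<theta> * B))"
      proof -
        have "a powr e = real n powr (- e) * 2 powr (- real k * \<theta> * e)"
        proof -
          have "(1 / real n) powr e = real n powr (- e)" using n1 by (simp add: powr_divide powr_minus_divide)
          then show ?thesis by (simp only: a_def powr_mult powr_powr)
        qed
        also have "\<dots> \<le> (real n powr (- Q0) * exp B) * (2 powr (- real k * \<theta> * Q0) * 2 powr (2 * \<theta> * B))"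
        proof (intro mult_mono)
          have "real n powr (- e) \<le> real n powr (- Q0 + B / real n)" using e n1 by (intro powr_mono) auto
          also have "\<dots> = real n powr (- Q0) * real n powr (B / real n)" by (rule powr_add)
          also have "\<dots> \<le> real n powr (- Q0) * exp B"
            using nat_powr_inverse_le_exp[of n B] Nn c by (intro mult_left_mono) auto
          finally show "real n powr (- e) \<le> real n powr (- Q0) * exp B" .
          have "(real k * \<theta>) * (Q0 - e) \<le> (real k * \<theta>) * \<bar>e - Q0\<bar>"
            using k1 c by (intro mult_left_mono) auto
          also have "\<dots> \<le> (2 * real n * \<theta>) * (B / real n)"
            using k1 e c by (intro mult_mono) auto
          also have "\<dots> = 2 * \<theta> * B" using n1 by simp
          finally have "2 powr (- real k * \<theta> * e) \<le> 2 powr (- real k * \<theta> * Q0 + 2 * \<theta> * B)"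
            by (intro powr_mono) (auto simp: algebra_simps)
          also have "\<dots> = 2 powr (- real k * \<theta> * Q0) * 2 powr (2 * \<theta> * B)" by (rule powr_add)
          finally show "2 powr (- real k * \<theta> * e) \<le> 2 powr (- real k * \<theta> * Q0) * 2 powr (2 * \<theta> * B)" .
        qed auto
        finally show ?thesis .
      qed
      have b2: "((1/2) ^ k) powr (- (\<theta> * Q0) - C0 * \<bar>e - Q0\<bar>) \<le> 2 powr (real k * \<theta> * Q0) * 2 powr (2 * C0 * B)"
      proof -
        have "((1/2) ^ k) powr (- (\<theta> * Q0) - C0 * \<bar>e - Q0\<bar>) = 2 powr (real k * (\<theta> * Q0 + C0 * \<bar>e - Q0\<bar>))"
          using half_powr[of k "\<theta> * Q0 + C0 * \<bar>e - Q0\<bar>"] by simp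
        also have "real k * (C0 * \<bar>e - Q0\<bar>) \<le> (2 * real n) * (C0 * (B / real n))"
          using k1 e c by (intro mult_mono) auto
        then have "2 powr (real k * (\<theta> * Q0 + C0 * \<bar>e - Q0\<bar>)) \<le> 2 powr (real k * \<theta> * Q0 + 2 * C0 * B)"
          using n1 by (intro powr_mono) (auto simp: algebra_simps)
        also have "\<dots> = 2 powr (real k * \<theta> * Q0) * 2 powr (2 * C0 * B)" by (rule powr_add)
        finally show ?thesis .
      qed
      have b3: "\<bar>ln ((1/2) ^ k)\<bar> powr (Q0 - 1) \<le> 2 powr (Q0 - 1) * real n powr (Q0 - 1)"
      proof -
        have "ln ((1/2::real) ^ k) = - (real k * ln 2)" by (simp add: ln_realpow ln_div)
        then have "\<bar>ln ((1/2::real) ^ k)\<bar> \<le> 2 * real n"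
          using k1 ln_2_less_1 mult_mono[of "real k" "2 * real n" "ln 2" 1] by (simp add: abs_mult)
        then have "\<bar>ln ((1/2::real) ^ k)\<bar> powr (Q0 - 1) \<le> (2 * real n) powr (Q0 - 1)"
          using c by (intro powr_mono2) auto
        then show ?thesis using n1 by (simp add: powr_mult)
      qed
      have "a powr e * (C * ((1/2) ^ k) powr (- (\<theta> * Q0) - C0 * \<bar>e - Q0\<bar>) * \<bar>ln ((1/2) ^ k)\<bar> powr (Q0 - 1))
        \<le> (real n powr (- Q0) * exp B * (2 powr (- real k * \<theta> * Q0) * 2 powr (2 * \<theta> * B)))
          * (C * (2 powr (real k * \<theta> * Q0) * 2 powr (2 * C0 * B)) * (2 powr (Q0 - 1) * real n powr (Q0 - 1)))"
        using b1 b2 b3 c by (intro mult_mono mult_left_mono) auto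
      also have "\<dots> = (C * exp B * (2 powr (2 * \<theta> * B) * 2 powr (2 * C0 * B)) * 2 powr (Q0 - 1))
         * ((real n powr (- Q0) * real n powr (Q0 - 1)) * (2 powr (- real k * \<theta> * Q0) * 2 powr (real k * \<theta> * Q0)))"
        by (simp only: mult_ac)
      also have "\<dots> = K / real n"
        unfolding powr_add[symmetric] K_def using n1 by (simp add: powr_minus divide_inverse)
      finally show "a powr e * (C * ((1/2) ^ k) powr (- (\<theta> * Q0) - C0 * \<bar>e - Q0\<bar>) * \<bar>ln ((1/2) ^ k)\<bar> powr (Q0 - 1)) \<le> K / real n" .
    qed
    finally show ?thesis .
  qed
  show thesis
  proof (rule that[of "2 * K" N])
    show "2 * K \<ge> 0" using K by simp
    fix n k e assume n: "n \<ge> N" and k: "k \<in> {n-1..2*n}" and e: "\<bar>e - Q0\<bar> \<le> B / real n"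
    have n0: "real n > 0" using N[OF n] by simp
    let ?F = "\<lambda>e z. ennreal ((1 / real n * 2 powr (- real k * \<theta>) * m z) powr e * V z powr (1 - e)) * indicator (annulus \<Omega> \<theta>1 \<theta>2 k) z"
    show "(\<integral>\<^sup>+z. ?F e z \<partial>lebesgue) \<le> ennreal (2 * K / real n)"
    proof (cases "e = Q0")
      case False
      have "(\<integral>\<^sup>+z. ?F e z \<partial>lebesgue) \<le> ennreal (K / real n)" by (rule ne[OF n k e False])
      also have "\<dots> \<le> ennreal (2 * K / real n)" using K n0 by (intro ennreal_leI divide_right_mono) auto
      finally show ?thesis .
    next
      case True
      let ?\<epsilon> = "1 / real n"
      have meas': "?F e' \<in> borel_measurable lebesgue" for e'
      proof -
        let ?a = "1 / real n * 2 powr (- real k * \<theta>)"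
        have "?F e' = (\<lambda>z. ennreal (?a powr e') * (ennreal (m z powr e' * V z powr (1 - e')) * indicator (annulus \<Omega> \<theta>1 \<theta>2 k) z))"
        proof
          fix z
          have "?a \<ge> 0" by simp
          then show "?F e' z = ennreal (?a powr e') * (ennreal (m z powr e' * V z powr (1 - e')) * indicator (annulus \<Omega> \<theta>1 \<theta>2 k) z)"
            by (simp only: powr_mult mult.assoc ennreal_mult powr_ge_zero mult_nonneg_nonneg)
        qed
        then show ?thesis by (simp only:) (intro borel_measurable_times_ennreal borel_measurable_const meas)
      qed
      have "(\<integral>\<^sup>+z. ?F e z \<partial>lebesgue) \<le> (\<integral>\<^sup>+z. ?F (e + ?\<epsilon>) z + ?F (e - ?\<epsilon>) z \<partial>lebesgue)"
      proof (rule nn_integral_mono)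
        fix z
        show "?F e z \<le> ?F (e + ?\<epsilon>) z + ?F (e - ?\<epsilon>) z"
          unfolding distrib_right[symmetric]
          using geometric_mean_le_sum[of "1 / real n * 2 powr (- real k * \<theta>) * m z" e "V z" ?\<epsilon>]
          by (intro mult_right_mono) (simp_all add: ennreal_plus[symmetric] ennreal_leI del: ennreal_plus)
      qed
      also have "\<dots> = (\<integral>\<^sup>+z. ?F (e + ?\<epsilon>) z \<partial>lebesgue) + (\<integral>\<^sup>+z. ?F (e - ?\<epsilon>) z \<partial>lebesgue)"
        by (rule nn_integral_add) (rule meas')+
      also have "\<dots> \<le> ennreal (K / real n) + ennreal (K / real n)"
        using True n0 c by (intro add_mono ne[OF n k]) (auto simp: divide_right_mono)
      also have "\<dots> = ennreal (2 * K / real n)" using K n0 by (simp add: ennreal_plus[symmetric] del: ennreal_plus)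
      finally show ?thesis .
    qed
  qed
qed

lemma annuli_integral_bound:
  fixes F :: "nat \<Rightarrow> 'a::euclidean_space \<times> real \<Rightarrow> ennreal"
  assumes n: "n \<ge> 2" and K: "K \<ge> 0"
    and meas: "\<And>k. k \<in> {n-1..2*n} \<Longrightarrow> (\<lambda>z. F k z * indicator (annulus \<Omega> \<theta>1 \<theta>2 k) z) \<in> borel_measurable lebesgue"
    and F: "\<And>k. k \<in> {n-1..2*n} \<Longrightarrow> (\<integral>\<^sup>+z. F k z * indicator (annulus \<Omega> \<theta>1 \<theta>2 k) z \<partial>lebesgue) \<le> ennreal (K / real n)"
  shows "(\<integral>\<^sup>+z. (\<Sum>k\<in>{n-1..2*n}. F k z * indicator (annulus \<Omega> \<theta>1 \<theta>2 k) z) \<partial>lebesgue) \<le> ennreal (2 * K)"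
proof -
  have "(\<integral>\<^sup>+z. (\<Sum>k\<in>{n-1..2*n}. F k z * indicator (annulus \<Omega> \<theta>1 \<theta>2 k) z) \<partial>lebesgue)
    = (\<Sum>k\<in>{n-1..2*n}. \<integral>\<^sup>+z. F k z * indicator (annulus \<Omega> \<theta>1 \<theta>2 k) z \<partial>lebesgue)"
    by (rule nn_integral_sum) (rule meas)
  also have "\<dots> \<le> (\<Sum>k\<in>{n-1..2*n}. ennreal (K / real n))" by (rule sum_mono) (rule F)
  also have "\<dots> = ennreal (real (n + 2) * (K / real n))"
    using n K by (subst sum_ennreal) (auto simp: of_nat_diff algebra_simps)
  also have "\<dots> \<le> ennreal (2 * K)"
  proof (rule ennreal_leI)
    have "real (n + 2) * (K / real n) \<le> (2 * real n) * (K / real n)" using n K by (intro mult_right_mono) auto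
    then show "real (n + 2) * (K / real n) \<le> 2 * K" using n by simp
  qed
  finally show ?thesis .
qed

section \<open>The estimate on one annulus\<close>

lemma powr_le_powr_1_plus: "0 \<le> x \<Longrightarrow> 0 \<le> e \<Longrightarrow> e \<le> E \<Longrightarrow> x powr e \<le> (1 + x) powr E" for x :: real
  by (rule order_trans[OF powr_mono2[of e x "1 + x"] powr_mono]) auto

lemma powr_between: "0 < x \<Longrightarrow> b \<le> a \<Longrightarrow> a \<le> c \<Longrightarrow> x powr a \<le> x powr c + x powr b" for x :: real
proof (cases "x \<ge> 1")
  case True
  assume "a \<le> c"
  then have "x powr a \<le> x powr c" using True by (intro powr_mono) auto
  then show ?thesis by (simp add: add_increasing2)
next
  case False
  assume "0 < x" "b \<le> a"
  then have "x powr a \<le> x powr b" using False by (intro powr_mono') auto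
  then show ?thesis by (simp add: add_increasing)
qed

text \<open>The two pairs of integrability conditions in a common form: with \<open>e\<close> for the perturbed critical
  exponent, each integrand is \<open>m powr e * V powr (1 - e)\<close> for a fixed weight \<open>m\<close>.\<close>

locale weighted_problem =
  fixes p q \<theta>1 \<theta>2 C C0 \<delta>0 \<epsilon>0 :: real and \<Omega> :: "'a::euclidean_space set"
    and V u :: "'a \<times> real \<Rightarrow> real" and u0 :: "'a \<Rightarrow> real" and G :: "'a \<times> real \<Rightarrow> 'a \<times> real"
  assumes p: "p > 1" and q: "q > p - 1" "q > 1"
    and \<theta>: "\<theta>1 \<ge> 1" "\<theta>2 \<ge> 1" and c: "C > 0" "C0 \<ge> 0" "\<delta>0 > 0" "\<epsilon>0 > 0"
    and \<Omega>: "open \<Omega>" "bounded \<Omega>"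
    and V_loc: "Lp_loc 1 (\<lambda>_. 1) (\<Omega> \<times> {0..}) V"
    and V_pos: "AE z in lebesgue. z \<in> \<Omega> \<times> {0<..} \<longrightarrow> V z > 0"
    and sol: "weak_solution_grad p q \<Omega> V u0 u G"
    and hyp1: "\<And>\<delta> e. 0 < \<delta> \<Longrightarrow> \<delta> < \<delta>0 \<Longrightarrow> e \<noteq> q / (q - 1) \<Longrightarrow> \<bar>e - q / (q - 1)\<bar> < \<epsilon>0 \<Longrightarrow>
      (\<integral>\<^sup>+z\<in>E_set \<Omega> \<theta>1 \<theta>2 (\<delta> / 2) - E_set \<Omega> \<theta>1 \<theta>2 \<delta>. ennreal ((snd z powr (\<theta>1 - 1)) powr e * V z powr (1 - e)) \<partial>lebesgue)
        \<le> ennreal (C * \<delta> powr (- (\<theta>2 * (q / (q - 1))) - C0 * \<bar>e - q / (q - 1)\<bar>) * \<bar>ln \<delta>\<bar> powr (q / (q - 1) - 1))"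
    and hyp2: "\<And>\<delta> e. 0 < \<delta> \<Longrightarrow> \<delta> < \<delta>0 \<Longrightarrow> e \<noteq> q / (q - p + 1) \<Longrightarrow> \<bar>e - q / (q - p + 1)\<bar> < \<epsilon>0 \<Longrightarrow>
      (\<integral>\<^sup>+z\<in>E_set \<Omega> \<theta>1 \<theta>2 (\<delta> / 2) - E_set \<Omega> \<theta>1 \<theta>2 \<delta>. ennreal ((bdist \<Omega> (fst z) powr (- (\<theta>2 + 1) * p)) powr e * V z powr (1 - e)) \<partial>lebesgue)
        \<le> ennreal (C * \<delta> powr (- (p * \<theta>2 * (q / (q - p + 1))) - C0 * \<bar>e - q / (q - p + 1)\<bar>) * \<bar>ln \<delta>\<bar> powr (q / (q - p + 1) - 1))"
begin

abbreviation S where "S \<equiv> \<Omega> \<times> {0::real..}"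
abbreviation "D \<equiv> {z::'a \<times> real. snd z > 0}"
abbreviation "R \<equiv> annulus \<Omega> \<theta>1 \<theta>2"

text \<open>The critical exponents, and on the annulus \<open>k\<close> the bounds, up to constants, for \<open>|\<partial>\<^sub>t \<phi>|\<close> (\<open>time_weight\<close>)
  and for \<open>|\<nabla>\<phi>|\<^sup>p \<gamma>\<^sup>1\<^sup>-\<^sup>p\<close> with \<open>\<gamma> = 1 / n\<close> (\<open>space_weight\<close>). The choice \<open>\<gamma> = 1 / n\<close> makes the powers of \<open>n\<close> in the
  latter collapse to \<open>1 / n\<close>.\<close>

definition "Q1 = q / (q - 1)"
definition "Q2 = q / (q - p + 1)"
definition "time_factor z = snd z powr (\<theta>1 - 1)" for z :: "'a \<times> real"
definition "space_factor z = bdist \<Omega> (fst z) powr (- (\<theta>2 + 1) * p)" for z :: "'a \<times> real"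
definition "space_weight n k z = 1 / real n * 2 powr (- real k * (p * \<theta>2)) * space_factor z" for n k :: nat
definition "time_weight n k z = 1 / real n * 2 powr (- real k * \<theta>2) * time_factor z" for n k :: nat
definition "mass z = V z * u z powr q"
definition "f z = ennreal (mass z) * indicator (S \<inter> D) z"

text \<open>Large enough for the powers of the cutoff that Young's inequality requires, for all small \<open>\<gamma>\<close>. The
  constants \<open>c1\<close>, \<open>c2\<close>, \<open>c3\<close> collect the factors from the derivatives of the cutoff.\<close>

definition "cutoff_power = nat \<lceil>2 * p * q / (q - p + 1) + q / (q - 1) + 2\<rceil>"
definition "c1 = \<theta>1 * 4 powr (\<theta>2 + 2)"
definition "c2 = (real cutoff_power * c1) powr p * 2 powr (p - 1)"
definition "c3 = real cutoff_power * c1"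

lemma Q_gt: "Q1 > 1" "Q2 > 1" using p q by (auto simp: Q1_def Q2_def divide_simps)

lemma S_borel: "S \<in> sets borel" by (rule cylinder_borel[OF \<Omega>(1)])

lemma proj_borel: "fst \<in> borel_measurable (borel::('a \<times> real) measure)" "snd \<in> borel_measurable (borel::('a \<times> real) measure)"
  by (intro borel_measurable_continuous_onI continuous_intros)+

lemma bdist_borel: "(\<lambda>z::'a \<times> real. bdist \<Omega> (fst z)) \<in> borel_measurable borel"
  unfolding bdist_def by (intro borel_measurable_continuous_onI continuous_intros)

lemma E_set_borel: "E_set \<Omega> \<theta>1 \<theta>2 \<delta> \<in> sets borel"
proof -
  note [measurable] = bdist_borel proj_borel
  have [measurable]: "S \<in> sets borel" by (rule S_borel)
  have "{z::'a \<times> real. bdist \<Omega> (fst z) powr - \<theta>2 + snd z powr \<theta>1 \<le> \<delta> powr - \<theta>2} \<in> sets borel"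
    by measurable
  moreover have "E_set \<Omega> \<theta>1 \<theta>2 \<delta> = S \<inter> {z. bdist \<Omega> (fst z) powr - \<theta>2 + snd z powr \<theta>1 \<le> \<delta> powr - \<theta>2}"
    by (auto simp: E_set_def)
  ultimately show ?thesis by simp
qed

lemma annulus_borel: "R k \<in> sets borel" using E_set_borel by auto

lemma annulus_subset_S: "R k \<subseteq> S" by (auto simp: E_set_def)

lemma borel_lebesgue: "g \<in> borel_measurable borel \<Longrightarrow> g \<in> borel_measurable lebesgue" for g :: "'b::euclidean_space \<Rightarrow> 'c::topological_space"
  by (intro measurable_completion) simp

lemma local_meas: "(\<lambda>z. indicator S z *\<^sub>R V z) \<in> borel_measurable lebesgue"
  "(\<lambda>z. indicator S z *\<^sub>R u z) \<in> borel_measurable lebesgue"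
proof -
  have "V \<in> borel_measurable (lebesgue_on S)" "u \<in> borel_measurable (lebesgue_on S)"
    using V_loc sol unfolding weak_solution_grad_def Lp_loc_def by auto
  then show "(\<lambda>z. indicator S z *\<^sub>R V z) \<in> borel_measurable lebesgue" "(\<lambda>z. indicator S z *\<^sub>R u z) \<in> borel_measurable lebesgue"
    using borel_measurable_restrict_space_iff[of S lebesgue V] borel_measurable_restrict_space_iff[of S lebesgue u] S_borel by simp_all
qed

lemma weight_meas:
  assumes [measurable]: "m \<in> borel_measurable borel"
  shows "(\<lambda>z. ennreal (m z powr e * V z powr e') * indicator (R k) z) \<in> borel_measurable lebesgue"
proof -
  note [measurable] = local_meas borel_lebesgue[OF assms]
  have [measurable]: "R k \<in> sets lebesgue" using annulus_borel by (simp add: sets_completionI_sets)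
  have "(\<lambda>z. ennreal (m z powr e * (indicator S z *\<^sub>R V z) powr e') * indicator (R k) z) \<in> borel_measurable lebesgue"
    by measurable
  moreover have "(\<lambda>z. ennreal (m z powr e * (indicator S z *\<^sub>R V z) powr e') * indicator (R k) z)
      = (\<lambda>z. ennreal (m z powr e * V z powr e') * indicator (R k) z)"
    using annulus_subset_S[of k] by (auto simp: fun_eq_iff indicator_def)
  ultimately show ?thesis by simp
qed

lemma factor_borel: "time_factor \<in> borel_measurable borel" "space_factor \<in> borel_measurable borel"
proof -
  note [measurable] = bdist_borel proj_borel(2)
  show "time_factor \<in> borel_measurable borel" "space_factor \<in> borel_measurable borel"
    unfolding time_factor_def[abs_def] space_factor_def[abs_def] by measurable
qed

lemma weight_borel: "space_weight n k \<in> borel_measurable borel" "time_weight n k \<in> borel_measurable borel"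
proof -
  note [measurable] = factor_borel
  show "space_weight n k \<in> borel_measurable borel" "time_weight n k \<in> borel_measurable borel"
    unfolding space_weight_def[abs_def] time_weight_def[abs_def] by measurable
qed

lemma f_meas: "f \<in> borel_measurable lebesgue"
proof -
  note [measurable] = local_meas
  have [measurable]: "S \<inter> D \<in> sets lebesgue"
  proof -
    have "open D" by (intro open_Collect_less continuous_intros)
    then show ?thesis using S_borel by (intro sets_completionI_sets) auto
  qed
  have "(\<lambda>z. ennreal ((indicator S z *\<^sub>R V z) * (indicator S z *\<^sub>R u z) powr q) * indicator (S \<inter> D) z) \<in> borel_measurable lebesgue"
    by measurable
  moreover have "(\<lambda>z. ennreal ((indicator S z *\<^sub>R V z) * (indicator S z *\<^sub>R u z) powr q) * indicator (S \<inter> D) z) = f"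
    by (auto simp: fun_eq_iff f_def mass_def indicator_def)
  ultimately show ?thesis by simp
qed

lemma cutoff_power_bounds: "real cutoff_power \<ge> 2 * p * q / (q - p + 1) + q / (q - 1) + 2" "cutoff_power \<ge> 2" "real cutoff_power \<ge> p"
proof -
  show 1: "real cutoff_power \<ge> 2 * p * q / (q - p + 1) + q / (q - 1) + 2" unfolding cutoff_power_def by linarith
  have a: "2 * p * q / (q - p + 1) \<ge> p" 
  proof -
    have "p * (q - p + 1) \<le> p * (2 * q)" using p q by (intro mult_left_mono) auto
    then show ?thesis using q by (simp add: pos_le_divide_eq mult_ac)
  qed
  have b: "q / (q - 1) \<ge> 0" using q by simp
  show "cutoff_power \<ge> 2" "real cutoff_power \<ge> p" using 1 a b p by linarith+
qed

lemma c_pos: "c1 > 0" "c2 > 0" "c3 > 0"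
  using \<theta> cutoff_power_bounds(2) by (auto simp: c1_def c2_def c3_def)

lemma weight_nonneg: "space_weight n k z \<ge> 0" "time_weight n k z \<ge> 0"
  by (simp_all add: space_weight_def time_weight_def time_factor_def space_factor_def)

text \<open>The contribution of the region \<open>u < \<eta>\<close>.\<close>

definition "remainder \<gamma> l \<eta> = (l * (2 * \<eta>) powr (p - 1 - \<gamma>) + l powr (1 - p) * (2 * \<eta>) powr ((1 + \<gamma>) * (p - 1)))
    + (\<eta> + 2 * l * (2 * \<eta>) powr (1 - \<gamma>))"

definition "\<kappa> = (1 + 2 powr (p - 1) * c2) powr Q2 * 4 powr Q2 + (1 + 4 powr (p - 1) * c2) powr (Q2 + 1)
    + (1 + 4 * c3) powr Q1 * 4 powr Q1 + (1 + c3) powr Q1"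
definition "m0 = (p - 1) * (Q2 + 1)"

text \<open>The exponents that Young's inequality produces; for \<open>\<gamma> = 0\<close> they are the critical ones.\<close>

definition "e1 \<gamma> = (q - \<gamma>) / (q - p + 1)"
definition "e2 \<gamma> = q / (q - (1 + \<gamma>) * (p - 1))"
definition "e3 \<gamma> = (q - \<gamma>) / (q - 1)"

text \<open>Smallness of \<open>\<gamma>\<close> that keeps \<open>e2 \<gamma>\<close> within distance one of its critical value.\<close>

definition "admissible \<gamma> \<longleftrightarrow> 0 < \<gamma> \<and> \<gamma> \<le> 1 / 2 \<and> \<gamma> < p - 1 \<and> \<gamma> * (p - 1) \<le> (q - p + 1) / 2 \<and>
    2 * q * (p - 1) / (q - p + 1)\<^sup>2 * \<gamma> \<le> 1"

lemma exponent_bounds: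
  assumes "admissible \<gamma>"
  shows "0 \<le> e1 \<gamma>" "e1 \<gamma> \<le> Q2" "\<bar>e1 \<gamma> - Q2\<bar> \<le> 1 / (q - p + 1) * \<gamma>"
    "Q2 \<le> e2 \<gamma>" "e2 \<gamma> \<le> Q2 + 1" "\<bar>e2 \<gamma> - Q2\<bar> \<le> 2 * q * (p - 1) / (q - p + 1)\<^sup>2 * \<gamma>"
    "0 \<le> e3 \<gamma>" "e3 \<gamma> \<le> Q1" "\<bar>e3 \<gamma> - Q1\<bar> \<le> 1 / (q - 1) * \<gamma>"
    "(1 + \<gamma>) * (p - 1) < q" "(1 + \<gamma>) * (p - 1) \<le> (q + p - 1) / 2"
proof -
  note a = assms[unfolded admissible_def]
  show m: "(1 + \<gamma>) * (p - 1) \<le> (q + p - 1) / 2" using a by (simp add: algebra_simps)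
  then show mq: "(1 + \<gamma>) * (p - 1) < q" using q by simp
  have E1: "e1 \<gamma> = Q2 - 1 / (q - p + 1) * \<gamma>" "e3 \<gamma> = Q1 - 1 / (q - 1) * \<gamma>"
    by (simp_all add: e1_def e3_def Q1_def Q2_def diff_divide_distrib)
  have pos: "0 \<le> 1 / (q - p + 1) * \<gamma>" "0 \<le> 1 / (q - 1) * \<gamma>" using a q by simp_all
  show "e1 \<gamma> \<le> Q2" "\<bar>e1 \<gamma> - Q2\<bar> \<le> 1 / (q - p + 1) * \<gamma>" "e3 \<gamma> \<le> Q1" "\<bar>e3 \<gamma> - Q1\<bar> \<le> 1 / (q - 1) * \<gamma>"
    unfolding E1 using pos by linarith+
  show "0 \<le> e1 \<gamma>" "0 \<le> e3 \<gamma>" using a q p by (auto simp: e1_def e3_def)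
  let ?d = "q - p + 1" and ?r = "q - (1 + \<gamma>) * (p - 1)"
  have r: "?r \<ge> ?d / 2" "?r > 0" "?d > 0" using m mq q by (simp_all add: field_simps)
  have diff: "e2 \<gamma> - Q2 = q * (\<gamma> * (p - 1)) / (?r * ?d)"
  proof -
    have "e2 \<gamma> - Q2 = (q * ?d - q * ?r) / (?r * ?d)"
      unfolding e2_def Q2_def using r by (simp only: diff_frac_eq)
    also have "q * ?d - q * ?r = q * (\<gamma> * (p - 1))" by (simp add: algebra_simps)
    finally show ?thesis .
  qed
  have ge: "0 \<le> q * (\<gamma> * (p - 1)) / (?r * ?d)" using r a p q by (intro divide_nonneg_pos) auto
  then show "Q2 \<le> e2 \<gamma>" using diff by linarith
  have "q * (\<gamma> * (p - 1)) / (?r * ?d) \<le> q * (\<gamma> * (p - 1)) / (?d / 2 * ?d)"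
    using r a p q by (intro divide_left_mono mult_right_mono mult_pos_pos) auto
  also have "\<dots> = 2 * q * (p - 1) / ?d\<^sup>2 * \<gamma>" by (simp add: power2_eq_square)
  finally have le: "q * (\<gamma> * (p - 1)) / (?r * ?d) \<le> 2 * q * (p - 1) / ?d\<^sup>2 * \<gamma>" .
  then show "\<bar>e2 \<gamma> - Q2\<bar> \<le> 2 * q * (p - 1) / ?d\<^sup>2 * \<gamma>" using diff ge by linarith
  show "e2 \<gamma> \<le> Q2 + 1" using diff le a by linarith
qed

definition "terms n k l \<mu> z = l * (space_weight n k z powr e1 (1 / real n) * V z powr (1 - e1 (1 / real n)))
    + l powr - m0 * (\<mu> powr (1 - Q2) + \<mu> powr (- Q2)) * (space_weight n k z powr e2 (1 / real n) * V z powr (1 - e2 (1 / real n)))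
    + l * (time_weight n k z powr e3 (1 / real n) * V z powr (1 - e3 (1 / real n)))
    + \<mu> powr (1 - Q1) * (time_weight n k z powr Q1 * V z powr (1 - Q1))" for n k :: nat

text \<open>The absorption estimate on one annulus, with the constants separated from the weights.\<close>

lemma pointwise_estimate:
  fixes \<phi> Pt l \<mu> \<eta> :: real and Px :: 'a and n k :: nat
  defines "\<gamma> \<equiv> 1 / real n"
  assumes n: "n \<ge> 1" and adm: "admissible \<gamma>" and l: "0 < l" "l \<le> 1" and \<mu>: "0 < \<mu>" and \<eta>: "0 < \<eta>"
    and v: "V z > 0" and u: "u z \<ge> 0" and \<phi>: "0 < \<phi>" "\<phi> \<le> 1"
    and Px: "norm Px \<le> real cutoff_power * \<phi> ^ (cutoff_power - 1) * (c1 / real n * 2 powr (- real k * \<theta>2) * bdist \<Omega> (fst z) powr (- \<theta>2 - 1))"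
    and Pt: "\<bar>Pt\<bar> \<le> real cutoff_power * \<phi> ^ (cutoff_power - 1) * (c1 / real n * 2 powr (- real k * \<theta>2) * snd z powr (\<theta>1 - 1))"
  shows "mass z * \<phi> ^ cutoff_power - (V z * u z powr q * damping l \<gamma> \<eta> (u z) * \<phi> ^ cutoff_power
      - (damping' l \<gamma> \<eta> (u z) * \<phi> ^ cutoff_power * norm (fst (G z)) powr p
        + damping l \<gamma> \<eta> (u z) * (norm (fst (G z)) powr (p - 2) * (fst (G z) \<bullet> Px))) + damping_primitive l \<gamma> \<eta> (u z) * Pt)
    \<le> 2 * \<mu> * (mass z * \<phi> ^ cutoff_power) + \<kappa> * terms n k l \<mu> z + (c2 * space_weight n k z + c3 * time_weight n k z) * remainder \<gamma> l \<eta>"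
proof -
  note a = adm[unfolded admissible_def]
  note ex = exponent_bounds[OF adm]
  have n1: "real n \<ge> 1" using n by simp
  have Rs: "\<phi> ^ cutoff_power = \<phi> powr real cutoff_power" "\<phi> ^ (cutoff_power - 1) = \<phi> powr (real cutoff_power - 1)"
    using \<phi> cutoff_power_bounds(2) by (simp_all add: powr_realpow[symmetric] of_nat_diff)
  define Z where "Z = c2 * space_weight n k z"
  define B where "B = c3 * time_weight n k z"
  define g where "g = norm (fst (G z))"
  define y where "y = u z + \<eta>"
  have Z0: "Z \<ge> 0" "B \<ge> 0" using c_pos weight_nonneg by (auto simp: Z_def B_def)
  have Zc: "norm Px powr p * (2 / \<gamma>) powr (p - 1) \<le> Z * \<phi> powr (p * (real cutoff_power - 1))"
  proof -
    let ?r = "2 powr (- real k * \<theta>2) * bdist \<Omega> (fst z) powr (- \<theta>2 - 1)"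
    have "norm Px powr p \<le> ((real cutoff_power * c1) * (1 / real n) * ?r * \<phi> powr (real cutoff_power - 1)) powr p"
      using Px p unfolding Rs by (intro powr_mono2) (auto simp: mult_ac)
    also have "\<dots> = (real cutoff_power * c1) powr p * (1 / real n) powr p * ?r powr p * \<phi> powr (p * (real cutoff_power - 1))"
      by (simp only: powr_mult powr_powr mult_ac)
    also have "?r powr p = 2 powr (- real k * (p * \<theta>2)) * space_factor z"
    proof -
      have "- real k * \<theta>2 * p = - real k * (p * \<theta>2)" "(- \<theta>2 - 1) * p = - (\<theta>2 + 1) * p"
        by (simp_all add: algebra_simps)
      then show ?thesis by (simp only: space_factor_def powr_mult powr_powr)
    qed
    finally have "norm Px powr p * (2 / \<gamma>) powr (p - 1)
      \<le> (real cutoff_power * c1) powr p * (1 / real n) powr p * (2 powr (- real k * (p * \<theta>2)) * space_factor z) * \<phi> powr (p * (real cutoff_power - 1)) * (2 / \<gamma>) powr (p - 1)"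
      by (intro mult_right_mono) auto
    also have g2: "(2 / \<gamma>) powr (p - 1) = 2 powr (p - 1) * (1 / real n) powr (- (p - 1))"
    proof -
      have "2 / \<gamma> = 2 * (1 / real n) powr (- 1)" using n1 by (simp add: \<gamma>_def powr_minus_divide)
      then show ?thesis by (simp only: powr_mult powr_powr) simp
    qed
    also have "(real cutoff_power * c1) powr p * (1 / real n) powr p * (2 powr (- real k * (p * \<theta>2)) * space_factor z) * \<phi> powr (p * (real cutoff_power - 1)) * (2 powr (p - 1) * (1 / real n) powr (- (p - 1)))
      = c2 * (((1 / real n) powr p * (1 / real n) powr (- (p - 1))) * 2 powr (- real k * (p * \<theta>2)) * space_factor z) * \<phi> powr (p * (real cutoff_power - 1))"
      by (simp only: c2_def mult_ac)
    also have "(1 / real n) powr p * (1 / real n) powr (- (p - 1)) = 1 / real n"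
      unfolding powr_add[symmetric] using n1 by simp
    finally show ?thesis unfolding g2 Z_def space_weight_def .
  qed
  have Bc: "\<bar>Pt\<bar> \<le> B * \<phi> powr (real cutoff_power - 1)"
    using Pt unfolding Rs by (simp add: B_def c3_def time_weight_def time_factor_def mult_ac)
  have s1: "real cutoff_power * ((1 + \<gamma>) * (p - 1)) / q \<le> real cutoff_power - p"
  proof -
    have "real cutoff_power * ((1 + \<gamma>) * (p - 1)) \<le> real cutoff_power * ((q + p - 1) / 2)" using ex by (intro mult_left_mono) auto
    moreover have "p * (2 * q) \<le> real cutoff_power * (q - p + 1)"
    proof -
      have "2 * p * q / (q - p + 1) \<le> real cutoff_power" using cutoff_power_bounds(1) q by (smt (verit) divide_nonneg_nonneg)
      then show ?thesis using q by (simp add: pos_divide_le_eq mult_ac)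
    qed
    ultimately have "real cutoff_power * ((1 + \<gamma>) * (p - 1)) \<le> (real cutoff_power - p) * q" by (simp add: algebra_simps)
    then show ?thesis using q by (simp add: pos_divide_le_eq)
  qed
  have s2: "real cutoff_power / q \<le> real cutoff_power - 1"
  proof -
    have "q / (q - 1) \<le> real cutoff_power"
    proof -
      have "0 \<le> 2 * p * q / (q - p + 1)" using p q by simp
      then show ?thesis using cutoff_power_bounds(1) by linarith
    qed
    then have "q \<le> real cutoff_power * (q - 1)" using q by (simp add: pos_divide_le_eq)
    then have "real cutoff_power \<le> (real cutoff_power - 1) * q" by (simp add: algebra_simps)
    then show ?thesis using q by (simp add: pos_divide_le_eq)
  qed
  have abs1: "(1 + l * y powr (- \<gamma>)) * (g powr (p - 1) * norm Px) + damping_primitive l \<gamma> \<eta> (u z) * \<bar>Pt\<bar>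
      - l * V z * u z powr q * y powr (- \<gamma>) * \<phi> powr real cutoff_power
      - l * \<gamma> * y powr (- \<gamma> - 1) * g powr p * \<phi> powr real cutoff_power
    \<le> 2 * \<mu> * V z * \<phi> powr real cutoff_power * u z powr q
      + l * ((2 powr (p - 1) * Z) powr e1 \<gamma> * (V z / 4) powr (1 - e1 \<gamma>))
      + (l powr (1 - p) * 4 powr (p - 1) * Z) powr e2 \<gamma> * (\<mu> * V z) powr (1 - e2 \<gamma>)
      + l * ((4 * B) powr e3 \<gamma> * (V z / 4) powr (1 - e3 \<gamma>))
      + B powr Q1 * (\<mu> * V z) powr (1 - Q1)
      + (Z * (l * (2 * \<eta>) powr (p - 1 - \<gamma>) + l powr (1 - p) * (2 * \<eta>) powr ((1 + \<gamma>) * (p - 1)))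
         + B * (\<eta> + 2 * l * (2 * \<eta>) powr (1 - \<gamma>)))"
    unfolding y_def
    by (rule energy_absorption_pointwise[OF p q _ _ _ _ refl ex(10) s1 s2 cutoff_power_bounds(3) l \<mu> \<eta> v u _ \<phi> norm_ge_zero Zc abs_ge_zero Bc _ e1_def e2_def e3_def Q1_def])
      (use a l \<eta> u in \<open>auto simp: g_def intro!: damping_primitive_bounds(3)\<close>)
  \<comment> \<open>The exponents depend on \<open>\<gamma>\<close> but stay in bounded intervals, so that \<open>\<kappa>\<close> dominates all
    constant factors.\<close>
  have T1: "(2 powr (p - 1) * Z) powr e1 \<gamma> * (V z / 4) powr (1 - e1 \<gamma>) \<le> \<kappa> * (space_weight n k z powr e1 \<gamma> * V z powr (1 - e1 \<gamma>))"
  proof -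
    have "(2 powr (p - 1) * Z) powr e1 \<gamma> * (V z / 4) powr (1 - e1 \<gamma>)
      = ((2 powr (p - 1) * c2) powr e1 \<gamma> * 4 powr (e1 \<gamma> - 1)) * (space_weight n k z powr e1 \<gamma> * V z powr (1 - e1 \<gamma>))"
      using v by (simp add: Z_def powr_mult powr_divide powr_diff field_simps)
    also have "\<dots> \<le> \<kappa> * (space_weight n k z powr e1 \<gamma> * V z powr (1 - e1 \<gamma>))"
    proof (rule mult_right_mono)
      have "(2 powr (p - 1) * c2) powr e1 \<gamma> * 4 powr (e1 \<gamma> - 1) \<le> (1 + 2 powr (p - 1) * c2) powr Q2 * 4 powr Q2"
        using c_pos ex by (intro mult_mono powr_le_powr_1_plus powr_mono) auto
      also have "\<dots> \<le> \<kappa>" using c_pos by (simp add: \<kappa>_def)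
      finally show "(2 powr (p - 1) * c2) powr e1 \<gamma> * 4 powr (e1 \<gamma> - 1) \<le> \<kappa>" .
    qed simp
    finally show ?thesis .
  qed
  have T3: "(4 * B) powr e3 \<gamma> * (V z / 4) powr (1 - e3 \<gamma>) \<le> \<kappa> * (time_weight n k z powr e3 \<gamma> * V z powr (1 - e3 \<gamma>))"
  proof -
    have "(4 * B) powr e3 \<gamma> * (V z / 4) powr (1 - e3 \<gamma>)
      = ((4 * c3) powr e3 \<gamma> * 4 powr (e3 \<gamma> - 1)) * (time_weight n k z powr e3 \<gamma> * V z powr (1 - e3 \<gamma>))"
      using v by (simp add: B_def powr_mult powr_divide powr_diff field_simps)
    also have "\<dots> \<le> \<kappa> * (time_weight n k z powr e3 \<gamma> * V z powr (1 - e3 \<gamma>))"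
    proof (rule mult_right_mono)
      have "(4 * c3) powr e3 \<gamma> * 4 powr (e3 \<gamma> - 1) \<le> (1 + 4 * c3) powr Q1 * 4 powr Q1"
        using c_pos ex by (intro mult_mono powr_le_powr_1_plus powr_mono) auto
      also have "\<dots> \<le> \<kappa>" using c_pos by (simp add: \<kappa>_def)
      finally show "(4 * c3) powr e3 \<gamma> * 4 powr (e3 \<gamma> - 1) \<le> \<kappa>" .
    qed simp
    finally show ?thesis .
  qed
  have T2: "(l powr (1 - p) * 4 powr (p - 1) * Z) powr e2 \<gamma> * (\<mu> * V z) powr (1 - e2 \<gamma>)
    \<le> \<kappa> * (l powr - m0 * (\<mu> powr (1 - Q2) + \<mu> powr (- Q2)) * (space_weight n k z powr e2 \<gamma> * V z powr (1 - e2 \<gamma>)))"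
  proof -
    have "(l powr (1 - p) * 4 powr (p - 1) * Z) powr e2 \<gamma> * (\<mu> * V z) powr (1 - e2 \<gamma>)
      = (4 powr (p - 1) * c2) powr e2 \<gamma> * (l powr ((1 - p) * e2 \<gamma>) * \<mu> powr (1 - e2 \<gamma>)) * (space_weight n k z powr e2 \<gamma> * V z powr (1 - e2 \<gamma>))"
      by (simp add: Z_def powr_mult powr_powr mult_ac)
    also have "\<dots> \<le> \<kappa> * (l powr - m0 * (\<mu> powr (1 - Q2) + \<mu> powr (- Q2))) * (space_weight n k z powr e2 \<gamma> * V z powr (1 - e2 \<gamma>))"
    proof (intro mult_right_mono mult_mono)
      have "(4 powr (p - 1) * c2) powr e2 \<gamma> \<le> (1 + 4 powr (p - 1) * c2) powr (Q2 + 1)"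
        using c_pos ex Q_gt by (intro powr_le_powr_1_plus) auto
      also have "\<dots> \<le> \<kappa>" using c_pos by (simp add: \<kappa>_def)
      finally show "(4 powr (p - 1) * c2) powr e2 \<gamma> \<le> \<kappa>" .
      have "(p - 1) * e2 \<gamma> \<le> m0" unfolding m0_def using ex p by (intro mult_left_mono) auto
      then show "l powr ((1 - p) * e2 \<gamma>) \<le> l powr - m0" using l by (intro powr_mono') (auto simp: algebra_simps)
      show "\<mu> powr (1 - e2 \<gamma>) \<le> \<mu> powr (1 - Q2) + \<mu> powr (- Q2)"
        using \<mu> ex by (intro powr_between) auto
      show "0 \<le> \<kappa>" using c_pos by (simp add: \<kappa>_def)
    qed auto
    finally show ?thesis by (simp only: mult_ac)
  qed
  have T4: "B powr Q1 * (\<mu> * V z) powr (1 - Q1) \<le> \<kappa> * (\<mu> powr (1 - Q1) * (time_weight n k z powr Q1 * V z powr (1 - Q1)))"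
  proof -
    have "B powr Q1 * (\<mu> * V z) powr (1 - Q1) = c3 powr Q1 * (\<mu> powr (1 - Q1) * (time_weight n k z powr Q1 * V z powr (1 - Q1)))"
      by (simp add: B_def powr_mult mult_ac)
    also have "\<dots> \<le> \<kappa> * (\<mu> powr (1 - Q1) * (time_weight n k z powr Q1 * V z powr (1 - Q1)))"
    proof (rule mult_right_mono)
      have "c3 powr Q1 \<le> (1 + c3) powr Q1" using c_pos Q_gt by (intro powr_mono2) auto
      also have "\<dots> \<le> \<kappa>" using c_pos by (simp add: \<kappa>_def)
      finally show "c3 powr Q1 \<le> \<kappa>" .
    qed simp
    finally show ?thesis .
  qed
  have T5: "Z * (l * (2 * \<eta>) powr (p - 1 - \<gamma>) + l powr (1 - p) * (2 * \<eta>) powr ((1 + \<gamma>) * (p - 1)))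
         + B * (\<eta> + 2 * l * (2 * \<eta>) powr (1 - \<gamma>)) \<le> (Z + B) * remainder \<gamma> l \<eta>"
  proof -
    have "Z * r1 + B * r2 \<le> (Z + B) * (r1 + r2)" if "r1 \<ge> 0" "r2 \<ge> 0" for r1 r2
      using that Z0 by (simp add: algebra_simps)
    then show ?thesis unfolding remainder_def using l \<eta> by simp
  qed
  have tm: "l * (\<kappa> * (space_weight n k z powr e1 \<gamma> * V z powr (1 - e1 \<gamma>)))
      + \<kappa> * (l powr - m0 * (\<mu> powr (1 - Q2) + \<mu> powr (- Q2)) * (space_weight n k z powr e2 \<gamma> * V z powr (1 - e2 \<gamma>)))
      + l * (\<kappa> * (time_weight n k z powr e3 \<gamma> * V z powr (1 - e3 \<gamma>)))
      + \<kappa> * (\<mu> powr (1 - Q1) * (time_weight n k z powr Q1 * V z powr (1 - Q1))) = \<kappa> * terms n k l \<mu> z"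
    unfolding terms_def \<gamma>_def distrib_left by (simp only: mult_ac)
  have lT: "l * ((2 powr (p - 1) * Z) powr e1 \<gamma> * (V z / 4) powr (1 - e1 \<gamma>)) \<le> l * (\<kappa> * (space_weight n k z powr e1 \<gamma> * V z powr (1 - e1 \<gamma>)))"
    "l * ((4 * B) powr e3 \<gamma> * (V z / 4) powr (1 - e3 \<gamma>)) \<le> l * (\<kappa> * (time_weight n k z powr e3 \<gamma> * V z powr (1 - e3 \<gamma>)))"
    using T1 T3 l by (auto intro: mult_left_mono)
  have h0: "damping l \<gamma> \<eta> (u z) = 1 + l * y powr (- \<gamma>)" "damping' l \<gamma> \<eta> (u z) = - (l * \<gamma> * y powr (- \<gamma> - 1))"
    using l a \<eta> by (simp_all add: damping_def damping'_def y_def)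
  have hpos: "0 \<le> 1 + l * y powr (- \<gamma>)" using l by (simp add: add_nonneg_nonneg)
  have H0: "0 \<le> damping_primitive l \<gamma> \<eta> (u z)" using l a \<eta> u by (intro damping_primitive_bounds(1)) auto
  have flux: "(1 + l * y powr (- \<gamma>)) * (g powr (p - 2) * (fst (G z) \<bullet> Px)) \<le> (1 + l * y powr (- \<gamma>)) * (g powr (p - 1) * norm Px)"
  proof (rule mult_left_mono[OF _ hpos])
    have "g powr (p - 2) * (fst (G z) \<bullet> Px) = (g powr (p - 2) *\<^sub>R fst (G z)) \<bullet> Px" by simp
    also have "\<dots> \<le> norm (g powr (p - 2) *\<^sub>R fst (G z)) * norm Px" by (rule norm_cauchy_schwarz)
    also have "norm (g powr (p - 2) *\<^sub>R fst (G z)) = g powr (p - 1)" unfolding g_def by (rule norm_flux[OF p])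
    finally show "g powr (p - 2) * (fst (G z) \<bullet> Px) \<le> g powr (p - 1) * norm Px" .
  qed
  have "damping_primitive l \<gamma> \<eta> (u z) * (- Pt) \<le> damping_primitive l \<gamma> \<eta> (u z) * \<bar>Pt\<bar>" using H0 by (intro mult_left_mono) auto
  then have HP: "- (damping_primitive l \<gamma> \<eta> (u z) * Pt) \<le> damping_primitive l \<gamma> \<eta> (u z) * \<bar>Pt\<bar>" by simp
  have lhs: "mass z * \<phi> ^ cutoff_power - (V z * u z powr q * damping l \<gamma> \<eta> (u z) * \<phi> ^ cutoff_power
      - (damping' l \<gamma> \<eta> (u z) * \<phi> ^ cutoff_power * norm (fst (G z)) powr p
        + damping l \<gamma> \<eta> (u z) * (norm (fst (G z)) powr (p - 2) * (fst (G z) \<bullet> Px))) + damping_primitive l \<gamma> \<eta> (u z) * Pt)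
    = (1 + l * y powr (- \<gamma>)) * (g powr (p - 2) * (fst (G z) \<bullet> Px)) - damping_primitive l \<gamma> \<eta> (u z) * Pt
      - l * V z * u z powr q * y powr (- \<gamma>) * \<phi> powr real cutoff_power
      - l * \<gamma> * y powr (- \<gamma> - 1) * g powr p * \<phi> powr real cutoff_power"
    unfolding h0 Rs g_def[symmetric] mass_def by (simp add: algebra_simps)
  show ?thesis
    unfolding lhs
    using flux HP abs1 lT T2 T4 T5 tm unfolding Rs mass_def Z_def[symmetric] B_def[symmetric]
    by (simp add: mult_ac)
qed

end

section \<open>The estimate for the mass\<close>

context weighted_problem begin

text \<open>A crude bound for the weights on the annuli used at stage \<open>n\<close>. It multiplies the remainder, which
  tends to zero with \<open>\<eta>\<close> while \<open>n\<close> is fixed, so that its dependence on \<open>n\<close> is harmless.\<close>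

definition "weight_cap n = c2 * (2 powr (real (2 * n + 1) * \<theta>2)) powr ((\<theta>2 + 1) * p / \<theta>2) + c3 * (1 + 2 powr (real (2 * n + 1) * \<theta>2))" for n :: nat

lemma weight_cap:
  assumes z: "z \<in> R k" "z \<in> D" and k: "k \<le> 2 * n" and n: "n \<ge> 1"
  shows "c2 * space_weight n k z + c3 * time_weight n k z \<le> weight_cap n"
proof -
  let ?d = "bdist \<Omega> (fst z)" and ?T = "2 powr (real (2 * n + 1) * \<theta>2)"
  have "?d powr - \<theta>2 + snd z powr \<theta>1 \<le> ((1/2) ^ k / 2) powr - \<theta>2"
    using z(1) by (auto simp: E_set_def)
  also have "\<dots> = 2 powr (real (Suc k) * \<theta>2)" using half_powr[of "Suc k" \<theta>2] by simp
  also have "\<dots> \<le> ?T" using k \<theta> by (intro powr_mono mult_right_mono) auto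
  finally have T: "?d powr - \<theta>2 + snd z powr \<theta>1 \<le> ?T" .
  have dT: "?d powr - \<theta>2 \<le> ?T" using T powr_ge_zero[of "snd z" \<theta>1] by linarith
  have tT: "snd z powr \<theta>1 \<le> ?T" using T powr_ge_zero[of ?d "- \<theta>2"] by linarith
  have space_factor: "space_factor z \<le> ?T powr ((\<theta>2 + 1) * p / \<theta>2)"
  proof -
    have "- \<theta>2 * ((\<theta>2 + 1) * p / \<theta>2) = - (\<theta>2 + 1) * p"
      unfolding mult_minus_left using \<theta> by simp
    then have "space_factor z = (?d powr - \<theta>2) powr ((\<theta>2 + 1) * p / \<theta>2)"
      unfolding space_factor_def powr_powr by (simp only:)
    also have "\<dots> \<le> ?T powr ((\<theta>2 + 1) * p / \<theta>2)" using dT \<theta> p by (intro powr_mono2) auto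
    finally show ?thesis .
  qed
  have time_factor: "time_factor z \<le> 1 + ?T"
    using powr_le_1_plus[of "snd z" "\<theta>1 - 1" \<theta>1] z(2) \<theta> tT by (simp add: time_factor_def)
  have le1: "1 / real n * 2 powr (- real k * a) \<le> 1" if "a \<ge> 0" for a
  proof -
    have "2 powr (- real k * a) \<le> 2 powr 0" using that by (intro powr_mono) auto
    then have "1 / real n * 2 powr (- real k * a) \<le> 1 * 1" using n by (intro mult_mono) auto
    then show ?thesis by simp
  qed
  have "space_weight n k z \<le> 1 * (?T powr ((\<theta>2 + 1) * p / \<theta>2))" unfolding space_weight_def
    using le1[of "p * \<theta>2"] space_factor p \<theta> by (intro mult_mono) (auto simp: space_factor_def)
  moreover have "time_weight n k z \<le> 1 * (1 + ?T)" unfolding time_weight_def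
    using le1[of \<theta>2] time_factor \<theta> by (intro mult_mono) (auto simp: time_factor_def)
  ultimately show ?thesis unfolding weight_cap_def
    using c_pos by (intro add_mono mult_left_mono) auto
qed

lemma remainder_tendsto_0:
  assumes "admissible \<gamma>" "0 < l"
  shows "(remainder \<gamma> l \<longlongrightarrow> 0) (at_right 0)"
proof -
  note a = assms(1)[unfolded admissible_def]
  have pw: "((\<lambda>\<eta>. (2 * \<eta>) powr b) \<longlongrightarrow> 0) (at_right (0::real))" if "b > 0" for b
  proof (rule tendsto_zero_powrI[OF _ tendsto_const _ that])
    have "((\<lambda>\<eta>. 2 * \<eta>) \<longlongrightarrow> 2 * 0) (at_right (0::real))" by (intro tendsto_intros)
    then show "((\<lambda>\<eta>. 2 * \<eta>) \<longlongrightarrow> 0) (at_right (0::real))" by simp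
    show "\<forall>\<^sub>F \<eta> in at_right (0::real). 0 \<le> 2 * \<eta>" by (auto simp: eventually_at_filter)
  qed
  have "0 < (1 + \<gamma>) * (p - 1)" using a p by (intro mult_pos_pos) auto
  then have "(remainder \<gamma> l \<longlongrightarrow> (l * 0 + l powr (1 - p) * 0) + (0 + 2 * l * 0)) (at_right 0)"
    unfolding remainder_def[abs_def] using a by (intro tendsto_intros pw) auto
  then show ?thesis by simp
qed

definition "\<Phi>A e n k z = ennreal (space_weight n k z powr e * V z powr (1 - e)) * indicator (R k) z" for n k :: nat
definition "\<Phi>B e n k z = ennreal (time_weight n k z powr e * V z powr (1 - e)) * indicator (R k) z" for n k :: nat
definition "omega l \<mu> = l powr - m0 * (\<mu> powr (1 - Q2) + \<mu> powr (- Q2))"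

definition "annulus_terms n l \<mu> z = (\<Sum>k\<in>{n-1..2*n}. ennreal l * \<Phi>A (e1 (1 / real n)) n k z)
    + (\<Sum>k\<in>{n-1..2*n}. ennreal (omega l \<mu>) * \<Phi>A (e2 (1 / real n)) n k z)
    + (\<Sum>k\<in>{n-1..2*n}. ennreal l * \<Phi>B (e3 (1 / real n)) n k z)
    + (\<Sum>k\<in>{n-1..2*n}. ennreal (\<mu> powr (1 - Q1)) * \<Phi>B Q1 n k z)" for n :: nat

lemma \<Phi>_meas: "\<Phi>A e n k \<in> borel_measurable lebesgue" "\<Phi>B e n k \<in> borel_measurable lebesgue"
  unfolding \<Phi>A_def[abs_def] \<Phi>B_def[abs_def] by (rule weight_meas weight_borel)+

lemma annulus_terms_meas: "annulus_terms n l \<mu> \<in> borel_measurable lebesgue"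
  unfolding annulus_terms_def[abs_def]
  by (intro borel_measurable_add borel_measurable_sum borel_measurable_times_ennreal borel_measurable_const \<Phi>_meas)

lemma terms_le_annulus_terms:
  assumes "z \<in> R k" "k \<in> {n-1..2*n}" "0 \<le> l"
  shows "ennreal (terms n k l \<mu> z) \<le> annulus_terms n l \<mu> z"
proof -
  have mem: "g k \<le> sum g {n-1..2*n}" for g :: "nat \<Rightarrow> ennreal"
    using assms(2) by (intro member_le_sum) auto
  have om: "omega l \<mu> \<ge> 0" by (simp add: omega_def)
  have "ennreal (terms n k l \<mu> z) = ennreal l * \<Phi>A (e1 (1 / real n)) n k z + ennreal (omega l \<mu>) * \<Phi>A (e2 (1 / real n)) n k z
    + ennreal l * \<Phi>B (e3 (1 / real n)) n k z + ennreal (\<mu> powr (1 - Q1)) * \<Phi>B Q1 n k z"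
    using assms om unfolding terms_def omega_def[symmetric] \<Phi>A_def \<Phi>B_def
    by (simp add: ennreal_plus[symmetric] ennreal_mult[symmetric] add_nonneg_nonneg del: ennreal_plus)
  also have "\<dots> \<le> annulus_terms n l \<mu> z"
    unfolding annulus_terms_def by (intro add_mono mem)
  finally show ?thesis .
qed

lemma annuli_disjoint_E: "E_set \<Omega> \<theta>1 \<theta>2 ((1/2) ^ (n - 1)) \<inter> (\<Union>k\<in>{n-1..2*n}. R k) = {}"
proof -
  have "E_set \<Omega> \<theta>1 \<theta>2 ((1/2) ^ (n - 1)) \<subseteq> E_set \<Omega> \<theta>1 \<theta>2 ((1/2) ^ k)" if "k \<ge> n - 1" for k
  proof -
    have "2 powr (real (n - 1) * \<theta>2) \<le> 2 powr (real k * \<theta>2)"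
      using that \<theta> by (intro powr_mono mult_right_mono) auto
    then have "((1/2) ^ (n - 1)) powr - \<theta>2 \<le> ((1/2) ^ k) powr - \<theta>2" by (simp only: half_powr)
    then show ?thesis unfolding E_set_def by auto
  qed
  then show ?thesis by fastforce
qed

text \<open>The mass inside the cutoff is bounded by a small multiple of the mass in the annuli where the cutoff
  varies, plus the weights on these annuli. The cutoff does not depend on \<open>l\<close> and \<open>\<mu>\<close>, which are still free
  to be chosen.\<close>

lemma cutoff_estimate:
  assumes n: "n \<ge> 1" and adm: "admissible (1 / real n)"
  obtains \<psi> :: "'a \<times> real \<Rightarrow> real" where "\<psi> \<in> borel_measurable borel" "\<And>z. 0 \<le> \<psi> z \<and> \<psi> z \<le> 1"
    "\<And>z. z \<in> D \<Longrightarrow> z \<in> E_set \<Omega> \<theta>1 \<theta>2 ((1/2) ^ (n - 1)) \<Longrightarrow> \<psi> z = 1"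
    "(\<integral>\<^sup>+z. f z * ennreal (\<psi> z) \<partial>lebesgue) < \<infinity>"
    "\<And>l \<mu>. 0 < l \<Longrightarrow> l \<le> 1 \<Longrightarrow> 0 < \<mu> \<Longrightarrow> (\<integral>\<^sup>+z. f z * ennreal (\<psi> z) \<partial>lebesgue)
      \<le> ennreal (2 * \<mu>) * (\<integral>\<^sup>+z. f z * ennreal (\<psi> z) * indicator (\<Union>k\<in>{n-1..2*n}. R k) z \<partial>lebesgue)
        + ennreal \<kappa> * (\<integral>\<^sup>+z. annulus_terms n l \<mu> z \<partial>lebesgue)"
proof -
  let ?\<gamma> = "1 / real n"
  note a = adm[unfolded admissible_def]
  obtain \<phi> Px Pt M K where K: "compact K" "K \<subseteq> S"
    and der: "\<And>z. z \<in> D \<Longrightarrow> ((\<lambda>z. \<phi> z ^ cutoff_power) has_derivative (\<lambda>v. Px z \<bullet> fst v + Pt z * snd v)) (at z)"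
    and \<phi>01: "\<And>z. 0 \<le> \<phi> z \<and> \<phi> z \<le> 1" and bd: "\<And>z. z \<in> D \<Longrightarrow> norm (Px z) \<le> M \<and> \<bar>Pt z\<bar> \<le> M"
    and off: "\<And>z. z \<in> D \<Longrightarrow> z \<notin> K \<Longrightarrow> \<phi> z = 0 \<and> Px z = 0 \<and> Pt z = 0"
    and meas: "Px \<in> borel_measurable borel" "Pt \<in> borel_measurable borel" "\<phi> \<in> borel_measurable borel"
    and one: "\<And>z. z \<in> D \<Longrightarrow> z \<in> E_set \<Omega> \<theta>1 \<theta>2 ((1/2) ^ (n - 1)) \<Longrightarrow> \<phi> z = 1"
    and ringb: "\<And>z. z \<in> D \<Longrightarrow> Px z \<noteq> 0 \<or> Pt z \<noteq> 0 \<Longrightarrow> \<exists>k\<in>{n-1..2*n}. z \<in> R k \<and> \<phi> z > 0 \<and>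
      norm (Px z) \<le> real cutoff_power * \<phi> z ^ (cutoff_power - 1) * (\<theta>1 * 4 powr (\<theta>2 + 2) / real n * 2 powr (- real k * \<theta>2) * bdist \<Omega> (fst z) powr (- \<theta>2 - 1)) \<and>
      \<bar>Pt z\<bar> \<le> real cutoff_power * \<phi> z ^ (cutoff_power - 1) * (\<theta>1 * 4 powr (\<theta>2 + 2) / real n * 2 powr (- real k * \<theta>2) * snd z powr (\<theta>1 - 1))"
    by (rule cutoff_exists[OF \<Omega> \<theta> n cutoff_power_bounds(2)], rule that; assumption)
  have D_open: "open D" by (intro open_Collect_less continuous_intros)
  have KD: "K \<inter> D \<in> sets lebesgue"
    using K(1) D_open by (intro sets_completionI_sets) (auto simp: compact_imp_closed)
  define U where "U = (\<Union>k\<in>{n-1..2*n}. R k)"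
  have Um: "U \<in> sets lebesgue" unfolding U_def using annulus_borel by (intro sets_completionI_sets) auto
  define \<psi> where "\<psi> z = \<phi> z ^ cutoff_power" for z
  have \<psi>m [measurable]: "\<psi> \<in> borel_measurable borel" unfolding \<psi>_def[abs_def] using meas(3) by measurable
  have \<psi>ml [measurable]: "\<psi> \<in> borel_measurable lebesgue" by (rule borel_lebesgue[OF \<psi>m])
  have \<psi>01: "0 \<le> \<psi> z \<and> \<psi> z \<le> 1" for z using \<phi>01[of z] by (simp add: \<psi>_def power_le_one)
  have u_nn: "AE z in lebesgue. z \<in> S \<inter> D \<longrightarrow> u z \<ge> 0 \<and> V z > 0"
  proof -
    have "AE z in lebesgue. z \<in> \<Omega> \<times> {0<..} \<longrightarrow> u z \<ge> 0" using sol unfolding weak_solution_grad_def by blast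
    then show ?thesis using V_pos by eventually_elim force
  qed
  define g where "g z = indicator (K \<inter> D) z * (mass z * \<psi> z)" for z
  have KS: "z \<in> S" if "z \<in> K" for z using K(2) that by blast
  have g_meas: "g \<in> borel_measurable lebesgue"
  proof -
    note [measurable] = local_meas KD
    have "(\<lambda>z. indicator (K \<inter> D) z * ((indicator S z *\<^sub>R V z) * (indicator S z *\<^sub>R u z) powr q * \<psi> z)) \<in> borel_measurable lebesgue"
      by measurable
    moreover have "(\<lambda>z. indicator (K \<inter> D) z * ((indicator S z *\<^sub>R V z) * (indicator S z *\<^sub>R u z) powr q * \<psi> z)) = g"
      using KS by (auto simp: fun_eq_iff g_def mass_def indicator_def)
    ultimately show ?thesis by simp
  qed
  have g_int: "integrable lebesgue g"
  proof (rule Bochner_Integration.integrable_bound[OF _ g_meas])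
    show "integrable lebesgue (\<lambda>z. indicator K z *\<^sub>R (norm (u z) powr q * V z))"
      using sol K unfolding weak_solution_grad_def Lp_loc_def set_integrable_def by auto
    show "AE z in lebesgue. norm (g z) \<le> norm (indicator K z *\<^sub>R (norm (u z) powr q * V z))"
      using u_nn
    proof eventually_elim
      case (elim z)
      show ?case
      proof (cases "z \<in> K \<inter> D")
        case True
        then have uv: "u z \<ge> 0" "V z > 0" using elim KS by auto
        have "\<bar>mass z\<bar> * \<psi> z \<le> \<bar>mass z\<bar>" using \<psi>01[of z] by (intro mult_left_le) auto
        then show ?thesis using True uv \<psi>01[of z] by (simp add: g_def mass_def abs_mult mult.commute)
      qed (simp add: g_def)
    qed
  qed
  have g_nn: "AE z in lebesgue. g z \<ge> 0"
    using u_nn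
  proof eventually_elim
    case (elim z)
    then show ?case using \<psi>01[of z] KS[of z] by (auto simp: g_def mass_def indicator_def)
  qed
  have fg: "f z * ennreal (\<psi> z) = ennreal (g z)" for z
  proof (cases "z \<in> D \<and> z \<notin> K")
    case True
    then show ?thesis using off[of z] cutoff_power_bounds(2) by (simp add: g_def \<psi>_def)
  next
    case False
    then show ?thesis using \<psi>01[of z] KS[of z]
      by (auto simp: f_def g_def indicator_def ennreal_mult'')
  qed
  have X: "(\<integral>\<^sup>+z. f z * ennreal (\<psi> z) \<partial>lebesgue) = ennreal (LINT z|lebesgue. g z)"
    unfolding fg by (rule nn_integral_eq_integral[OF g_int g_nn])
  show thesis
  proof (rule that[of \<psi>])
    show "\<psi> \<in> borel_measurable borel" by (rule \<psi>m)
    show "0 \<le> \<psi> z \<and> \<psi> z \<le> 1" for z by (rule \<psi>01)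
    show "\<psi> z = 1" if "z \<in> D" "z \<in> E_set \<Omega> \<theta>1 \<theta>2 ((1/2) ^ (n - 1))" for z
      using one[OF that] by (simp add: \<psi>_def)
    show "(\<integral>\<^sup>+z. f z * ennreal (\<psi> z) \<partial>lebesgue) < \<infinity>" unfolding X by simp
    fix l \<mu> :: real assume l: "0 < l" "l \<le> 1" and \<mu>: "0 < \<mu>"
    define A where "A = ennreal (2 * \<mu>) * (\<integral>\<^sup>+z. f z * ennreal (\<psi> z) * indicator U z \<partial>lebesgue)
        + ennreal \<kappa> * (\<integral>\<^sup>+z. annulus_terms n l \<mu> z \<partial>lebesgue)"
    have \<kappa>0: "\<kappa> \<ge> 0" using c_pos by (simp add: \<kappa>_def)
    have cap0: "weight_cap n \<ge> 0" using c_pos by (simp add: weight_cap_def)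
    have step: "(\<integral>\<^sup>+z. f z * ennreal (\<psi> z) \<partial>lebesgue) \<le> A + ennreal (weight_cap n * remainder ?\<gamma> l \<eta>) * emeasure lebesgue K"
      if \<eta>: "0 < \<eta>" for \<eta>
    proof -
      have rem0: "remainder ?\<gamma> l \<eta> \<ge> 0" using l \<eta> by (simp add: remainder_def)
      have l0: "0 \<le> l" using l by simp
      have \<gamma>: "0 < ?\<gamma>" "?\<gamma> \<le> 1 / 2" using a by auto
      define Q where "Q z = V z * u z powr q * damping l ?\<gamma> \<eta> (u z) * \<psi> z
        - (damping' l ?\<gamma> \<eta> (u z) * \<psi> z * norm (fst (G z)) powr p
          + damping l ?\<gamma> \<eta> (u z) * (norm (fst (G z)) powr (p - 2) * (fst (G z) \<bullet> Px z))) + damping_primitive l ?\<gamma> \<eta> (u z) * Pt z" for z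
      have hh: "0 \<le> damping l ?\<gamma> \<eta> x \<and> damping l ?\<gamma> \<eta> x \<le> damping_bound l ?\<gamma> \<eta>" if "x \<ge> 0" for x
        using damping_bounds[OF l0 \<gamma> \<eta> that] by linarith
      have HH: "0 \<le> damping_primitive l ?\<gamma> \<eta> x \<and> damping_primitive l ?\<gamma> \<eta> x \<le> damping_bound l ?\<gamma> \<eta> * x" if "x \<ge> 0" for x
        using damping_primitive_bounds(1,2)[OF l0 \<gamma> \<eta> that] by blast
      have iD: "(\<lambda>z. indicator D z *\<^sub>R Px z) \<in> borel_measurable borel" "(\<lambda>z. indicator D z *\<^sub>R Pt z) \<in> borel_measurable borel"
        using meas D_open by (auto intro!: borel_measurable_scaleR borel_measurable_indicator borel_open)
      have M1: "0 \<le> \<psi> z \<and> \<psi> z \<le> max M 1" "norm (Px z) \<le> max M 1" "\<bar>Pt z\<bar> \<le> max M 1" if "z \<in> D" for z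
        using \<psi>01[of z] bd[OF that] by auto
      have off\<psi>: "\<psi> z = 0 \<and> Px z = 0 \<and> Pt z = 0" if "z \<in> D" "z \<notin> K" for z
        using off[OF that] cutoff_power_bounds(2) by (simp add: \<psi>_def)
      note E = energy_inequality[OF p \<Omega>(1) V_loc sol K damping_deriv[OF l0 \<gamma> \<eta>] damping_primitive_deriv[OF l0 \<gamma> \<eta>] hh
          damping'_bound[OF l0 \<gamma> \<eta>] HH continuous_damping'[OF l0 \<gamma> \<eta>] der[folded \<psi>_def] M1 off\<psi> iD, folded Q_def]
      have Qi: "integrable lebesgue (\<lambda>z. indicator (K \<inter> D) z * Q z)" and Q0: "(LINT z|lebesgue. indicator (K \<inter> D) z * Q z) \<le> 0"
        by (rule E; assumption)+
      define d where "d z = g z - indicator (K \<inter> D) z * Q z" for z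
      have d_int: "integrable lebesgue d" unfolding d_def using g_int Qi by auto
      \<comment> \<open>Subtracting the nonpositive energy integral only increases the mass, and the difference \<open>d\<close> has
    a pointwise bound.\<close>
      have "(LINT z|lebesgue. g z) \<le> (LINT z|lebesgue. d z)"
        unfolding d_def using Q0 g_int Qi by simp
      also have "\<dots> \<le> (LINT z|lebesgue. max 0 (d z))" using d_int by (intro integral_mono) auto
      finally have "ennreal (LINT z|lebesgue. g z) \<le> ennreal (LINT z|lebesgue. max 0 (d z))" by (rule ennreal_leI)
      also have "\<dots> = (\<integral>\<^sup>+z. ennreal (max 0 (d z)) \<partial>lebesgue)"
        using d_int by (intro nn_integral_eq_integral[symmetric]) auto
      also have "\<dots> \<le> (\<integral>\<^sup>+z. (ennreal (2 * \<mu>) * (f z * ennreal (\<psi> z) * indicator U z) + ennreal \<kappa> * annulus_terms n l \<mu> z)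
          + ennreal (weight_cap n * remainder ?\<gamma> l \<eta>) * indicator K z \<partial>lebesgue)"
      proof (rule nn_integral_mono_AE)
        show "AE z in lebesgue. ennreal (max 0 (d z)) \<le> (ennreal (2 * \<mu>) * (f z * ennreal (\<psi> z) * indicator U z) + ennreal \<kappa> * annulus_terms n l \<mu> z)
          + ennreal (weight_cap n * remainder ?\<gamma> l \<eta>) * indicator K z"
          using u_nn
        proof eventually_elim
          case (elim z)
          show ?case
          proof (cases "z \<in> K \<inter> D")
            case True
            then have uv: "u z \<ge> 0" "V z > 0" using elim KS by auto
            have dz: "d z = mass z * \<psi> z - Q z" using True by (simp add: d_def g_def)
            have mass0: "0 \<le> mass z * \<psi> z" using uv \<psi>01[of z] by (simp add: mass_def)
            show ?thesis
            proof (cases "Px z \<noteq> 0 \<or> Pt z \<noteq> 0")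
              case False
              have "mass z * \<psi> z * 1 \<le> mass z * \<psi> z * damping l ?\<gamma> \<eta> (u z)"
                using damping_bounds[OF l0 \<gamma> \<eta> uv(1)] mass0 by (intro mult_left_mono) auto
              moreover have "damping' l ?\<gamma> \<eta> (u z) * \<psi> z * norm (fst (G z)) powr p \<le> 0"
                using l \<gamma> \<eta> uv \<psi>01[of z] unfolding damping'_def[OF l0 \<gamma> \<eta>] by (simp add: mult_nonpos_nonneg)
              ultimately have "d z \<le> 0" unfolding dz Q_def using False by (simp add: mass_def mult_ac)
              then show ?thesis by (simp add: max_def)
            next
              case nz: True
              obtain k where k: "k \<in> {n-1..2*n}" "z \<in> R k" "\<phi> z > 0" and
                bk: "norm (Px z) \<le> real cutoff_power * \<phi> z ^ (cutoff_power - 1) * (c1 / real n * 2 powr (- real k * \<theta>2) * bdist \<Omega> (fst z) powr (- \<theta>2 - 1))"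
                "\<bar>Pt z\<bar> \<le> real cutoff_power * \<phi> z ^ (cutoff_power - 1) * (c1 / real n * 2 powr (- real k * \<theta>2) * snd z powr (\<theta>1 - 1))"
                using ringb[of z] True nz unfolding c1_def by blast
              have zU: "z \<in> U" using k unfolding U_def by blast
              have t0: "0 \<le> terms n k l \<mu> z" using l weight_nonneg by (simp add: terms_def)
              have "d z \<le> 2 * \<mu> * (mass z * \<psi> z) + \<kappa> * terms n k l \<mu> z + (c2 * space_weight n k z + c3 * time_weight n k z) * remainder ?\<gamma> l \<eta>"
                unfolding dz Q_def \<psi>_def
                by (rule pointwise_estimate[OF n adm l \<mu> \<eta> uv(2,1) k(3) _ bk]) (use \<phi>01 in auto)
              also have "\<dots> \<le> 2 * \<mu> * (mass z * \<psi> z) + \<kappa> * terms n k l \<mu> z + weight_cap n * remainder ?\<gamma> l \<eta>"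
                using weight_cap[OF k(2), of n] True k(1) n rem0 by (intro add_left_mono mult_right_mono) auto
              finally have "max 0 (d z) \<le> \<dots>" using mass0 t0 \<kappa>0 \<mu> cap0 rem0 by (auto intro!: add_nonneg_nonneg)
              then have "ennreal (max 0 (d z)) \<le> ennreal (2 * \<mu> * (mass z * \<psi> z) + \<kappa> * terms n k l \<mu> z + weight_cap n * remainder ?\<gamma> l \<eta>)"
                by (rule ennreal_leI)
              also have "\<dots> = ennreal (2 * \<mu>) * ennreal (mass z * \<psi> z) + ennreal \<kappa> * ennreal (terms n k l \<mu> z) + ennreal (weight_cap n * remainder ?\<gamma> l \<eta>)"
                using mass0 t0 \<kappa>0 \<mu> cap0 rem0 by (simp add: ennreal_plus[symmetric] ennreal_mult[symmetric] del: ennreal_plus)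
              also have "ennreal (mass z * \<psi> z) = f z * ennreal (\<psi> z) * indicator U z"
                unfolding fg using True zU by (simp add: g_def)
              also have "ennreal (2 * \<mu>) * (f z * ennreal (\<psi> z) * indicator U z) + ennreal \<kappa> * ennreal (terms n k l \<mu> z) + ennreal (weight_cap n * remainder ?\<gamma> l \<eta>)
                \<le> ennreal (2 * \<mu>) * (f z * ennreal (\<psi> z) * indicator U z) + ennreal \<kappa> * annulus_terms n l \<mu> z + ennreal (weight_cap n * remainder ?\<gamma> l \<eta>) * indicator K z"
                using True terms_le_annulus_terms[OF k(2,1) l0] by (intro add_mono mult_left_mono) auto
              finally show ?thesis .
            qed
          qed (simp add: d_def g_def)
        qed
      qed
      also have "\<dots> = A + ennreal (weight_cap n * remainder ?\<gamma> l \<eta>) * emeasure lebesgue K"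
      proof -
        have [measurable]: "f \<in> borel_measurable lebesgue" "annulus_terms n l \<mu> \<in> borel_measurable lebesgue" "U \<in> sets lebesgue" "K \<in> sets lebesgue"
          using f_meas annulus_terms_meas Um K(1) by (auto simp: compact_imp_closed)
        show ?thesis unfolding A_def
          by (simp add: nn_integral_add nn_integral_cmult nn_integral_cmult_indicator)
      qed
      finally show ?thesis unfolding X .
    qed
    have "(\<integral>\<^sup>+z. f z * ennreal (\<psi> z) \<partial>lebesgue) \<le> A"
    proof (rule ennreal_le_epsilon)
      fix e :: real assume e: "0 < e"
      define m where "m = weight_cap n * measure lebesgue K"
      have Kfin: "emeasure lebesgue K = ennreal (measure lebesgue K)"
        using emeasure_compact_finite[OF K(1)] K(1)
        by (intro emeasure_eq_ennreal_measure) (auto simp: compact_imp_closed)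
      have "((\<lambda>\<eta>. m * remainder ?\<gamma> l \<eta>) \<longlongrightarrow> m * 0) (at_right 0)"
        by (intro tendsto_mult tendsto_const remainder_tendsto_0 adm l)
      then have "\<forall>\<^sub>F \<eta> in at_right 0. m * remainder ?\<gamma> l \<eta> < e" using e by (intro order_tendstoD(2)) auto
      then have "\<forall>\<^sub>F \<eta> in at_right 0. m * remainder ?\<gamma> l \<eta> < e \<and> \<eta> > 0"
        using eventually_at_right_less[of 0] by eventually_elim auto
      then obtain \<eta> where \<eta>: "m * remainder ?\<gamma> l \<eta> < e" "\<eta> > 0"
        using eventually_happens'[OF trivial_limit_at_right_real] by blast
      have "remainder ?\<gamma> l \<eta> \<ge> 0" using l \<eta> by (simp add: remainder_def)
      then have "ennreal (weight_cap n * remainder ?\<gamma> l \<eta>) * emeasure lebesgue K = ennreal (m * remainder ?\<gamma> l \<eta>)"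
        unfolding Kfin m_def using cap0 by (simp add: ennreal_mult[symmetric] mult_ac)
      also have "\<dots> \<le> ennreal e" using \<eta> by (intro ennreal_leI) simp
      finally have "A + ennreal (weight_cap n * remainder ?\<gamma> l \<eta>) * emeasure lebesgue K \<le> A + ennreal e"
        by (intro add_left_mono)
      then show "(\<integral>\<^sup>+z. f z * ennreal (\<psi> z) \<partial>lebesgue) \<le> A + ennreal e"
        using step[OF \<eta>(2)] by (rule order_trans[rotated])
    qed
    then show "(\<integral>\<^sup>+z. f z * ennreal (\<psi> z) \<partial>lebesgue)
      \<le> ennreal (2 * \<mu>) * (\<integral>\<^sup>+z. f z * ennreal (\<psi> z) * indicator (\<Union>k\<in>{n-1..2*n}. R k) z \<partial>lebesgue)
        + ennreal \<kappa> * (\<integral>\<^sup>+z. annulus_terms n l \<mu> z \<partial>lebesgue)"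
      unfolding A_def U_def .
  qed
qed

end

section \<open>Vanishing of the solution\<close>

context weighted_problem begin

text \<open>About \<open>n\<close> annuli contribute \<open>O(1 / n)\<close> each, so the bound is independent of \<open>n\<close>.\<close>

lemma annulus_terms_integral:
  obtains K N where "K \<ge> 0" "\<And>n. n \<ge> N \<Longrightarrow> n \<ge> 1 \<and> admissible (1 / real n)"
    "\<And>n l \<mu>. n \<ge> N \<Longrightarrow> 0 \<le> l \<Longrightarrow> (\<integral>\<^sup>+z. annulus_terms n l \<mu> z \<partial>lebesgue) \<le> ennreal (K * (2 * l + omega l \<mu> + \<mu> powr (1 - Q1)))"
proof -
  define bA where "bA = max 1 (max (1 / (q - p + 1)) (2 * q * (p - 1) / (q - p + 1)\<^sup>2))"
  define bB where "bB = max 1 (1 / (q - 1))"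
  have mnn: "time_factor z \<ge> 0" "space_factor z \<ge> 0" for z by (simp_all add: time_factor_def space_factor_def)
  have pos: "0 \<le> p * \<theta>2" "0 \<le> \<theta>2" "1 \<le> Q2" "1 \<le> Q1" "1 \<le> bA" "1 \<le> bB" using p \<theta> Q_gt by (auto simp: bA_def bB_def)
  obtain KA NA where KA: "KA \<ge> 0" "\<And>n k e. n \<ge> NA \<Longrightarrow> k \<in> {n-1..2*n} \<Longrightarrow> \<bar>e - Q2\<bar> \<le> bA / real n \<Longrightarrow>
    (\<integral>\<^sup>+z. ennreal ((1 / real n * 2 powr (- real k * (p * \<theta>2)) * space_factor z) powr e * V z powr (1 - e)) * indicator (R k) z \<partial>lebesgue)
    \<le> ennreal (KA / real n)"
    by (rule annulus_integral_bound[OF hyp2[folded Q2_def space_factor_def] weight_meas[OF factor_borel(2)] mnn(2) c(3,4,1,2) pos(1,3,5)])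
      (assumption | blast)+
  obtain KB NB where KB: "KB \<ge> 0" "\<And>n k e. n \<ge> NB \<Longrightarrow> k \<in> {n-1..2*n} \<Longrightarrow> \<bar>e - Q1\<bar> \<le> bB / real n \<Longrightarrow>
    (\<integral>\<^sup>+z. ennreal ((1 / real n * 2 powr (- real k * \<theta>2) * time_factor z) powr e * V z powr (1 - e)) * indicator (R k) z \<partial>lebesgue)
    \<le> ennreal (KB / real n)"
    by (rule annulus_integral_bound[OF hyp1[folded Q1_def time_factor_def] weight_meas[OF factor_borel(1)] mnn(1) c(3,4,1,2) pos(2,4,6)])
      (assumption | blast)+
  have lim: "\<forall>\<^sub>F n in sequentially. b * (1 / real n) < a" if "a > 0" for a b
    using order_tendstoD(2)[OF lim_const_over_n[of b] that] by simp
  have "\<forall>\<^sub>F n in sequentially. n \<ge> 2 \<and> admissible (1 / real n)"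
  proof -
    have "0 < (1::real) / 2" "0 < p - 1" "0 < (q - p + 1) / 2" using p q by auto
    from lim[OF this(1), of 1] lim[OF this(2), of 1] lim[OF this(3), of "p - 1"]
      lim[OF zero_less_one, of "2 * q * (p - 1) / (q - p + 1)\<^sup>2"] eventually_ge_at_top[of 2]
    show ?thesis
    proof eventually_elim
      case (elim n)
      then show ?case unfolding admissible_def mult.commute[of "1 / real n"] by auto
    qed
  qed
  then obtain N1 where N1: "\<And>n. n \<ge> N1 \<Longrightarrow> n \<ge> 2 \<and> admissible (1 / real n)" by (auto simp: eventually_sequentially)
  show thesis
  proof (rule that[of "2 * (KA + KB)" "max N1 (max NA NB)"])
    show "2 * (KA + KB) \<ge> 0" using KA KB by simp
    show "n \<ge> 1 \<and> admissible (1 / real n)" if "n \<ge> max N1 (max NA NB)" for n using N1[of n] that by simp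
    fix n l \<mu> assume n: "n \<ge> max N1 (max NA NB)" and l: "0 \<le> (l::real)"
    have n2: "n \<ge> 2" and adm: "admissible (1 / real n)" using N1[of n] n by auto
    note ex = exponent_bounds[OF adm]
    have iA: "(\<integral>\<^sup>+z. (\<Sum>k\<in>{n-1..2*n}. ennreal c * \<Phi>A e n k z) \<partial>lebesgue) \<le> ennreal (c * (2 * KA))"
      if "\<bar>e - Q2\<bar> \<le> bA / real n" "c \<ge> 0" for e c
    proof -
      have "(\<integral>\<^sup>+z. (\<Sum>k\<in>{n-1..2*n}. ennreal c * \<Phi>A e n k z) \<partial>lebesgue)
        = ennreal c * (\<integral>\<^sup>+z. (\<Sum>k\<in>{n-1..2*n}. \<Phi>A e n k z) \<partial>lebesgue)"
        unfolding sum_distrib_left[symmetric] by (rule nn_integral_cmult) (intro borel_measurable_sum \<Phi>_meas)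
      also have "\<dots> \<le> ennreal c * ennreal (2 * KA)"
        unfolding \<Phi>A_def
        by (intro mult_left_mono annuli_integral_bound[OF n2 KA(1)] weight_meas weight_borel)
          (use KA(2) that n in \<open>auto simp: space_weight_def\<close>)
      finally show ?thesis using that KA by (simp add: ennreal_mult)
    qed
    have iB: "(\<integral>\<^sup>+z. (\<Sum>k\<in>{n-1..2*n}. ennreal c * \<Phi>B e n k z) \<partial>lebesgue) \<le> ennreal (c * (2 * KB))"
      if "\<bar>e - Q1\<bar> \<le> bB / real n" "c \<ge> 0" for e c
    proof -
      have "(\<integral>\<^sup>+z. (\<Sum>k\<in>{n-1..2*n}. ennreal c * \<Phi>B e n k z) \<partial>lebesgue)
        = ennreal c * (\<integral>\<^sup>+z. (\<Sum>k\<in>{n-1..2*n}. \<Phi>B e n k z) \<partial>lebesgue)"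
        unfolding sum_distrib_left[symmetric] by (rule nn_integral_cmult) (intro borel_measurable_sum \<Phi>_meas)
      also have "\<dots> \<le> ennreal c * ennreal (2 * KB)"
        unfolding \<Phi>B_def
        by (intro mult_left_mono annuli_integral_bound[OF n2 KB(1)] weight_meas weight_borel)
          (use KB(2) that n in \<open>auto simp: time_weight_def\<close>)
      finally show ?thesis using that KB by (simp add: ennreal_mult)
    qed
    have eA: "\<bar>e1 (1 / real n) - Q2\<bar> \<le> bA / real n" "\<bar>e2 (1 / real n) - Q2\<bar> \<le> bA / real n" "\<bar>e3 (1 / real n) - Q1\<bar> \<le> bB / real n"
      "\<bar>Q1 - Q1\<bar> \<le> bB / real n"
    proof -
      have mm: "b * (1 / real n) \<le> a / real n" if "b \<le> a" for a b using mult_right_mono[OF that, of "1 / real n"] by simp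
      show "\<bar>e1 (1 / real n) - Q2\<bar> \<le> bA / real n" by (rule order_trans[OF ex(3) mm]) (simp add: bA_def)
      show "\<bar>e2 (1 / real n) - Q2\<bar> \<le> bA / real n" by (rule order_trans[OF ex(6) mm]) (simp add: bA_def)
      show "\<bar>e3 (1 / real n) - Q1\<bar> \<le> bB / real n" by (rule order_trans[OF ex(9) mm]) (simp add: bB_def)
      show "\<bar>Q1 - Q1\<bar> \<le> bB / real n" using pos by simp
    qed
    have om: "omega l \<mu> \<ge> 0" "\<mu> powr (1 - Q1) \<ge> 0" by (simp_all add: omega_def)
    have mA: "(\<lambda>z. \<Sum>k\<in>{n-1..2*n}. ennreal c * \<Phi>A e n k z) \<in> borel_measurable lebesgue"
      "(\<lambda>z. \<Sum>k\<in>{n-1..2*n}. ennreal c * \<Phi>B e n k z) \<in> borel_measurable lebesgue" for c e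
      by (intro borel_measurable_sum borel_measurable_times_ennreal borel_measurable_const \<Phi>_meas)+
    have "(\<integral>\<^sup>+z. annulus_terms n l \<mu> z \<partial>lebesgue)
      = (\<integral>\<^sup>+z. (\<Sum>k\<in>{n-1..2*n}. ennreal l * \<Phi>A (e1 (1 / real n)) n k z) \<partial>lebesgue)
      + (\<integral>\<^sup>+z. (\<Sum>k\<in>{n-1..2*n}. ennreal (omega l \<mu>) * \<Phi>A (e2 (1 / real n)) n k z) \<partial>lebesgue)
      + (\<integral>\<^sup>+z. (\<Sum>k\<in>{n-1..2*n}. ennreal l * \<Phi>B (e3 (1 / real n)) n k z) \<partial>lebesgue)
      + (\<integral>\<^sup>+z. (\<Sum>k\<in>{n-1..2*n}. ennreal (\<mu> powr (1 - Q1)) * \<Phi>B Q1 n k z) \<partial>lebesgue)"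
      unfolding annulus_terms_def
      by (simp only: nn_integral_add mA borel_measurable_add)
    also have "\<dots> \<le> ennreal (l * (2 * KA)) + ennreal (omega l \<mu> * (2 * KA)) + ennreal (l * (2 * KB)) + ennreal (\<mu> powr (1 - Q1) * (2 * KB))"
      by (intro add_mono iA iB eA l om)
    also have "\<dots> = ennreal (l * (2 * KA) + omega l \<mu> * (2 * KA) + l * (2 * KB) + \<mu> powr (1 - Q1) * (2 * KB))"
      using l om KA KB by (simp add: ennreal_plus[symmetric] del: ennreal_plus)
    also have "\<dots> \<le> ennreal (2 * (KA + KB) * (2 * l + omega l \<mu> + \<mu> powr (1 - Q1)))"
    proof (rule ennreal_leI)
      have "0 \<le> l * KA" "0 \<le> l * KB" "0 \<le> omega l \<mu> * KB" "0 \<le> \<mu> powr (1 - Q1) * KA" using l om KA KB by auto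
      then show "l * (2 * KA) + omega l \<mu> * (2 * KA) + l * (2 * KB) + \<mu> powr (1 - Q1) * (2 * KB)
        \<le> 2 * (KA + KB) * (2 * l + omega l \<mu> + \<mu> powr (1 - Q1))" by (simp add: algebra_simps)
    qed
    finally show "(\<integral>\<^sup>+z. annulus_terms n l \<mu> z \<partial>lebesgue) \<le> ennreal (2 * (KA + KB) * (2 * l + omega l \<mu> + \<mu> powr (1 - Q1)))" .
  qed
qed

abbreviation "dyadic_E n \<equiv> E_set \<Omega> \<theta>1 \<theta>2 ((1/2) ^ n)"

lemma dyadic_E_mono: "n \<le> k \<Longrightarrow> dyadic_E n \<subseteq> dyadic_E k"
proof -
  assume "n \<le> k"
  then have "2 powr (real n * \<theta>2) \<le> 2 powr (real k * \<theta>2)" using \<theta> by (intro powr_mono mult_right_mono) auto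
  then have "((1/2) ^ n) powr - \<theta>2 \<le> ((1/2) ^ k) powr - \<theta>2" by (simp only: half_powr)
  then show ?thesis unfolding E_set_def by auto
qed

lemma dyadic_E_covers: assumes "z \<in> S" shows "\<exists>n. z \<in> dyadic_E n"
proof -
  let ?x = "bdist \<Omega> (fst z) powr - \<theta>2 + snd z powr \<theta>1"
  obtain n :: nat where n: "?x < 2 ^ n" using real_arch_pow[of 2 ?x] by auto
  have "2 ^ n = 2 powr real n" by (simp add: powr_realpow)
  also have "\<dots> \<le> 2 powr (real n * \<theta>2)" using \<theta> by (intro powr_mono) (auto simp: mult_le_cancel_left1)
  finally have "?x \<le> ((1/2) ^ n) powr - \<theta>2" using n by (simp add: half_powr)
  then show ?thesis using assms by (cases z) (auto simp: E_set_def)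
qed

lemma dyadic_E_lebesgue: "dyadic_E n \<in> sets lebesgue" using E_set_borel by (intro sets_completionI_sets) auto

lemma nn_integral_f_dyadic_E: "(\<integral>\<^sup>+z. f z \<partial>lebesgue) = (SUP n. \<integral>\<^sup>+z. f z * indicator (dyadic_E n) z \<partial>lebesgue)"
proof -
  have [measurable]: "f \<in> borel_measurable lebesgue" "\<And>n. dyadic_E n \<in> sets lebesgue" using f_meas dyadic_E_lebesgue by auto
  have "f z = (SUP n. f z * indicator (dyadic_E n) z)" for z
  proof (cases "z \<in> S")
    case True
    then obtain n where "z \<in> dyadic_E n" using dyadic_E_covers by blast
    then have "f z \<le> (SUP n. f z * indicator (dyadic_E n) z)" by (intro SUP_upper2[of n]) auto
    moreover have "(SUP n. f z * indicator (dyadic_E n) z) \<le> f z" by (intro SUP_least) (auto simp: indicator_def)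
    ultimately show ?thesis by (rule antisym)
  qed (simp add: f_def)
  then have "(\<integral>\<^sup>+z. f z \<partial>lebesgue) = (\<integral>\<^sup>+z. (SUP n. f z * indicator (dyadic_E n) z) \<partial>lebesgue)" by simp
  also have "\<dots> = (SUP n. \<integral>\<^sup>+z. f z * indicator (dyadic_E n) z \<partial>lebesgue)"
  proof (rule nn_integral_monotone_convergence_SUP)
    show "incseq (\<lambda>n z. f z * indicator (dyadic_E n) z)"
      using dyadic_E_mono by (auto simp: incseq_def le_fun_def indicator_def)
  qed measurable
  finally show ?thesis .
qed

text \<open>The estimates are used twice. For fixed parameters they bound the mass uniformly in \<open>n\<close>, so \<open>V u\<^sup>q\<close> is
  integrable. Then the mass in the annuli tends to zero, and what remains of the bound tends to zero as \<open>\<mu>\<close>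
  tends to infinity and \<open>l\<close> to zero, in this order.\<close>

lemma solution_vanishes: "AE z in lebesgue. z \<in> S \<inter> D \<longrightarrow> u z = 0"
proof -
  obtain K N where K: "K \<ge> 0" and N: "\<And>n. n \<ge> N \<Longrightarrow> n \<ge> 1 \<and> admissible (1 / real n)"
    and rt: "\<And>n l \<mu>. n \<ge> N \<Longrightarrow> 0 \<le> l \<Longrightarrow> (\<integral>\<^sup>+z. annulus_terms n l \<mu> z \<partial>lebesgue) \<le> ennreal (K * (2 * l + omega l \<mu> + \<mu> powr (1 - Q1)))"
    using annulus_terms_integral by metis
  have \<kappa>0: "\<kappa> \<ge> 0" using c_pos by (simp add: \<kappa>_def)
  define tail where "tail n = (\<integral>\<^sup>+z. f z * indicator (- dyadic_E (n - 1)) z \<partial>lebesgue)" for n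
  define bound where "bound l \<mu> = \<kappa> * (K * (2 * l + omega l \<mu> + \<mu> powr (1 - Q1)))" for l \<mu>
  have b0: "bound l \<mu> \<ge> 0" if "0 \<le> l" for l \<mu> using that K \<kappa>0 by (simp add: bound_def omega_def)
  have fm [measurable]: "f \<in> borel_measurable lebesgue" "\<And>n. dyadic_E n \<in> sets lebesgue" using f_meas dyadic_E_lebesgue by auto
  have key: "\<exists>X. (\<integral>\<^sup>+z. f z * indicator (dyadic_E (n - 1)) z \<partial>lebesgue) \<le> X \<and> X < \<infinity> \<and>
      (\<forall>l \<mu>. 0 < l \<longrightarrow> l \<le> 1 \<longrightarrow> 0 < \<mu> \<longrightarrow> X \<le> ennreal (2 * \<mu>) * min X (tail n) + ennreal (bound l \<mu>))"
    if n: "n \<ge> N" for n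
  proof -
    from N[OF n] have "n \<ge> 1" "admissible (1 / real n)" by auto
    from cutoff_estimate[OF this] obtain \<psi> where
      \<psi>m: "\<psi> \<in> borel_measurable borel" and \<psi>: "\<And>z. 0 \<le> \<psi> z \<and> \<psi> z \<le> 1"
      "\<And>z. z \<in> D \<Longrightarrow> z \<in> dyadic_E (n - 1) \<Longrightarrow> \<psi> z = 1"
      and fin: "(\<integral>\<^sup>+z. f z * ennreal (\<psi> z) \<partial>lebesgue) < \<infinity>"
      and est: "\<And>l \<mu>. 0 < l \<Longrightarrow> l \<le> 1 \<Longrightarrow> 0 < \<mu> \<Longrightarrow> (\<integral>\<^sup>+z. f z * ennreal (\<psi> z) \<partial>lebesgue)
      \<le> ennreal (2 * \<mu>) * (\<integral>\<^sup>+z. f z * ennreal (\<psi> z) * indicator (\<Union>k\<in>{n-1..2*n}. R k) z \<partial>lebesgue)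
        + ennreal \<kappa> * (\<integral>\<^sup>+z. annulus_terms n l \<mu> z \<partial>lebesgue)"
      by blast
    let ?X = "\<integral>\<^sup>+z. f z * ennreal (\<psi> z) \<partial>lebesgue"
    let ?Y = "\<integral>\<^sup>+z. f z * ennreal (\<psi> z) * indicator (\<Union>k\<in>{n-1..2*n}. R k) z \<partial>lebesgue"
    have "(\<integral>\<^sup>+z. f z * indicator (dyadic_E (n - 1)) z \<partial>lebesgue) \<le> ?X"
      using \<psi>(2) by (intro nn_integral_mono) (auto simp: f_def indicator_def)
    moreover have "?Y \<le> min ?X (tail n)"
    proof (rule min.boundedI)
      show "?Y \<le> ?X" by (intro nn_integral_mono) (auto simp: indicator_def)
      show "?Y \<le> tail n" unfolding tail_def
      proof (rule nn_integral_mono)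
        fix z
        have "f z * ennreal (\<psi> z) \<le> f z * 1" using \<psi>(1)[of z] by (intro mult_left_mono) auto
        then show "f z * ennreal (\<psi> z) * indicator (\<Union>k\<in>{n-1..2*n}. R k) z \<le> f z * indicator (- dyadic_E (n - 1)) z"
          using annuli_disjoint_E[of n] by (cases "z \<in> (\<Union>k\<in>{n-1..2*n}. R k)") (auto simp: indicator_def)
      qed
    qed
    moreover have "?X \<le> ennreal (2 * \<mu>) * min ?X (tail n) + ennreal (bound l \<mu>)" if "0 < l" "l \<le> 1" "0 < \<mu>" for l \<mu>
    proof -
      have "?X \<le> ennreal (2 * \<mu>) * ?Y + ennreal \<kappa> * (\<integral>\<^sup>+z. annulus_terms n l \<mu> z \<partial>lebesgue)" by (rule est[OF that])
      also have "\<dots> \<le> ennreal (2 * \<mu>) * min ?X (tail n) + ennreal \<kappa> * ennreal (K * (2 * l + omega l \<mu> + \<mu> powr (1 - Q1)))"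
        using calculation that n \<open>?Y \<le> min ?X (tail n)\<close> by (intro add_mono mult_left_mono rt) auto
      also have "ennreal \<kappa> * ennreal (K * (2 * l + omega l \<mu> + \<mu> powr (1 - Q1))) = ennreal (bound l \<mu>)"
        using \<kappa>0 unfolding bound_def by (simp add: ennreal_mult')
      finally show ?thesis .
    qed
    ultimately show ?thesis using fin by blast
  qed
  \<comment> \<open>For \<open>l = 1\<close> and \<open>\<mu> = 1/8\<close> the annuli contribute at most a quarter of the finite left-hand side,
    which can be subtracted; this bounds the mass uniformly in \<open>n\<close>.\<close>
  have fin: "(\<integral>\<^sup>+z. f z \<partial>lebesgue) < \<infinity>"
  proof -
    have le: "(\<integral>\<^sup>+z. f z * indicator (dyadic_E j) z \<partial>lebesgue) \<le> ennreal (2 * bound 1 (1/8))" for j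
    proof -
      let ?n = "max N (Suc j)"
      obtain X where X: "(\<integral>\<^sup>+z. f z * indicator (dyadic_E (?n - 1)) z \<partial>lebesgue) \<le> X" "X < \<infinity>"
        "\<forall>l \<mu>. 0 < l \<longrightarrow> l \<le> 1 \<longrightarrow> 0 < \<mu> \<longrightarrow> X \<le> ennreal (2 * \<mu>) * min X (tail ?n) + ennreal (bound l \<mu>)"
        using key[OF max.cobounded1] by blast
      have X3: "X \<le> ennreal (2 * (1/8)) * min X (tail ?n) + ennreal (bound 1 (1/8))"
        using X(3)[rule_format, of 1 "1/8"] by simp
      have "X \<le> ennreal (1/4) * X + ennreal (bound 1 (1/8))"
        using X3 by (rule order_trans) (intro add_right_mono mult_mono, auto)
      moreover obtain x where x: "X = ennreal x" "x \<ge> 0" using X(2) by (cases X) auto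
      ultimately have "x \<le> x / 4 + bound 1 (1/8)"
        using b0[of 1 "1/8"] by (simp add: ennreal_mult[symmetric] ennreal_plus[symmetric] ennreal_le_iff del: ennreal_plus)
      then have "X \<le> ennreal (2 * bound 1 (1/8))" using x b0[of 1 "1/8"] by (auto intro!: ennreal_leI)
      moreover have "(\<integral>\<^sup>+z. f z * indicator (dyadic_E j) z \<partial>lebesgue) \<le> (\<integral>\<^sup>+z. f z * indicator (dyadic_E (?n - 1)) z \<partial>lebesgue)"
      proof (rule nn_integral_mono)
        have "j \<le> ?n - 1" by (auto simp: max_def)
        from dyadic_E_mono[OF this] show "f z * indicator (dyadic_E j) z \<le> f z * indicator (dyadic_E (?n - 1)) z" for z
          by (auto simp: indicator_def)
      qed
      ultimately show ?thesis using X(1) by (meson order_trans)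
    qed
    have "(\<integral>\<^sup>+z. f z \<partial>lebesgue) \<le> ennreal (2 * bound 1 (1/8))"
      unfolding nn_integral_f_dyadic_E by (rule SUP_least) (rule le)
    then show ?thesis using le_less_trans ennreal_less_top by (metis infinity_ennreal_def)
  qed
  \<comment> \<open>The annuli escape to the boundary of the domain and to infinity in time.\<close>
  have tail0: "tail \<longlonglongrightarrow> 0"
  proof -
    have "(\<lambda>n. \<integral>\<^sup>+z. f z * indicator (- dyadic_E n) z \<partial>lebesgue) \<longlonglongrightarrow> (\<integral>\<^sup>+z. 0 \<partial>(lebesgue :: ('a \<times> real) measure))"
    proof (rule nn_integral_dominated_convergence[where w = f])
      show "AE z in lebesgue. f z * indicator (- dyadic_E n) z \<le> f z" for n by (simp add: indicator_def)
      show "AE z in lebesgue. (\<lambda>n. f z * indicator (- dyadic_E n) z) \<longlonglongrightarrow> 0"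
      proof (rule AE_I2)
        fix z
        show "(\<lambda>n. f z * indicator (- dyadic_E n) z) \<longlonglongrightarrow> 0"
        proof (cases "z \<in> S")
          case True
          then obtain j where "z \<in> dyadic_E j" using dyadic_E_covers by blast
          then have "f z * indicator (- dyadic_E n) z = 0" if "n \<ge> j" for n using dyadic_E_mono[OF that] by auto
          then show ?thesis by (intro tendsto_eventually) (auto simp: eventually_sequentially)
        qed (simp add: f_def)
      qed
      show "(\<lambda>z. f z * indicator (- dyadic_E n) z) \<in> borel_measurable lebesgue" for n by measurable
    qed (use fin fm(1) in simp_all)
    then have "(\<lambda>n. tail (Suc n)) \<longlonglongrightarrow> 0" by (simp add: tail_def)
    then show ?thesis by (rule filterlim_sequentially_Suc[THEN iffD1])
  qed
  have small: "(\<integral>\<^sup>+z. f z * indicator (dyadic_E j) z \<partial>lebesgue) \<le> ennreal (bound l \<mu>)" if l: "0 < l" "l \<le> 1" "0 < \<mu>" for j l \<mu>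
  proof -
    have "(\<lambda>n. ennreal (2 * \<mu>) * tail n + ennreal (bound l \<mu>)) \<longlonglongrightarrow> ennreal (2 * \<mu>) * 0 + ennreal (bound l \<mu>)"
      by (intro tendsto_add ennreal_tendsto_cmult tail0 tendsto_const) simp
    then have lim: "(\<lambda>n. ennreal (2 * \<mu>) * tail n + ennreal (bound l \<mu>)) \<longlonglongrightarrow> ennreal (bound l \<mu>)" by simp
    have "(\<integral>\<^sup>+z. f z * indicator (dyadic_E j) z \<partial>lebesgue) \<le> ennreal (2 * \<mu>) * tail n + ennreal (bound l \<mu>)" if n: "n \<ge> max N (Suc j)" for n
    proof -
      obtain X where X: "(\<integral>\<^sup>+z. f z * indicator (dyadic_E (n - 1)) z \<partial>lebesgue) \<le> X"
        "X \<le> ennreal (2 * \<mu>) * min X (tail n) + ennreal (bound l \<mu>)"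
        using key[of n] n l by auto
      have "(\<integral>\<^sup>+z. f z * indicator (dyadic_E j) z \<partial>lebesgue) \<le> (\<integral>\<^sup>+z. f z * indicator (dyadic_E (n - 1)) z \<partial>lebesgue)"
      proof (rule nn_integral_mono)
        have "j \<le> n - 1" using n by auto
        from dyadic_E_mono[OF this] show "f z * indicator (dyadic_E j) z \<le> f z * indicator (dyadic_E (n - 1)) z" for z
          by (auto simp: indicator_def)
      qed
      also note X(1)
      also note X(2)
      also have "ennreal (2 * \<mu>) * min X (tail n) + ennreal (bound l \<mu>) \<le> ennreal (2 * \<mu>) * tail n + ennreal (bound l \<mu>)"
        by (intro add_right_mono mult_left_mono) auto
      finally show ?thesis .
    qed
    then show ?thesis by (intro LIMSEQ_le_const[OF lim]) blast
  qed
  have zero: "(\<integral>\<^sup>+z. f z * indicator (dyadic_E j) z \<partial>lebesgue) = 0" for j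
  proof -
    have le: "(\<integral>\<^sup>+z. f z * indicator (dyadic_E j) z \<partial>lebesgue) \<le> ennreal (\<kappa> * (K * (2 * l)))" if l: "0 < l" "l \<le> 1" for l
    proof -
      \<comment> \<open>All powers of \<open>\<mu>\<close> in the bound are negative.\<close>
      have "((\<lambda>\<mu>. bound l \<mu>) \<longlongrightarrow> \<kappa> * (K * (2 * l + l powr - m0 * (0 + 0) + 0))) at_top"
        unfolding bound_def omega_def using Q_gt
        by (intro tendsto_intros tendsto_neg_powr filterlim_ident) auto
      then have "((\<lambda>\<mu>. ennreal (bound l \<mu>)) \<longlongrightarrow> ennreal (\<kappa> * (K * (2 * l)))) at_top"
        by (intro tendsto_ennrealI) simp
      moreover have "\<forall>\<^sub>F \<mu> in at_top. (\<integral>\<^sup>+z. f z * indicator (dyadic_E j) z \<partial>lebesgue) \<le> ennreal (bound l \<mu>)"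
        using eventually_gt_at_top[of 0] by eventually_elim (rule small[OF l])
      ultimately show ?thesis by (rule tendsto_lowerbound) simp
    qed
    have "((\<lambda>l. \<kappa> * (K * (2 * l))) \<longlongrightarrow> \<kappa> * (K * (2 * 0))) (at_right 0)" by (intro tendsto_intros)
    then have "((\<lambda>l. ennreal (\<kappa> * (K * (2 * l)))) \<longlongrightarrow> ennreal 0) (at_right 0)" by (intro tendsto_ennrealI) simp
    moreover have "\<forall>\<^sub>F l in at_right 0. (\<integral>\<^sup>+z. f z * indicator (dyadic_E j) z \<partial>lebesgue) \<le> ennreal (\<kappa> * (K * (2 * l)))"
      using eventually_at_right_less[of 0] eventually_at_right_real[of 0 1]
      by (auto elim!: eventually_elim2 intro!: le)
    ultimately have "(\<integral>\<^sup>+z. f z * indicator (dyadic_E j) z \<partial>lebesgue) \<le> ennreal 0"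
      by (rule tendsto_lowerbound) simp
    then show ?thesis by simp
  qed
  have "(\<integral>\<^sup>+z. f z \<partial>lebesgue) = 0" unfolding nn_integral_f_dyadic_E zero by simp
  then have "AE z in lebesgue. f z = 0" using nn_integral_0_iff_AE[OF f_meas] by simp
  moreover have "AE z in lebesgue. z \<in> \<Omega> \<times> {0<..} \<longrightarrow> u z \<ge> 0" using sol unfolding weak_solution_grad_def by blast
  ultimately show ?thesis using V_pos
  proof eventually_elim
    case (elim z)
    show ?case
    proof
      assume z: "z \<in> S \<inter> D"
      then have uv: "u z \<ge> 0" "V z > 0" using elim by force+
      have "mass z \<le> 0" using elim(1) z by (simp add: f_def ennreal_eq_0_iff)
      then have "u z powr q \<le> 0" using uv by (simp add: mass_def mult_le_0_iff)
      then show "u z = 0" by simp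
    qed
  qed
qed

end

theorem theorem2p2:
  fixes \<Omega> :: "(real ^ 'N) set"
    and V u :: "(real ^ 'N) \<times> real \<Rightarrow> real"
    and u0 :: "real ^ 'N \<Rightarrow> real"
    and p q \<theta>1 \<theta>2 C0 C \<delta>0 \<epsilon>0 s1 s2 s3 s4 :: real
  assumes "CARD('N) \<ge> 3"
    and "open \<Omega>" and "bounded \<Omega>" and "connected \<Omega>"
    and "p > 1" and "q > max (p - 1) 1"
    and "Lp_loc 1 (\<lambda>_. 1) (\<Omega> \<times> {0..}) V"
    and "AE z in lebesgue. z \<in> \<Omega> \<times> {0<..} \<longrightarrow> V z > 0"
    and "Lp_loc 1 (\<lambda>_. 1) \<Omega> u0"
    and "AE x in lebesgue. x \<in> \<Omega> \<longrightarrow> u0 x \<ge> 0"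
    and "s1 = q / (q - 1) * \<theta>2"
    and "s2 = 1 / (q - 1)"
    and "s3 = p * q / (q - p + 1) * \<theta>2"
    and "s4 = (p - 1) / (q - p + 1)"
    and "\<theta>1 \<ge> 1" and "\<theta>2 \<ge> 1" and "C0 \<ge> 0" and "C > 0"
    and "0 < \<delta>0" and "\<delta>0 < 1" and "\<epsilon>0 > 0"
    and "\<And>\<delta> \<epsilon>. 0 < \<delta> \<Longrightarrow> \<delta> < \<delta>0 \<Longrightarrow> 0 < \<epsilon> \<Longrightarrow> \<epsilon> < \<epsilon>0 \<Longrightarrow>
      (\<integral>\<^sup>+z\<in>E_set \<Omega> \<theta>1 \<theta>2 (\<delta> / 2) - E_set \<Omega> \<theta>1 \<theta>2 \<delta>.
          ennreal (snd z powr ((\<theta>1 - 1) * (q / (q - 1) - \<epsilon>))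
            * V z powr (- 1 / (q - 1) + \<epsilon>)) \<partial>lebesgue)
        \<le> ennreal (C * \<delta> powr (- s1 - C0 * \<epsilon>) * \<bar>ln \<delta>\<bar> powr s2)"
    and "\<And>\<delta> \<epsilon>. 0 < \<delta> \<Longrightarrow> \<delta> < \<delta>0 \<Longrightarrow> 0 < \<epsilon> \<Longrightarrow> \<epsilon> < \<epsilon>0 \<Longrightarrow>
      (\<integral>\<^sup>+z\<in>E_set \<Omega> \<theta>1 \<theta>2 (\<delta> / 2) - E_set \<Omega> \<theta>1 \<theta>2 \<delta>.
          ennreal (snd z powr ((\<theta>1 - 1) * (q / (q - 1) + \<epsilon>))
            * V z powr (- 1 / (q - 1) - \<epsilon>)) \<partial>lebesgue)
        \<le> ennreal (C * \<delta> powr (- s1 - C0 * \<epsilon>) * \<bar>ln \<delta>\<bar> powr s2)"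
    and "\<And>\<delta> \<epsilon>. 0 < \<delta> \<Longrightarrow> \<delta> < \<delta>0 \<Longrightarrow> 0 < \<epsilon> \<Longrightarrow> \<epsilon> < \<epsilon>0 \<Longrightarrow>
      (\<integral>\<^sup>+z\<in>E_set \<Omega> \<theta>1 \<theta>2 (\<delta> / 2) - E_set \<Omega> \<theta>1 \<theta>2 \<delta>.
          ennreal (bdist \<Omega> (fst z) powr (- (\<theta>2 + 1) * p * (q / (q - p + 1) - \<epsilon>))
            * V z powr (- (p - 1) / (q - p + 1) + \<epsilon>)) \<partial>lebesgue)
        \<le> ennreal (C * \<delta> powr (- s3 - C0 * \<epsilon>) * \<bar>ln \<delta>\<bar> powr s4)"
    and "\<And>\<delta> \<epsilon>. 0 < \<delta> \<Longrightarrow> \<delta> < \<delta>0 \<Longrightarrow> 0 < \<epsilon> \<Longrightarrow> \<epsilon> < \<epsilon>0 \<Longrightarrow>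
      (\<integral>\<^sup>+z\<in>E_set \<Omega> \<theta>1 \<theta>2 (\<delta> / 2) - E_set \<Omega> \<theta>1 \<theta>2 \<delta>.
          ennreal (bdist \<Omega> (fst z) powr (- (\<theta>2 + 1) * p * (q / (q - p + 1) + \<epsilon>))
            * V z powr (- (p - 1) / (q - p + 1) - \<epsilon>)) \<partial>lebesgue)
        \<le> ennreal (C * \<delta> powr (- s3 - C0 * \<epsilon>) * \<bar>ln \<delta>\<bar> powr s4)"
    and "weak_solution p q \<Omega> V u0 u"
  shows "AE z in lebesgue. z \<in> \<Omega> \<times> {0..} \<longrightarrow> u z = 0"
proof -
  have p: "p > 1" and q: "q > p - 1" "q > 1" using assms(5,6) by auto
  obtain G where G: "weak_solution_grad p q \<Omega> V u0 u G"
    using assms(26) unfolding weak_solution_iff_grad by blast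
  interpret weighted_problem p q \<theta>1 \<theta>2 C C0 \<delta>0 \<epsilon>0 \<Omega> V u u0 G
  proof
    have s: "- 1 / (q - 1) = 1 - q / (q - 1)" "s1 = \<theta>2 * (q / (q - 1))" "s2 = q / (q - 1) - 1"
      using q assms(11,12) by (simp_all add: field_simps)
    fix \<delta> e assume \<delta>: "0 < \<delta>" "\<delta> < \<delta>0" and e: "e \<noteq> q / (q - 1)" "\<bar>e - q / (q - 1)\<bar> < \<epsilon>0"
    show "(\<integral>\<^sup>+z\<in>E_set \<Omega> \<theta>1 \<theta>2 (\<delta> / 2) - E_set \<Omega> \<theta>1 \<theta>2 \<delta>. ennreal ((snd z powr (\<theta>1 - 1)) powr e * V z powr (1 - e)) \<partial>lebesgue)
        \<le> ennreal (C * \<delta> powr (- (\<theta>2 * (q / (q - 1))) - C0 * \<bar>e - q / (q - 1)\<bar>) * \<bar>ln \<delta>\<bar> powr (q / (q - 1) - 1))"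
    proof (cases "e < q / (q - 1)")
      case True
      then show ?thesis using assms(22)[OF \<delta>, of "q / (q - 1) - e"] e unfolding s
        by (simp add: powr_powr abs_if algebra_simps)
    next
      case False
      then show ?thesis using assms(23)[OF \<delta>, of "e - q / (q - 1)"] e unfolding s
        by (simp add: powr_powr abs_if algebra_simps)
    qed
  next
    have s: "- (p - 1) / (q - p + 1) = 1 - q / (q - p + 1)" "s3 = p * \<theta>2 * (q / (q - p + 1))" "s4 = q / (q - p + 1) - 1"
      using q assms(13,14) by (simp_all add: field_simps)
    fix \<delta> e assume \<delta>: "0 < \<delta>" "\<delta> < \<delta>0" and e: "e \<noteq> q / (q - p + 1)" "\<bar>e - q / (q - p + 1)\<bar> < \<epsilon>0"
    show "(\<integral>\<^sup>+z\<in>E_set \<Omega> \<theta>1 \<theta>2 (\<delta> / 2) - E_set \<Omega> \<theta>1 \<theta>2 \<delta>. ennreal ((bdist \<Omega> (fst z) powr (- (\<theta>2 + 1) * p)) powr e * V z powr (1 - e)) \<partial>lebesgue)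
        \<le> ennreal (C * \<delta> powr (- (p * \<theta>2 * (q / (q - p + 1))) - C0 * \<bar>e - q / (q - p + 1)\<bar>) * \<bar>ln \<delta>\<bar> powr (q / (q - p + 1) - 1))"
    proof (cases "e < q / (q - p + 1)")
      case True
      then show ?thesis using assms(24)[OF \<delta>, of "q / (q - p + 1) - e"] e unfolding s
        by (simp add: powr_powr abs_if algebra_simps)
    next
      case False
      then show ?thesis using assms(25)[OF \<delta>, of "e - q / (q - p + 1)"] e unfolding s
        by (simp add: powr_powr abs_if algebra_simps)
    qed
  qed (use p q assms G in auto)
  show ?thesis
    using solution_vanishes AE_snd_neq_0
  proof eventually_elim
    case (elim z)
    then show ?case by (cases z) auto
  qed
qed

end
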